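(* Consider the system $\dot x=f(x)+g(x)u+D\varepsilon_T$ with disturbance generated by $\dot\varepsilon_T=S\varepsilon_T$, where: the system is stabilizable, $f(0)=0$, and $f,g$ are locally Lipschitz; $S\in\mathbb{R}^{d\times d}$ is unknown with all eigenvalues on the imaginary axis; and $D\in\mathbb{R}^{n\times d}$ has full column rank. Let $a>0$, let $\Gamma\in\mathbb{R}^{d^2\times d^2}$ be symmetric positive definite, and put $F=D^{+}$. Let $\varepsilon,\bar\varepsilon,\rho,h,l$ be the filtered signals defined in the context, and consider the disturbance observer $$\hat\varepsilon_T=(\hat S+aI_d)\varepsilon+\hat\rho_\Delta,\qquad \dot{\hat\rho}_\Delta=-a\hat\rho_\Delta,\quad \hat\rho_\Delta(0)=\hat\varepsilon_T(0),$$ the auxiliary dynamics $$\hat x=\phi^{*}h+a\,l+\hat{\bar\varepsilon}+\rho,\qquad \dot{\hat\varepsilon}=-a\hat\varepsilon+\hat\varepsilon_T,\qquad \hat{\bar\varepsilon}=D\hat\varepsilon,$$ and, with $\tilde e=x-\hat x$, the adaptive law $$\dot{\hat S}_{vec}=\Gamma\,(\bar\varepsilon^{T}F^{T}\otimes D)^{T}\tilde e .$$ Then the disturbance estimation error $\tilde\varepsilon_T=\varepsilon_T-\hat\varepsilon_T$ converges to zero: $\tilde\varepsilon_T(t)\to0$ as $t\to\infty$.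
   Context: Setting: $x(t)\in\mathbb{R}^n$ is the measured state, defined for all $t\ge0$; $f:\mathbb{R}^n\to\mathbb{R}^n$ and $g:\mathbb{R}^n\to\mathbb{R}^{n\times m}$ are known, $g(x)$ has full column rank; $u\in\mathbb{R}^m$ is the control input; $\varepsilon_T(t)\in\mathbb{R}^d$ is the unmeasured disturbance. Parametrization: $f(x)=\theta^{*}\xi(x)$ and $g(x)=\psi^{*}\zeta(x)$ with known constant matrices $\theta^{*}\in\mathbb{R}^{n\times p_\theta}$, $\psi^{*}\in\mathbb{R}^{n\times p_\psi}$ and known basis functions $\xi(x)\in\mathbb{R}^{p_\theta}$, $\zeta(x)\in\mathbb{R}^{p_\psi\times m}$. Put $\phi^{*}=[\theta^{*}\ \psi^{*}]$ and $z(x,u)=[\xi(x)^T\ \ u^T\zeta(x)^T]^T$, so $\dot x=\phi^{*}z(x,u)+D\varepsilon_T$. Filtered signals: $\dot h=-ah+z(x,u)$, $h(0)=0$; $\dot l=-al+x$, $l(0)=0$; $\dot\rho=-a\rho$, $\rho(0)=x(0)$; $\dot\varepsilon=-a\varepsilon+\varepsilon_T$, $\varepsilon(0)=0$; $\bar\varepsilon=D\varepsilon$. These satisfy $x=\phi^{*}h+a\,l+\bar\varepsilon+\rho$, so $\bar\varepsilon$ and $\varepsilon=D^{+}\bar\varepsilon$ are available from the measured state. Notation: $D^{+}=(D^TD)^{-1}D^T$ is the pseudoinverse; $\otimes$ is the Kronecker product; $A_{vec}$ is the vector obtained by stacking the columns of $A$, so that $(\bar\varepsilon^TF^T\otimes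 D)A_{vec}=DAF\bar\varepsilon$ for $A\in\mathbb{R}^{d\times d}$; $\hat S(t)\in\mathbb{R}^{d\times d}$ is the estimate of $S$. Initial values $\hat S(0)$, $\hat\varepsilon(0)$, $\hat\varepsilon_T(0)$ are arbitrary. *)

theory Defs
  imports "HOL-Analysis.Analysis"
begin

definition symmetric_matrix :: "real^'n^'n \<Rightarrow> bool"
  where "symmetric_matrix A \<longleftrightarrow> transpose A = A"

definition positive_definite :: "real^'n^'n \<Rightarrow> bool"
  where "positive_definite A \<longleftrightarrow> (\<forall>v. v \<noteq> 0 \<longrightarrow> v \<bullet> (A *v v) > 0)"

definition complex_eigenvalue :: "real^'n^'n \<Rightarrow> complex \<Rightarrow> bool"
  where "complex_eigenvalue A \<mu> \<longleftrightarrow>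
    (\<exists>v :: complex^'n. v \<noteq> 0 \<and> map_matrix complex_of_real A *v v = \<mu> *s v)"

text \<open>No semisimplicity is required: a non-trivial Jordan block, and hence polynomial growth of
  the solutions of \<open>w' = A w\<close>, is allowed.\<close>

definition imaginary_spectrum :: "real^'n^'n \<Rightarrow> bool"
  where "imaginary_spectrum A \<longleftrightarrow> (\<forall>\<mu>. complex_eigenvalue A \<mu> \<longrightarrow> Re \<mu> = 0)"

definition full_column_rank :: "real^'m^'n \<Rightarrow> bool"
  where "full_column_rank A \<longleftrightarrow> rank A = CARD('m)"

text \<open>This formula is the pseudoinverse only for matrices of full column rank.\<close>

definition left_pinv :: "real^'d^'n \<Rightarrow> real^'n^'d"
  where "left_pinv D = matrix_inv (transpose D ** D) ** transpose D"

definition block_row :: "real^'p^'n \<Rightarrow> real^'q^'n \<Rightarrow> real^('p + 'q)^'n"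
  where "block_row A B = (\<chi> i k. case k of Inl j \<Rightarrow> A $ i $ j | Inr j \<Rightarrow> B $ i $ j)"

definition stack :: "real^'p \<Rightarrow> real^'q \<Rightarrow> real^('p + 'q)"
  where "stack v w = (\<chi> k. case k of Inl i \<Rightarrow> v $ i | Inr j \<Rightarrow> w $ j)"

text \<open>In a product index \<open>(i, k)\<close> of a Kronecker product, \<open>i\<close> selects the block and \<open>k\<close> the position
  inside the block. Accordingly, in the column-stacked vector of a matrix the first component of
  the index is the column and the second one the row.\<close>

definition kron :: "real^'b^'a \<Rightarrow> real^'d^'c \<Rightarrow> real^('b \<times> 'd)^('a \<times> 'c)"
  where "kron A B = (\<chi> r s. A $ fst r $ fst s * B $ snd r $ snd s)"

definition vec_cols :: "real^'b^'a \<Rightarrow> real^('b \<times> 'a)"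
  where "vec_cols A = (\<chi> s. A $ snd s $ fst s)"

text \<open>If the left factor has a single row, the row index of the Kronecker product has type
  \<open>1 \<times> 'n\<close>, which is identified with \<open>'n\<close>.\<close>

definition kron_row :: "real^'b^1 \<Rightarrow> real^'d^'n \<Rightarrow> real^('b \<times> 'd)^'n"
  where "kron_row V B = (\<chi> i. kron V B $ (1, i))"

lemma kron_row_mult_vec_cols:
  fixes A :: "real^'d^'d" and F :: "real^'n^'d" and D :: "real^'d^'n" and w :: "real^'n"
  shows "kron_row (rowvector w ** transpose F) D *v vec_cols A = (D ** A ** F) *v w"
proof -
  have row: "(rowvector w ** transpose F :: real^'d^1) $ 1 $ j = (F *v w) $ j" for j
    by (simp add: rowvector_def transpose_def matrix_matrix_mult_def matrix_vector_mult_def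
        mult.commute)
  have "(kron_row (rowvector w ** transpose F) D *v vec_cols A) $ i
      = (D *v (A *v (F *v w))) $ i" for i
  proof -
    have "(kron_row (rowvector w ** transpose F) D *v vec_cols A) $ i
        = (\<Sum>s\<in>UNIV \<times> UNIV. (F *v w) $ fst s * D $ i $ snd s * A $ snd s $ fst s)"
      by (subst matrix_vector_mult_def) (simp add: kron_row_def kron_def vec_cols_def row)
    also have "\<dots> = (\<Sum>j\<in>UNIV. \<Sum>k\<in>UNIV. (F *v w) $ j * D $ i $ k * A $ k $ j)"
      by (subst sum.cartesian_product) (simp add: case_prod_unfold)
    also have "\<dots> = (\<Sum>k\<in>UNIV. \<Sum>j\<in>UNIV. (F *v w) $ j * D $ i $ k * A $ k $ j)"
      by (rule sum.swap)
    also have "\<dots> = (D *v (A *v (F *v w))) $ i"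
      by (simp add: matrix_vector_mult_def[of D] matrix_vector_mult_def[of A] sum_distrib_left
          ac_simps)
    finally show ?thesis .
  qed
  then have "kron_row (rowvector w ** transpose F) D *v vec_cols A = D *v (A *v (F *v w))"
    by (simp add: vec_eq_iff)
  then show ?thesis
    by (simp add: matrix_vector_mul_assoc matrix_mul_assoc)
qed

definition autonomous_solution ::
    "('a::real_normed_vector \<Rightarrow> 'a) \<Rightarrow> (real \<Rightarrow> 'a) \<Rightarrow> real set \<Rightarrow> bool"
  where "autonomous_solution G y I \<longleftrightarrow>
    (\<forall>t\<in>I. (y has_vector_derivative G (y t)) (at t within I))"

text \<open>Local asymptotic stability of the equilibrium 0. Stability is imposed on every bounded
  interval of existence, so for continuous \<open>G\<close> it rules out finite escape from the neighbourhood
  concerned, and attractivity is not vacuous.\<close>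

definition asymptotically_stable :: "('a::real_normed_vector \<Rightarrow> 'a) \<Rightarrow> bool"
  where "asymptotically_stable G \<longleftrightarrow> G 0 = 0 \<and>
    (\<forall>e>0. \<exists>r>0. \<forall>y T. autonomous_solution G y {0..<T} \<and> norm (y 0) < r \<longrightarrow>
        (\<forall>t\<in>{0..<T}. norm (y t) < e)) \<and>
    (\<exists>r>0. \<forall>y. autonomous_solution G y {0..} \<and> norm (y 0) < r \<longrightarrow> (y \<longlongrightarrow> 0) at_top)"

text \<open>Stabilizability of \<open>x' = f x + g x u\<close> at the origin by continuous state feedback.\<close>

definition stabilizable :: "(real^'n \<Rightarrow> real^'n) \<Rightarrow> (real^'n \<Rightarrow> real^'m^'n) \<Rightarrow> bool"
  where "stabilizable f g \<longleftrightarrow>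
    (\<exists>\<kappa> :: real^'n \<Rightarrow> real^'m. continuous_on UNIV \<kappa> \<and>
        asymptotically_stable (\<lambda>x. f x + g x *v \<kappa> x))"

text \<open>\<open>local_lipschitz\<close> from the library is about time-dependent maps.\<close>

definition locally_lipschitz :: "('a::metric_space \<Rightarrow> 'b::metric_space) \<Rightarrow> bool"
  where "locally_lipschitz f \<longleftrightarrow> local_lipschitz (UNIV :: real set) UNIV (\<lambda>_. f)"

text \<open>Differential equation on \<open>[0, \<infinity>)\<close>, with one-sided derivative at 0.\<close>

definition solves_on_halfline ::
    "(real \<Rightarrow> 'a::real_normed_vector) \<Rightarrow> (real \<Rightarrow> 'a) \<Rightarrow> bool"
  where "solves_on_halfline y r \<longleftrightarrow>
    (\<forall>t\<ge>0. (y has_vector_derivative r t) (at t within {0..}))"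

end

theory Submission
  imports Defs "HOL-Computational_Algebra.Fundamental_Theorem_Algebra" "HOL-Real_Asymp.Real_Asymp"
begin

text \<open>Write \<open>q = \<epsilon> - \<epsilon>hat\<close>, \<open>\<sigma> = vec_cols (Shat - S)\<close> and \<open>E \<sigma> = (Shat - S) \<epsilon>\<close>. Up to exponentially decaying
  terms the estimation error is \<open>- E \<sigma>\<close>, and
  \<open>q' = - a q - E \<sigma>\<close>, \<open>\<sigma>' = \<Gamma> E\<^sup>T D\<^sup>T D q\<close>. The Lyapunov function \<open>|D q|\<^sup>2 + \<sigma> \<bullet> \<Gamma>\<^sup>-\<^sup>1 \<sigma>\<close> shows
  that \<open>q\<close> and \<open>\<sigma>\<close> are bounded and that \<open>q\<close> is square integrable.

  Since the spectrum of \<open>S\<close> is imaginary but \<open>S\<close> need not be semisimple, \<open>\<epsilon>\<^sub>T\<close> is either bounded or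
  tends to infinity in norm. If it is bounded, Barbalat's lemma gives \<open>q \<rightarrow> 0\<close>, then \<open>q' \<rightarrow> 0\<close>, hence
  \<open>E \<sigma> \<rightarrow> 0\<close>.

  If \<open>m = |\<epsilon>\<^sub>T| \<rightarrow> \<infinity>\<close>, then \<open>(q, E \<sigma>)\<close> is an oscillator whose frequency grows like \<open>m\<close>, forced by
  the slowly varying \<open>\<sigma>\<close>. Two corrections \<open>b = q + R \<sigma>\<close> and \<open>v = E \<sigma> - T \<sigma>\<close> with \<open>R, T = O(1/m)\<close>
  reduce the forcing to \<open>O(1/m)\<close> in the equation of \<open>v\<close>. An energy \<open>W\<close> equivalent to
  \<open>|b|\<^sup>2 + |v|\<^sup>2 / m\<^sup>2\<close> then satisfies \<open>W' \<le> - k W + O(m\<^sup>-\<^sup>4)\<close>. As \<open>m\<close> varies subexponentially,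
  \<open>W = O(m\<^sup>-\<^sup>4)\<close> up to decaying terms, so \<open>|v|\<^sup>2 \<le> C m\<^sup>2 W \<rightarrow> 0\<close> and \<open>E \<sigma> = v + T \<sigma> \<rightarrow> 0\<close>.\<close>

text \<open>No persistence of excitation is available, so \<open>Shat - S\<close> need not tend to
  zero; only its product with \<open>\<epsilon>\<close> is controlled. The obstacle is a nontrivial
  Jordan block of \<open>S\<close>: the regressor can then be unbounded, Barbalat's argument has no
  bound on the derivatives to work with, and square integrability of \<open>q\<close> alone does not
  reach \<open>E \<sigma>\<close>. What replaces excitation is algebraic. The unknown is a full
  matrix, so \<open>E E^T = |\<epsilon>|^2 I\<close>, and the gain \<open>E \<Gamma> E^T\<close> is
  uniformly definite of size \<open>m^2\<close>, with an inverse of size \<open>m^(-2)\<close>.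
  Moreover \<open>\<epsilon>\<^sub>T\<close> obeys a linear autonomous equation, so differentiating
  such expressions does not raise their order in \<open>m\<close>; hence \<open>R\<close>,
  \<open>T\<close> and all their derivatives are O(1/m). Both facts need \<open>|\<epsilon>|\<close>
  to be comparable with \<open>m\<close> when \<open>m\<close> is large. This holds because
  \<open>\<epsilon>\<^sub>T = (S + a I) \<epsilon>\<close> up to a decaying term and
  \<open>- a\<close> is not an eigenvalue of \<open>S\<close>.\<close>

section \<open>Differential equations on the half-line\<close>

lemma solves_on_halfline_interior:
  assumes "solves_on_halfline y r" "t > 0"
  shows "(y has_vector_derivative r t) (at t)"
proof -
  have "(y has_vector_derivative r t) (at t within {0<..})"
    using assms unfolding solves_on_halfline_def
    by (meson greaterThan_subset_iff has_vector_derivative_within_subset less_imp_le atLeast_iff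
        greaterThan_iff subsetI)
  then show ?thesis
    using assms(2) by (simp add: at_within_open[of t "{0<..}"])
qed

lemma solves_on_halfline_continuous_on:
  assumes "solves_on_halfline y r" "0 \<le> s"
  shows "continuous_on {s..t} y"
proof -
  have "continuous_on {0..} y"
    using assms(1) unfolding solves_on_halfline_def continuous_on_eq_continuous_within
    by (metis atLeast_iff has_vector_derivative_continuous)
  then show ?thesis
    by (rule continuous_on_subset) (use assms(2) in auto)
qed

lemma solves_on_halfline_linear:
  assumes "bounded_linear f" "solves_on_halfline y r"
  shows "solves_on_halfline (\<lambda>t. f (y t)) (\<lambda>t. f (r t))"
  using assms unfolding solves_on_halfline_def by (auto intro: bounded_linear.has_vector_derivative)

text \<open>The mean value inequality with a varying majorant of the speed. With
  \<open>\<phi> = 0\<close> it turns a vanishing derivative into constancy, which takes the place of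
  a uniqueness theorem for the linear equations below.\<close>

lemma solves_on_halfline_diff_bound:
  assumes y: "solves_on_halfline y r" and \<phi>: "solves_on_halfline \<phi> \<phi>'"
    and le: "\<And>\<tau>. \<tau> > 0 \<Longrightarrow> norm (r \<tau>) \<le> \<phi>' \<tau>" and st: "0 \<le> s" "s \<le> t"
  shows "norm (y t - y s) \<le> \<phi> t - \<phi> s"
proof (cases "s = t")
  case False
  then have "s < t" using st by simp
  show ?thesis
    by (rule differentiable_bound_general[OF \<open>s < t\<close>,
          where f' = r and \<phi>' = \<phi>'])
      (use st y \<phi> le in \<open>auto intro!: solves_on_halfline_interior
          solves_on_halfline_continuous_on\<close>)
qed simp

subsection \<open>Polynomials in a complex matrix\<close>

lemma norm_vector_scalar_mult: "norm (c *s v) = cmod c * norm v" for v :: "complex^'n"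
  by (simp add: norm_vec_def vector_scalar_mult_def norm_mult L2_set_right_distrib)

lemma bounded_bilinear_vector_scalar_mult:
  "bounded_bilinear (\<lambda>(c::complex) (v::complex^'n). c *s v)"
proof
  show "\<exists>K. \<forall>(a::complex) (b::complex^'n). norm (a *s b) \<le> norm a * norm b * K"
    by (rule exI[of _ 1]) (simp add: norm_vector_scalar_mult)
qed (simp_all add: vec_eq_iff algebra_simps vector_scalar_mult_def)

text \<open>The vector \<open>p(A) v\<close> by Horner's scheme. The recursion follows
  \<open>pCons\<close>, so algebraic laws are proved by induction on the polynomial without forming
  powers of \<open>A\<close>.\<close>

definition matpoly :: "complex^'n^'n \<Rightarrow> complex poly \<Rightarrow> complex^'n \<Rightarrow> complex^'n"
  where "matpoly A p v = fold_coeffs (\<lambda>c w. c *s v + A *v w) p 0"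

lemma matpoly_0 [simp]: "matpoly A 0 v = 0"
  by (simp add: matpoly_def)

lemma matpoly_pCons [simp]: "matpoly A (pCons c p) v = c *s v + A *v matpoly A p v"
  by (cases "p = 0 \<and> c = 0") (auto simp: matpoly_def)

lemma matrix_vector_mult_scale: "A *v (c *s v) = c *s (A *v v)"
  for A :: "complex^'n^'m"
  by (simp add: vec_eq_iff matrix_vector_mult_def sum_distrib_left algebra_simps)

lemma matpoly_const: "matpoly A [:c:] v = c *s v"
  by simp

lemma matpoly_linear_factor: "matpoly A [:-\<mu>, 1:] v = A *v v - \<mu> *s v"
  by (simp add: vec_eq_iff vector_scalar_mult_def)

lemma matpoly_mult_vec: "matpoly A p (A *v v) = A *v matpoly A p v"
  by (induction p) (auto simp: matrix_vector_right_distrib matrix_vector_mult_scale)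

lemma matpoly_add: "matpoly A (p + q) v = matpoly A p v + matpoly A q v"
proof (induction p arbitrary: q)
  case (pCons c p)
  then show ?case
    by (cases q) (auto simp: matrix_vector_right_distrib vector_sadd_rdistrib algebra_simps)
qed simp

lemma matpoly_smult: "matpoly A (smult c p) v = c *s matpoly A p v"
  by (induction p)
    (auto simp: matrix_vector_mult_scale vector_add_ldistrib vector_smult_assoc)

lemma matpoly_mult: "matpoly A (p * q) v = matpoly A p (matpoly A q v)"
  by (induction p) (auto simp: matpoly_add matpoly_smult)

lemma bounded_linear_matpoly: "bounded_linear (matpoly A p)"
proof (induction p)
  case (pCons c p)
  have "bounded_linear (\<lambda>v. c *s v + A *v matpoly A p v)"
    by (intro bounded_linear_add bounded_linear_compose[OF matrix_vector_mul_bounded_linear pCons.IH]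
        bounded_bilinear.bounded_linear_right[OF bounded_bilinear_vector_scalar_mult])
  then show ?case by simp
qed simp

text \<open>With \<open>n\<close> the real dimension of the matrix space, the \<open>n + 1\<close>
  powers \<open>A^0, ..., A^n\<close> are linearly dependent over the reals; a dependence relation
  is an annihilating polynomial.\<close>

lemma matpoly_annihilator_exists:
  fixes A :: "complex^'n^'n"
  shows "\<exists>p. p \<noteq> 0 \<and> (\<forall>v. matpoly A p v = 0)"
proof -
  define pw where "pw i = ((\<lambda>B. A ** B) ^^ i) (mat 1)" for i
  define n where "n = DIM(complex^'n^'n)"
  have "\<exists>c. (\<exists>i\<le>n. c i \<noteq> 0) \<and> (\<Sum>i\<le>n. c i *\<^sub>R pw i) = 0"
  \<comment> \<open>\<open>dependent\<close> speaks of the set of powers, so a repetition among them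
    is a separate case, with the relation \<open>pw i - pw j = 0\<close>.\<close>
  proof (cases "inj_on pw {..n}")
    case True
    have "dependent (pw ` {..n})"
      by (rule dependent_biggerset) (use True in \<open>simp add: card_image n_def\<close>)
    then obtain u where u: "\<exists>v\<in>pw ` {..n}. u v \<noteq> 0" "(\<Sum>v\<in>pw ` {..n}. u v *\<^sub>R v) = 0"
      by (auto simp: dependent_finite)
    then show ?thesis
      by (intro exI[of _ "\<lambda>i. u (pw i)"]) (auto simp: sum.reindex[OF True])
  next
    case False
    then obtain i j where ij: "i \<le> n" "j \<le> n" "i \<noteq> j" "pw i = pw j"
      by (auto simp: inj_on_def)
    have "(\<Sum>k\<le>n. (of_bool (k = i) - of_bool (k = j) :: real) *\<^sub>R pw k) = 0"
      using ij by (simp add: scaleR_left_diff_distrib sum_subtractf of_bool_def if_distrib[of "\<lambda>c. c *\<^sub>R _"]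
          cong: if_cong)
    then show ?thesis
      by (intro exI[of _ "\<lambda>k. of_bool (k = i) - of_bool (k = j)"]) (use ij in auto)
  qed
  then obtain c where c: "\<exists>i\<le>n. c i \<noteq> 0" "(\<Sum>i\<le>n. c i *\<^sub>R pw i) = 0"
    by blast
  define p where "p = (\<Sum>i\<le>n. monom (complex_of_real (c i)) i)"
  have coeff: "coeff p i = (if i \<le> n then complex_of_real (c i) else 0)" for i
    by (simp add: p_def coeff_sum)
  have "p \<noteq> 0"
    using c(1) coeff by (metis coeff_0 of_real_eq_0_iff)
  moreover have "matpoly A p v = 0" for v
  proof -
    have sum: "matpoly A (\<Sum>i\<in>I. f i) v = (\<Sum>i\<in>I. matpoly A (f i) v)" if "finite I"
      for I and f :: "nat \<Rightarrow> complex poly"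
      using that by induction (auto simp: matpoly_add)
    have mon: "matpoly A (monom x i) v = x *s (pw i *v v)" for x i
      by (induction i)
        (auto simp: pw_def monom_0 monom_Suc matrix_vector_mult_scale matrix_vector_mul_assoc[symmetric])
    have sc: "complex_of_real x *s w = x *\<^sub>R w" for x and w :: "complex^'n"
      by (simp add: vec_eq_iff) (simp add: scaleR_conv_of_real)
    have scale: "(x *\<^sub>R B) *v v = x *\<^sub>R (B *v v)" for x and B :: "complex^'n^'n"
      by (simp add: vec_eq_iff matrix_vector_mult_def scaleR_sum_right)
    have "matpoly A p v = (\<Sum>i\<le>n. c i *\<^sub>R (pw i *v v))"
      by (simp add: p_def sum mon sc)
    also have "\<dots> = (\<Sum>i\<le>n. (c i *\<^sub>R pw i)) *v v"
    proof (induction n)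
      case (Suc n)
      then show ?case by (simp add: matrix_vector_mult_add_rdistrib scale)
    qed (simp add: scale)
    finally show ?thesis using c(2) by simp
  qed
  ultimately show ?thesis by blast
qed

lemma degree_linear_factor_mult:
  "q \<noteq> 0 \<Longrightarrow> degree ([:- \<mu>, 1:] * q) = Suc (degree q)" for q :: "'a::idom poly"
  by (subst degree_mult_eq) auto

text \<open>If \<open>p = (X - \<mu>) q\<close> has least degree, some \<open>q(A) v\<close> is
  nonzero, and it is an eigenvector for \<open>\<mu>\<close>; hence every root is an eigenvalue. The
  set \<open>V\<close> covers both the minimal polynomial of the matrix and that of a single
  vector.\<close>

lemma minimal_annihilator:
  fixes A :: "complex^'n^'n"
  assumes spec: "\<And>\<mu> v. v \<noteq> 0 \<Longrightarrow> A *v v = \<mu> *s v \<Longrightarrow> Re \<mu> = 0"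
  obtains p where "p \<noteq> 0" "\<And>v. v \<in> V \<Longrightarrow> matpoly A p v = 0"
    "\<And>\<mu>. poly p \<mu> = 0 \<Longrightarrow> Re \<mu> = 0"
    "\<And>q. q \<noteq> 0 \<Longrightarrow> degree q < degree p \<Longrightarrow> \<exists>v\<in>V. matpoly A q v \<noteq> 0"
proof -
  define ann where "ann p \<longleftrightarrow> p \<noteq> 0 \<and> (\<forall>v\<in>V. matpoly A p v = 0)" for p
  have "\<exists>p. ann p"
    using matpoly_annihilator_exists[of A] by (auto simp: ann_def)
  then obtain p where p: "ann p" and min: "\<And>q. ann q \<Longrightarrow> degree p \<le> degree q"
    using exists_least_iff[of "\<lambda>n. \<exists>p. ann p \<and> degree p = n"] by (metis not_le)
  have min': "\<exists>v\<in>V. matpoly A q v \<noteq> 0" if "q \<noteq> 0" "degree q < degree p" for q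
    using min[of q] that by (auto simp: ann_def)
  have "Re \<mu> = 0" if "poly p \<mu> = 0" for \<mu>
  proof -
    have "[:- \<mu>, 1:] dvd p"
      using that by (simp only: poly_eq_0_iff_dvd)
    then obtain q where q: "p = [:- \<mu>, 1:] * q" by (rule dvdE)
    have "q \<noteq> 0" using p q by (auto simp: ann_def)
    then have "degree q < degree p"
      unfolding q by (simp only: degree_linear_factor_mult lessI not_False_eq_True)
    then obtain v where v: "v \<in> V" "matpoly A q v \<noteq> 0"
      using min' \<open>q \<noteq> 0\<close> by blast
    have "matpoly A p v = 0" using p v by (auto simp: ann_def)
    then have "A *v matpoly A q v = \<mu> *s matpoly A q v"
      unfolding q matpoly_mult matpoly_linear_factor by simp
    then show ?thesis using spec v(2) by blast
  qed
  then show ?thesis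
    using that[of p] p min' by (auto simp: ann_def)
qed

subsection \<open>Linear equations with imaginary spectrum\<close>

lemma solves_on_halfline_matpoly:
  assumes "solves_on_halfline y (\<lambda>t. A *v y t)"
  shows "solves_on_halfline (\<lambda>t. matpoly A p (y t)) (\<lambda>t. A *v matpoly A p (y t))"
  using solves_on_halfline_linear[OF bounded_linear_matpoly assms, of A p]
  by (simp add: matpoly_mult_vec)

text \<open>The exponential factor removes \<open>\<mu>\<close> from the equation. For imaginary
  \<open>\<mu>\<close> it is unimodular, so the norms of solution and forcing stay the same.\<close>

lemma solves_on_halfline_rotate:
  fixes \<mu> :: complex and y :: "real \<Rightarrow> complex^'n"
  assumes y: "solves_on_halfline y (\<lambda>t. \<mu> *s y t + u t)"
  shows "solves_on_halfline (\<lambda>t. exp (- (of_real t * \<mu>)) *s y t)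
      (\<lambda>t. exp (- (of_real t * \<mu>)) *s u t)"
  unfolding solves_on_halfline_def
proof (intro allI impI)
  fix t :: real assume "0 \<le> t"
  have "((\<lambda>t. exp (- (of_real t * \<mu>))) has_vector_derivative - \<mu> * exp (- (of_real t * \<mu>)))
      (at t within {0..})"
    by (rule has_vector_derivative_at_within,
        rule has_vector_derivative_real_field[of "\<lambda>z. exp (- (z * \<mu>))"])
      (auto intro!: derivative_eq_intros)
  from bounded_bilinear.has_vector_derivative[OF bounded_bilinear_vector_scalar_mult this]
  have "((\<lambda>t. exp (- (of_real t * \<mu>)) *s y t) has_vector_derivative
     exp (- (of_real t * \<mu>)) *s (\<mu> *s y t + u t) + (- \<mu> * exp (- (of_real t * \<mu>))) *s y t)
      (at t within {0..})"
    using y \<open>0 \<le> t\<close> unfolding solves_on_halfline_def by blast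
  moreover have "exp (- (of_real t * \<mu>)) *s (\<mu> *s y t + u t)
      + (- \<mu> * exp (- (of_real t * \<mu>))) *s y t = exp (- (of_real t * \<mu>)) *s u t"
    by (simp add: vec_eq_iff algebra_simps)
  ultimately show "((\<lambda>t. exp (- (of_real t * \<mu>)) *s y t) has_vector_derivative
     exp (- (of_real t * \<mu>)) *s u t) (at t within {0..})"
    by (simp only:)
qed

lemma norm_rotate: "Re \<mu> = 0 \<Longrightarrow> norm (exp (- (of_real t * \<mu>)) *s v) = norm v"
  by (simp add: norm_vector_scalar_mult)

text \<open>Induction on the degree: for a root \<open>\<mu>\<close> of
  \<open>p = (X - \<mu>) q\<close>, the solution \<open>u = (A - \<mu>) y\<close> is annihilated by
  \<open>q\<close>, and after rotation \<open>y\<close> is an integral of \<open>u\<close>. Each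
  integration costs a factor of order \<open>1 / \<delta>\<close> instead of a power of
  \<open>t\<close>. The constant is chosen before \<open>y\<close>, because the step applies the
  hypothesis to \<open>u\<close>.\<close>

lemma imaginary_growth_aux:
  fixes A :: "complex^'n^'n"
  assumes "\<delta> > 0" "p \<noteq> 0" "\<And>\<mu>. poly p \<mu> = 0 \<Longrightarrow> Re \<mu> = 0"
  shows "\<exists>C\<ge>0. \<forall>y. solves_on_halfline y (\<lambda>t. A *v y t) \<longrightarrow> (\<forall>t\<ge>0. matpoly A p (y t) = 0) \<longrightarrow>
      (\<forall>t\<ge>0. norm (y t) \<le> C * exp (\<delta> * t) * norm (y 0))"
  using assms(2,3)
proof (induction "degree p" arbitrary: p)
  case 0
  then obtain c where "p = [:c:]" "c \<noteq> 0" by (metis degree_eq_zeroE pCons_eq_0_iff)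
  then show ?case by (intro exI[of _ 0]) (auto simp: vector_mul_eq_0)
next
  case (Suc n)
  have "\<not> constant (poly p)"
    using Suc.hyps(2) by (simp add: constant_degree)
  then obtain \<mu> where \<mu>: "poly p \<mu> = 0" using fundamental_theorem_of_algebra by blast
  then have "[:- \<mu>, 1:] dvd p" by (simp only: poly_eq_0_iff_dvd)
  then obtain q where q: "p = [:- \<mu>, 1:] * q" by (rule dvdE)
  then have "q \<noteq> 0" using Suc.prems by auto
  then have "n = degree q" using Suc.hyps(2) unfolding q
    by (simp only: degree_linear_factor_mult not_False_eq_True nat.inject)
  then obtain C where C: "C \<ge> 0" "\<And>y t. solves_on_halfline y (\<lambda>t. A *v y t) \<Longrightarrow>
      (\<forall>t\<ge>0. matpoly A q (y t) = 0) \<Longrightarrow> t \<ge> 0 \<Longrightarrow> norm (y t) \<le> C * exp (\<delta> * t) * norm (y 0)"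
  proof -
    have "Re \<nu> = 0" if "poly q \<nu> = 0" for \<nu>
      using Suc.prems(2)[of \<nu>] that unfolding q by simp
    from Suc.hyps(1)[OF \<open>n = degree q\<close> \<open>q \<noteq> 0\<close> this] that show ?thesis by blast
  qed
  have Re: "Re \<mu> = 0" using \<mu> Suc.prems by blast
  obtain B where B: "\<And>v. norm (matpoly A [:- \<mu>, 1:] v) \<le> norm v * B" "B \<ge> 0"
    using bounded_linear.nonneg_bounded[OF bounded_linear_matpoly] by blast
  show ?case
  proof (intro exI[of _ "1 + C * B / \<delta>"] conjI allI impI)
    show "0 \<le> 1 + C * B / \<delta>" using B C \<open>\<delta> > 0\<close> by simp
  next
    fix y t
    assume y: "solves_on_halfline y (\<lambda>t. A *v y t)" and p: "\<forall>t\<ge>0. matpoly A p (y t) = 0"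
      and t: "(t::real) \<ge> 0"
    define u where "u t = matpoly A [:- \<mu>, 1:] (y t)" for t
    have "norm (u t) \<le> C * exp (\<delta> * t) * norm (u 0)" if "t \<ge> 0" for t
    proof (rule C(2)[OF _ _ that])
      show "solves_on_halfline u (\<lambda>t. A *v u t)"
        unfolding u_def by (rule solves_on_halfline_matpoly[OF y])
      show "\<forall>t\<ge>0. matpoly A q (u t) = 0"
        using p unfolding q u_def by (metis matpoly_mult mult.commute)
    qed
    moreover have "norm (u 0) \<le> B * norm (y 0)"
      using B(1)[of "y 0"] by (simp add: u_def mult.commute)
    ultimately have u: "norm (u t) \<le> C * exp (\<delta> * t) * (B * norm (y 0))" if "t \<ge> 0" for t
      using that C(1) by (meson exp_ge_zero mult_left_mono mult_nonneg_nonneg order_trans)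
    have "solves_on_halfline y (\<lambda>t. \<mu> *s y t + u t)"
      using y unfolding u_def matpoly_linear_factor by simp
    note rot = solves_on_halfline_rotate[OF this]
    have \<phi>: "solves_on_halfline (\<lambda>t. C * B * norm (y 0) / \<delta> * exp (\<delta> * t))
        (\<lambda>t. C * exp (\<delta> * t) * (B * norm (y 0)))"
      unfolding solves_on_halfline_def has_real_derivative_iff_has_vector_derivative[symmetric]
      using \<open>\<delta> > 0\<close> by (auto intro!: derivative_eq_intros)
    have "norm (exp (- (of_real t * \<mu>)) *s y t - exp (- (of_real 0 * \<mu>)) *s y 0)
        \<le> C * B * norm (y 0) / \<delta> * exp (\<delta> * t) - C * B * norm (y 0) / \<delta> * exp (\<delta> * 0)"
      by (rule solves_on_halfline_diff_bound[OF rot \<phi>])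
        (use t u in \<open>auto simp: norm_rotate Re simp del: of_real_0\<close>)
    then have "norm (y t) \<le> norm (y 0) + C * B * norm (y 0) / \<delta> * exp (\<delta> * t)
        - C * B * norm (y 0) / \<delta>"
      using norm_triangle_ineq2[of "exp (- (of_real t * \<mu>)) *s y t" "exp (- (of_real 0 * \<mu>)) *s y 0"]
      unfolding norm_rotate[OF Re] by simp
    also have "\<dots> \<le> norm (y 0) * exp (\<delta> * t) + C * B * norm (y 0) / \<delta> * exp (\<delta> * t)"
    proof -
      have "0 \<le> C * B * norm (y 0) / \<delta>" using C(1) B(2) \<open>\<delta> > 0\<close> by simp
      moreover have "norm (y 0) \<le> norm (y 0) * exp (\<delta> * t)"
        using mult_left_mono[of 1 "exp (\<delta> * t)" "norm (y 0)"] t \<open>\<delta> > 0\<close> by simp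
      ultimately show ?thesis by linarith
    qed
    also have "\<dots> = (1 + C * B / \<delta>) * exp (\<delta> * t) * norm (y 0)"
      by (simp add: algebra_simps)
    finally show "norm (y t) \<le> (1 + C * B / \<delta>) * exp (\<delta> * t) * norm (y 0)" .
  qed
qed

lemma imaginary_growth_complex:
  fixes A :: "complex^'n^'n"
  assumes spec: "\<And>\<mu> v. v \<noteq> 0 \<Longrightarrow> A *v v = \<mu> *s v \<Longrightarrow> Re \<mu> = 0" and "\<delta> > 0"
  obtains C where "C \<ge> 0" "\<And>y t. solves_on_halfline y (\<lambda>t. A *v y t) \<Longrightarrow> t \<ge> 0 \<Longrightarrow>
      norm (y t) \<le> C * exp (\<delta> * t) * norm (y 0)"
proof -
  obtain p where "p \<noteq> 0" "\<And>v. v \<in> UNIV \<Longrightarrow> matpoly A p v = 0" "\<And>\<mu>. poly p \<mu> = 0 \<Longrightarrow> Re \<mu> = 0"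
    by (rule minimal_annihilator[OF spec, where V = UNIV]) blast+
  with imaginary_growth_aux[OF \<open>\<delta> > 0\<close>, of p A] that show ?thesis by blast
qed

text \<open>For \<open>p = (X - \<mu>) q\<close> a simple root means
  \<open>q(\<mu>) \<noteq> 0\<close>, and \<open>q = q(\<mu>) + (X - \<mu>) s\<close> is a Bezout
  relation. It expresses \<open>q(\<mu>) y\<close> by \<open>w = q(A) y\<close>, which solves
  \<open>w' = \<mu> w\<close> and has constant norm, and by \<open>u = (A - \<mu>) y\<close>, which
  is bounded by induction.\<close>

lemma squarefree_annihilator_bounded:
  fixes A :: "complex^'n^'n"
  assumes "p \<noteq> 0" "\<And>\<mu>. poly p \<mu> = 0 \<Longrightarrow> Re \<mu> = 0" "\<And>\<mu>. \<not> [:- \<mu>, 1:]\<^sup>2 dvd p"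
    and "solves_on_halfline y (\<lambda>t. A *v y t)" "\<And>t. t \<ge> 0 \<Longrightarrow> matpoly A p (y t) = 0"
  shows "\<exists>C. \<forall>t\<ge>0. norm (y t) \<le> C"
  using assms
proof (induction "degree p" arbitrary: p y)
  case 0
  then obtain c where "p = [:c:]" "c \<noteq> 0" by (metis degree_eq_zeroE pCons_eq_0_iff)
  then show ?case using 0 by (intro exI[of _ 0]) (auto simp: vector_mul_eq_0)
next
  case (Suc n)
  note y = Suc.prems(4)
  have "\<not> constant (poly p)"
    using Suc.hyps(2) by (simp add: constant_degree)
  then obtain \<mu> where \<mu>: "poly p \<mu> = 0" using fundamental_theorem_of_algebra by blast
  then have "[:- \<mu>, 1:] dvd p" by (simp only: poly_eq_0_iff_dvd)
  then obtain q where q: "p = [:- \<mu>, 1:] * q" by (rule dvdE)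
  have "q \<noteq> 0" using Suc.prems q by auto
  have Re: "Re \<mu> = 0" using \<mu> Suc.prems by blast
  have q\<mu>: "poly q \<mu> \<noteq> 0"
    using Suc.prems(3)[of \<mu>] unfolding q power2_eq_square poly_eq_0_iff_dvd
    by (metis dvd_refl mult_dvd_mono)
  define u where "u t = matpoly A [:- \<mu>, 1:] (y t)" for t
  have "\<exists>C. \<forall>t\<ge>0. norm (u t) \<le> C"
  proof (rule Suc.hyps(1)[of q])
    show "n = degree q" using Suc.hyps(2) \<open>q \<noteq> 0\<close> unfolding q
    by (simp only: degree_linear_factor_mult not_False_eq_True nat.inject)
    show "\<not> [:- \<nu>, 1:]\<^sup>2 dvd q" for \<nu>
      using Suc.prems(3)[of \<nu>] unfolding q by (meson dvd_mult)
    show "solves_on_halfline u (\<lambda>t. A *v u t)"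
      unfolding u_def by (rule solves_on_halfline_matpoly[OF y])
    show "matpoly A q (u t) = 0" if "t \<ge> 0" for t
      using Suc.prems(5)[OF that] unfolding q u_def by (metis matpoly_mult mult.commute)
  qed (use Suc.prems q \<open>q \<noteq> 0\<close> in auto)
  then obtain C where C: "\<And>t. t \<ge> 0 \<Longrightarrow> norm (u t) \<le> C" by blast
  define w where "w t = matpoly A q (y t)" for t
  have w: "solves_on_halfline w (\<lambda>t. A *v w t)"
    unfolding w_def by (rule solves_on_halfline_matpoly[OF y])
  have "matpoly A [:- \<mu>, 1:] (w t) = 0" if "t \<ge> 0" for t
    using Suc.prems(5)[OF that] unfolding q w_def by (simp only: matpoly_mult)
  then have "solves_on_halfline w (\<lambda>t. \<mu> *s w t + 0)"
    using w unfolding matpoly_linear_factor solves_on_halfline_def by simp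
  note rot = solves_on_halfline_rotate[OF this]
  have w_bound: "norm (w t) \<le> norm (w 0)" if "t \<ge> 0" for t
  proof -
    have zero: "solves_on_halfline (\<lambda>_. 0::real) (\<lambda>_. 0)"
      by (simp add: solves_on_halfline_def)
    have "norm (exp (- (of_real t * \<mu>)) *s w t - exp (- (of_real 0 * \<mu>)) *s w 0) \<le> 0 - 0"
      by (rule solves_on_halfline_diff_bound[OF rot zero])
        (use that in \<open>auto simp: norm_rotate Re simp del: of_real_0\<close>)
    then show ?thesis
      using norm_rotate[OF Re, of t "w t"] by simp
  qed
  obtain s where s: "q - [:poly q \<mu>:] = [:- \<mu>, 1:] * s"
    using poly_eq_0_iff_dvd[of "q - [:poly q \<mu>:]" \<mu>] by auto
  obtain B where B: "\<And>v. norm (matpoly A s v) \<le> norm v * B" "B \<ge> 0"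
    using bounded_linear.nonneg_bounded[OF bounded_linear_matpoly] by blast
  show ?case
  proof (intro exI[of _ "(norm (w 0) + C * B) / norm (poly q \<mu>)"] allI impI)
    fix t :: real assume t: "0 \<le> t"
    have "q = [:poly q \<mu>:] + s * [:- \<mu>, 1:]"
      using s by (simp add: algebra_simps)
    then have "w t = poly q \<mu> *s y t + matpoly A s (u t)"
      unfolding w_def u_def by (metis matpoly_add matpoly_mult matpoly_const)
    then have "norm (poly q \<mu> *s y t) \<le> norm (w t) + norm (matpoly A s (u t))"
      by (metis add_diff_cancel_right' norm_triangle_ineq4)
    also have "\<dots> \<le> norm (w 0) + C * B"
      using w_bound[OF t] B(1)[of "u t"] mult_right_mono[OF C[OF t] B(2)] by linarith
    finally show "norm (y t) \<le> (norm (w 0) + C * B) / norm (poly q \<mu>)"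
      using q\<mu> by (simp add: norm_vector_scalar_mult field_simps)
  qed
qed

text \<open>The minimal polynomial of the initial value decides: a double root produces a component
  that grows linearly, and without double roots every component is bounded.\<close>

lemma bounded_or_unbounded_complex:
  fixes A :: "complex^'n^'n"
  assumes spec: "\<And>\<mu> v. v \<noteq> 0 \<Longrightarrow> A *v v = \<mu> *s v \<Longrightarrow> Re \<mu> = 0"
    and y: "solves_on_halfline y (\<lambda>t. A *v y t)"
  shows "(\<exists>C. \<forall>t\<ge>0. norm (y t) \<le> C) \<or> filterlim (\<lambda>t. norm (y t)) at_top at_top"
proof -
  obtain p where p: "p \<noteq> 0" "matpoly A p (y 0) = 0" "\<And>\<mu>. poly p \<mu> = 0 \<Longrightarrow> Re \<mu> = 0"
    and min: "\<And>q. q \<noteq> 0 \<Longrightarrow> degree q < degree p \<Longrightarrow> matpoly A q (y 0) \<noteq> 0"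
    by (rule minimal_annihilator[OF spec, where V = "{y 0}"]) auto
  \<comment> \<open>\<open>p(A) y\<close> is a solution with initial value zero, and the growth
    bound is proportional to the initial value.\<close>
  have py: "matpoly A p (y t) = 0" if "t \<ge> 0" for t
  proof -
    obtain C where "\<And>y t. solves_on_halfline y (\<lambda>t. A *v y t) \<Longrightarrow> t \<ge> 0 \<Longrightarrow>
        norm (y t) \<le> C * exp (1 * t) * norm (y 0)"
      by (rule imaginary_growth_complex[OF spec zero_less_one]) blast+
    from this[OF solves_on_halfline_matpoly[OF y, of p] that] p(2) show ?thesis by simp
  qed
  show ?thesis
  proof (cases "\<exists>\<mu>. [:- \<mu>, 1:]\<^sup>2 dvd p")
    case False
    then show ?thesis using squarefree_annihilator_bounded[OF p(1,3) _ y py] by blast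
  next
    case True
    then obtain \<mu> q where q: "p = [:- \<mu>, 1:] * ([:- \<mu>, 1:] * q)"
      unfolding power2_eq_square by (metis dvdE mult.assoc)
    then have "poly p \<mu> = 0" by simp
    then have Re: "Re \<mu> = 0" using p by blast
    have "q \<noteq> 0" using p q by auto
    define v where "v t = matpoly A q (y t)" for t
    define u where "u t = matpoly A [:- \<mu>, 1:] (v t)" for t
    \<comment> \<open>\<open>u 0\<close> is the value at \<open>y 0\<close> of a polynomial of
      smaller degree than \<open>p\<close>, so minimality excludes zero.\<close>
    have u0: "u 0 \<noteq> 0"
    proof -
      have "[:- \<mu>, 1:] * q \<noteq> 0" "degree ([:- \<mu>, 1:] * q) < degree p"
        using \<open>q \<noteq> 0\<close> unfolding q by (simp_all add: degree_linear_factor_mult del: mult_pCons_left)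
      from min[OF this] show ?thesis
        by (simp only: u_def v_def matpoly_mult not_False_eq_True)
    qed
    have v: "solves_on_halfline v (\<lambda>t. A *v v t)"
      unfolding v_def by (rule solves_on_halfline_matpoly[OF y])
    have u: "solves_on_halfline u (\<lambda>t. A *v u t)"
      unfolding u_def by (rule solves_on_halfline_matpoly[OF v])
    have "matpoly A [:- \<mu>, 1:] (u t) = 0" if "t \<ge> 0" for t
      using py[OF that] unfolding q u_def v_def by (simp only: matpoly_mult)
    then have "solves_on_halfline u (\<lambda>t. \<mu> *s u t + 0)"
      using u unfolding matpoly_linear_factor solves_on_halfline_def by simp
    note rot_u = solves_on_halfline_rotate[OF this]
    have const: "exp (- (of_real t * \<mu>)) *s u t = u 0" if "t \<ge> 0" for t
    proof -
      have zero: "solves_on_halfline (\<lambda>_. 0::real) (\<lambda>_. 0)"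
        by (simp add: solves_on_halfline_def)
      have "norm (exp (- (of_real t * \<mu>)) *s u t - exp (- (of_real 0 * \<mu>)) *s u 0) \<le> 0 - 0"
        by (rule solves_on_halfline_diff_bound[OF rot_u zero])
          (use that in \<open>auto simp: norm_rotate Re simp del: of_real_0\<close>)
      then show ?thesis by simp
    qed
    have "solves_on_halfline v (\<lambda>t. \<mu> *s v t + u t)"
      using v unfolding u_def matpoly_linear_factor by simp
    note rot_v = solves_on_halfline_rotate[OF this]
    \<comment> \<open>The rotated \<open>u\<close> is constant, so the rotated \<open>v\<close> is
      affine in \<open>t\<close> with slope \<open>u 0\<close>: the linear growth of a Jordan chain
      of length two.\<close>
    have diff: "solves_on_halfline (\<lambda>t. exp (- (of_real t * \<mu>)) *s v t - t *\<^sub>R u 0) (\<lambda>t. 0)"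
      unfolding solves_on_halfline_def
    proof (intro allI impI)
      fix t :: real assume "t \<ge> 0"
      then have "((\<lambda>t. exp (- (of_real t * \<mu>)) *s v t) has_vector_derivative u 0)
          (at t within {0..})"
        using rot_v const[of t] unfolding solves_on_halfline_def by metis
      then show "((\<lambda>t. exp (- (of_real t * \<mu>)) *s v t - t *\<^sub>R u 0) has_vector_derivative 0)
          (at t within {0..})"
        by (auto intro!: derivative_eq_intros)
    qed
    have lower: "t * norm (u 0) - norm (v 0) \<le> norm (v t)" if "t \<ge> 0" for t
    proof -
      have zero: "solves_on_halfline (\<lambda>_. 0::real) (\<lambda>_. 0)"
        by (simp add: solves_on_halfline_def)
      have "norm ((exp (- (of_real t * \<mu>)) *s v t - t *\<^sub>R u 0)
          - (exp (- (of_real 0 * \<mu>)) *s v 0 - 0 *\<^sub>R u 0)) \<le> 0 - 0"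
        by (rule solves_on_halfline_diff_bound[OF diff zero]) (use that in auto)
      then have "t *\<^sub>R u 0 = exp (- (of_real t * \<mu>)) *s v t - v 0"
        by (simp add: algebra_simps)
      then have "norm (t *\<^sub>R u 0) \<le> norm (exp (- (of_real t * \<mu>)) *s v t) + norm (v 0)"
        by (metis norm_triangle_ineq4)
      then show ?thesis using that unfolding norm_rotate[OF Re] by simp
    qed
    obtain B where B: "\<And>w. norm (matpoly A q w) \<le> norm w * B" "B > 0"
      using bounded_linear.pos_bounded[OF bounded_linear_matpoly] by blast
    have "filterlim (\<lambda>t. (norm (u 0) / B) * t - norm (v 0) / B) at_top at_top"
      using u0 B(2) by real_asymp
    then have "filterlim (\<lambda>t. norm (y t)) at_top at_top"
    proof (rule filterlim_at_top_mono)
      show "\<forall>\<^sub>F t in at_top. norm (u 0) / B * t - norm (v 0) / B \<le> norm (y t)"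
        using eventually_ge_at_top[of 0]
      proof eventually_elim
        case (elim t)
        have "t * norm (u 0) - norm (v 0) \<le> norm (y t) * B"
          using lower[OF elim] B(1)[of "y t"] by (simp add: v_def)
        then show ?case using B(2) by (simp add: field_simps)
      qed
    qed
    then show ?thesis by blast
  qed
qed

subsection \<open>Complexification\<close>

definition cvec :: "real^'n \<Rightarrow> complex^'n"
  where "cvec v = (\<chi> i. complex_of_real (v $ i))"

lemma norm_cvec [simp]: "norm (cvec v) = norm v"
  by (simp add: norm_vec_def cvec_def)

lemma cvec_eq_0_iff [simp]: "cvec v = 0 \<longleftrightarrow> v = 0"
  by (simp add: vec_eq_iff cvec_def)

lemma bounded_linear_cvec: "bounded_linear cvec"
  by (rule bounded_linear_intro[where K = 1])
    (simp_all add: vec_eq_iff cvec_def norm_vec_def scaleR_conv_of_real[where 'a = complex])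

lemma cvec_matrix_vector_mult: "cvec (A *v v) = map_matrix complex_of_real A *v cvec v"
  by (simp add: vec_eq_iff cvec_def matrix_vector_mult_def)

lemma solves_on_halfline_cvec:
  "solves_on_halfline y (\<lambda>t. A *v y t) \<Longrightarrow>
    solves_on_halfline (\<lambda>t. cvec (y t)) (\<lambda>t. map_matrix complex_of_real A *v cvec (y t))"
  using solves_on_halfline_linear[OF bounded_linear_cvec, of y "\<lambda>t. A *v y t"]
  by (simp add: cvec_matrix_vector_mult)

lemma imaginary_spectrumD:
  "imaginary_spectrum A \<Longrightarrow> v \<noteq> 0 \<Longrightarrow> map_matrix complex_of_real A *v v = \<mu> *s v \<Longrightarrow> Re \<mu> = 0"
  by (auto simp: imaginary_spectrum_def complex_eigenvalue_def)

text \<open>The equation is autonomous, so time can be shifted to start at \<open>s\<close>. The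
  free starting time is what later allows values of \<open>m\<close> at two different times to be
  compared at an arbitrarily small exponential rate.\<close>

lemma imaginary_spectrum_growth:
  fixes A :: "real^'n^'n"
  assumes "imaginary_spectrum A" "\<delta> > 0"
  obtains C where "C \<ge> 0" "\<And>y s t. solves_on_halfline y (\<lambda>t. A *v y t) \<Longrightarrow> 0 \<le> s \<Longrightarrow> s \<le> t \<Longrightarrow>
      norm (y t) \<le> C * exp (\<delta> * (t - s)) * norm (y s)"
proof -
  obtain C where C: "C \<ge> 0" "\<And>y t. solves_on_halfline y (\<lambda>t. map_matrix complex_of_real A *v y t) \<Longrightarrow>
      t \<ge> 0 \<Longrightarrow> norm (y t) \<le> C * exp (\<delta> * t) * norm (y 0)"
    by (rule imaginary_growth_complex[OF imaginary_spectrumD[OF assms(1)] \<open>\<delta> > 0\<close>]) blast+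
  have "norm (y t) \<le> C * exp (\<delta> * (t - s)) * norm (y s)"
    if y: "solves_on_halfline y (\<lambda>t. A *v y t)" and st: "0 \<le> s" "s \<le> t" for y s t
  proof -
    have "solves_on_halfline (\<lambda>\<tau>. y (s + \<tau>)) (\<lambda>\<tau>. A *v y (s + \<tau>))"
      unfolding solves_on_halfline_def
    proof (intro allI impI)
      fix \<tau> :: real assume \<tau>: "\<tau> \<ge> 0"
      have "((\<lambda>\<tau>. s + \<tau>) has_vector_derivative 1) (at \<tau> within {0..})"
        by (auto intro!: derivative_eq_intros)
      moreover have "(y has_vector_derivative A *v y (s + \<tau>)) (at (s + \<tau>) within (\<lambda>\<tau>. s + \<tau>) ` {0..})"
        by (rule has_vector_derivative_within_subset[of _ _ _ "{0..}"])
          (use y \<tau> st in \<open>auto simp: solves_on_halfline_def\<close>)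
      ultimately show "((\<lambda>\<tau>. y (s + \<tau>)) has_vector_derivative A *v y (s + \<tau>)) (at \<tau> within {0..})"
        using vector_diff_chain_within[of "\<lambda>\<tau>. s + \<tau>" 1 \<tau> "{0..}" y] by (simp add: o_def)
    qed
    from C(2)[OF solves_on_halfline_cvec[OF this], of "t - s"] st show ?thesis by simp
  qed
  with C(1) that show ?thesis by blast
qed

lemma imaginary_spectrum_bounded_or_unbounded:
  fixes A :: "real^'n^'n"
  assumes "imaginary_spectrum A" "solves_on_halfline y (\<lambda>t. A *v y t)"
  shows "(\<exists>C. \<forall>t\<ge>0. norm (y t) \<le> C) \<or> filterlim (\<lambda>t. norm (y t)) at_top at_top"
  using bounded_or_unbounded_complex[OF imaginary_spectrumD[OF assms(1)]
      solves_on_halfline_cvec[OF assms(2)]] by simp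

text \<open>A nonzero \<open>v\<close> would be an eigenvector for \<open>- a\<close>, which is real
  and nonzero and hence not imaginary.\<close>

lemma imaginary_spectrum_shift_injective:
  fixes A :: "real^'n^'n"
  assumes "imaginary_spectrum A" "a \<noteq> 0" "A *v v + a *\<^sub>R v = 0"
  shows "v = 0"
proof (rule ccontr)
  assume "v \<noteq> 0"
  have "map_matrix complex_of_real A *v cvec v = cvec (- (a *\<^sub>R v))"
    using assms(3) by (simp add: cvec_matrix_vector_mult[symmetric] add_eq_0_iff)
  also have "\<dots> = complex_of_real (- a) *s cvec v"
    by (simp add: vec_eq_iff cvec_def)
  finally show False
    using imaginary_spectrumD[OF assms(1)] \<open>v \<noteq> 0\<close> \<open>a \<noteq> 0\<close>
    by (metis cvec_eq_0_iff Re_complex_of_real neg_equal_0_iff_equal)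
qed

subsection \<open>Limits from integral bounds\<close>

text \<open>A variant of Barbalat's lemma that avoids integrals: \<open>V\<close> plays the role of the negative
  antiderivative of \<open>\<phi>\<close>.\<close>

lemma dissipation_tendsto_0:
  fixes V \<phi> :: "real \<Rightarrow> real"
  assumes V: "\<And>t. t > t0 \<Longrightarrow> (V has_real_derivative V' t) (at t)"
    and V': "\<And>t. t > t0 \<Longrightarrow> V' t \<le> - \<phi> t" and V0: "\<And>t. t > t0 \<Longrightarrow> 0 \<le> V t"
    and \<phi>0: "\<And>t. t > t0 \<Longrightarrow> 0 \<le> \<phi> t"
    and \<phi>: "\<And>t. t > t0 \<Longrightarrow> (\<phi> has_real_derivative \<phi>' t) (at t)"
    and C: "\<And>t. t > t0 \<Longrightarrow> \<bar>\<phi>' t\<bar> \<le> C"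
  shows "(\<phi> \<longlongrightarrow> 0) at_top"
proof -
  have mono: "V t + c * t \<le> V s + c * s"
    if "t0 < s" "s \<le> t" "\<And>\<tau>. s \<le> \<tau> \<Longrightarrow> \<tau> \<le> t \<Longrightarrow> c \<le> \<phi> \<tau>" for s t c
  proof (rule DERIV_nonpos_imp_nonincreasing[OF \<open>s \<le> t\<close>])
    fix \<tau> assume \<tau>: "s \<le> \<tau>" "\<tau> \<le> t"
    have "((\<lambda>t. V t + c * t) has_real_derivative V' \<tau> + c) (at \<tau>)"
      using V[of \<tau>] \<tau> that by (auto intro!: derivative_eq_intros)
    moreover have "V' \<tau> + c \<le> 0" using V'[of \<tau>] that(3)[OF \<tau>] that(1) \<tau> by simp
    ultimately show "\<exists>y. ((\<lambda>t. V t + c * t) has_real_derivative y) (at \<tau>) \<and> y \<le> 0" by blast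
  qed
  have C0: "0 \<le> C" using C[of "t0 + 1"] by simp
  show ?thesis
  proof (rule tendstoI)
    fix e :: real assume "0 < e"
    \<comment> \<open>Starting from a value of at least \<open>e\<close>, a function with slope at
      most \<open>C\<close> stays above \<open>e / 2\<close> for a time \<open>h\<close>;
      \<open>C + 1\<close> keeps the denominator positive for \<open>C = 0\<close>.\<close>
    define h where "h = e / (2 * (C + 1))"
    have h: "h > 0" "C * h \<le> e / 2"
      using \<open>0 < e\<close> C0 by (auto simp: h_def field_simps)
    define I where "I = Inf (V ` {t0<..})"
    have bdd: "bdd_below (V ` {t0<..})" using V0 by (auto intro!: bdd_belowI[of _ 0])
    \<comment> \<open>From \<open>T\<close> on, \<open>V\<close> can no longer lose
      \<open>e / 2 * h\<close>, which a single excursion of \<open>\<phi>\<close> up to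
      \<open>e\<close> would cost.\<close>
    obtain T where T: "T > t0" "V T < I + e / 2 * h"
      using cInf_lessD[of "V ` {t0<..}" "I + e / 2 * h"] h \<open>0 < e\<close>
      by (auto simp: I_def)
    have "\<phi> t < e" if "T \<le> t" for t
    proof (rule ccontr)
      assume "\<not> \<phi> t < e"
      have "e / 2 \<le> \<phi> \<tau>" if \<tau>: "t \<le> \<tau>" "\<tau> \<le> t + h" for \<tau>
      proof -
        have "norm (\<phi> \<tau> - \<phi> t) \<le> C * norm (\<tau> - t)"
          by (rule field_differentiable_bound[of "{t..\<tau>}" \<phi> \<phi>'])
            (use \<phi> C \<tau> \<open>T \<le> t\<close> T in \<open>auto intro: has_field_derivative_at_within\<close>)
        also have "\<dots> \<le> e / 2"
          using mult_left_mono[of "\<tau> - t" h C] \<tau> h C0 by simp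
        finally show ?thesis using \<open>\<not> \<phi> t < e\<close> unfolding real_norm_def by linarith
      qed
      then have "V (t + h) + e / 2 * (t + h) \<le> V t + e / 2 * t"
        using T that h by (intro mono) auto
      then have "V (t + h) + e / 2 * h \<le> V t"
        by (simp add: distrib_left)
      moreover have "V t \<le> V T"
        using mono[of T t 0] \<phi>0 T that by simp
      moreover have "I \<le> V (t + h)"
        unfolding I_def by (rule cInf_lower[OF _ bdd]) (use T that h in auto)
      ultimately show False using T by simp
    qed
    then show "\<forall>\<^sub>F t in at_top. dist (\<phi> t) 0 < e"
      unfolding eventually_at_top_linorder using \<phi>0 T by (intro exI[of _ T]) auto
  qed
qed

text \<open>Taylor's formula with step \<open>h\<close> gives
  \<open>h |u(t)| \<le> |f(t + h)| + |f(t)| + C h^2\<close>. A fixed small \<open>h\<close> makes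
  the last term small relative to \<open>h\<close>, after which the values of \<open>f\<close> can
  be made small.\<close>

lemma derivative_tendsto_0:
  fixes f u :: "real \<Rightarrow> 'a::real_normed_vector"
  assumes f: "\<And>t. t > t0 \<Longrightarrow> (f has_vector_derivative u t) (at t)"
    and u: "\<And>t. t > t0 \<Longrightarrow> (u has_vector_derivative u' t) (at t)"
    and C: "\<And>t. t > t0 \<Longrightarrow> norm (u' t) \<le> C"
    and lim: "(f \<longlongrightarrow> 0) at_top"
  shows "(u \<longlongrightarrow> 0) at_top"
proof -
  have C0: "0 \<le> C" using C[of "t0 + 1"] norm_ge_zero order_trans by (metis less_add_one)
  have cont: "continuous_on {s..t} g"
    if "t0 < s" "\<And>t. t > t0 \<Longrightarrow> (g has_vector_derivative g' t) (at t)"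
    for s t and g g' :: "real \<Rightarrow> 'a"
    using that by (intro continuous_at_imp_continuous_on ballI)
      (metis has_vector_derivative_continuous atLeastAtMost_iff less_le_trans)
  have key: "h * norm (u t) \<le> norm (f (t + h)) + norm (f t) + C * h * h" if "t > t0" "h > 0" for t h
  proof -
    have lip: "norm (u s - u t) \<le> C * s - C * t" if "t \<le> s" for s
    proof (cases "t = s")
      case False
      then have "t < s" using that by simp
      then show ?thesis
        by (rule differentiable_bound_general[where f' = u' and \<phi>' = "\<lambda>_. C"])
          (use \<open>t > t0\<close> u C in \<open>auto intro!: cont[of _ u u'] continuous_intros derivative_eq_intros\<close>)
    qed simp
    have "norm ((f (t + h) - (t + h) *\<^sub>R u t) - (f t - t *\<^sub>R u t)) \<le> C * h * (t + h) - C * h * t"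
    proof (rule differentiable_bound_general[where f' = "\<lambda>s. u s - u t" and \<phi>' = "\<lambda>_. C * h"])
      show "((\<lambda>s. f s - s *\<^sub>R u t) has_vector_derivative u s - u t) (at s)" if "t < s" for s
        using f[of s] that \<open>t > t0\<close> by (auto intro!: derivative_eq_intros)
      show "norm (u s - u t) \<le> C * h" if "t < s" "s < t + h" for s
        using lip[of s] that C0 mult_left_mono[of "s - t" h C] by (simp add: algebra_simps)
      show "continuous_on {t..t + h} (\<lambda>s. f s - s *\<^sub>R u t)"
        using \<open>t > t0\<close> by (intro continuous_intros cont[of _ f u]) (auto intro: f)
    qed (use \<open>h > 0\<close> in \<open>auto intro!: continuous_intros derivative_eq_intros\<close>)
    then have "norm (f (t + h) - f t - h *\<^sub>R u t) \<le> C * h * h"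
      by (simp add: algebra_simps)
    moreover have "norm (h *\<^sub>R u t) \<le> norm (f (t + h)) + norm (f t) + norm (f (t + h) - f t - h *\<^sub>R u t)"
      using norm_triangle_ineq4[of "f (t + h) - f t" "f (t + h) - f t - h *\<^sub>R u t"]
        norm_triangle_ineq4[of "f (t + h)" "f t"] by simp
    ultimately show ?thesis using \<open>h > 0\<close> by simp
  qed
  show ?thesis
  proof (rule tendstoI)
    fix e :: real assume "0 < e"
    define h where "h = e / (2 * (C + 1))"
    have h: "h > 0" "C * h \<le> e / 2"
      using \<open>0 < e\<close> C0 by (auto simp: h_def field_simps)
    have "0 < h * e / 4" using h \<open>0 < e\<close> by simp
    from tendstoD[OF lim this] obtain T where T: "\<And>t. t \<ge> T \<Longrightarrow> norm (f t) < h * e / 4"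
      by (auto simp: eventually_at_top_linorder)
    have "norm (u t) < e" if "t \<ge> max T (t0 + 1)" for t
    proof -
      have "h * norm (u t) < h * e / 4 + h * e / 4 + C * h * h"
        using key[of t h] T[of t] T[of "t + h"] h that by linarith
      also have "\<dots> \<le> h * e / 4 + h * e / 4 + e / 2 * h"
        using mult_right_mono[OF h(2), of h] h(1) by linarith
      finally have "h * norm (u t) < h * e" by (simp add: mult.commute)
      then show ?thesis using h by simp
    qed
    then show "\<forall>\<^sub>F t in at_top. dist (u t) 0 < e"
      unfolding eventually_at_top_linorder by (intro exI[of _ "max T (t0 + 1)"]) auto
  qed
qed

subsection \<open>Functions of power growth with respect to a scale\<close>

lemma has_vector_derivative_iff_quotient:
  "(f has_vector_derivative D) (at x) \<longleftrightarrow> ((\<lambda>y. (f y - f x) /\<^sub>R (y - x)) \<longlongrightarrow> D) (at x)"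
  for f :: "real \<Rightarrow> 'a::real_normed_vector"
proof -
  have eq: "norm (f y - f x - (y - x) *\<^sub>R D) / norm (y - x) = norm ((f y - f x) /\<^sub>R (y - x) - D)"
    if "y \<noteq> x" for y
  proof -
    have "(f y - f x) /\<^sub>R (y - x) - D = (f y - f x - (y - x) *\<^sub>R D) /\<^sub>R (y - x)"
      using that by (simp add: scaleR_right_diff_distrib)
    then show ?thesis by (simp add: divide_inverse mult.commute)
  qed
  have "(f has_vector_derivative D) (at x) \<longleftrightarrow>
      ((\<lambda>y. norm (f y - f x - (y - x) *\<^sub>R D) / norm (y - x)) \<longlongrightarrow> 0) (at x)"
    by (simp add: has_vector_derivative_def has_derivative_iff_norm bounded_linear_scaleR_left)
  also have "\<dots> \<longleftrightarrow> ((\<lambda>y. norm ((f y - f x) /\<^sub>R (y - x) - D)) \<longlongrightarrow> 0) (at x)"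
    by (rule tendsto_cong, simp only: eventually_at_filter) (use eq in \<open>auto intro!: always_eventually\<close>)
  also have "\<dots> \<longleftrightarrow> ((\<lambda>y. (f y - f x) /\<^sub>R (y - x)) \<longlongrightarrow> D) (at x)"
    by (simp add: tendsto_norm_zero_iff LIM_zero_iff)
  finally show ?thesis .
qed

text \<open>Everything follows from \<open>\<Lambda> s - \<Lambda> t = - \<Lambda> s (L s - L t)
  \<Lambda> t\<close>: local boundedness of \<open>\<Lambda>\<close>, then its continuity, then the
  limit of the difference quotient. The inverse is given, so no Neumann series and no completeness
  enter.\<close>

lemma has_vector_derivative_blinfun_inverse:
  fixes L \<Lambda> :: "real \<Rightarrow> 'a::real_normed_vector \<Rightarrow>\<^sub>L 'a"
  assumes L: "(L has_vector_derivative L') (at t)" and S: "open S" "t \<in> S"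
    and left: "\<And>s. s \<in> S \<Longrightarrow> \<Lambda> s o\<^sub>L L s = id_blinfun"
    and right: "\<And>s. s \<in> S \<Longrightarrow> L s o\<^sub>L \<Lambda> s = id_blinfun"
  shows "(\<Lambda> has_vector_derivative - (\<Lambda> t o\<^sub>L L' o\<^sub>L \<Lambda> t)) (at t)"
proof -
  have diff: "\<Lambda> s - \<Lambda> t = - (\<Lambda> s o\<^sub>L (L s - L t) o\<^sub>L \<Lambda> t)" if "s \<in> S" for s
  proof (rule blinfun_eqI)
    fix v
    have l: "\<Lambda> s (L s w) = w" for w
      using left[OF that] by (metis blinfun_apply_blinfun_compose blinfun_apply_id_blinfun id_apply)
    have r: "L t (\<Lambda> t w) = w" for w
      using right[OF S(2)] by (metis blinfun_apply_blinfun_compose blinfun_apply_id_blinfun id_apply)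
    show "(\<Lambda> s - \<Lambda> t) v = (- (\<Lambda> s o\<^sub>L (L s - L t) o\<^sub>L \<Lambda> t)) v"
      by (simp add: blinfun.bilinear_simps l r)
  qed
  have ev_S: "\<forall>\<^sub>F s in at t. s \<in> S"
    using S by (auto simp: eventually_at_topological)
  have L_lim: "(L \<longlongrightarrow> L t) (at t)"
    using has_vector_derivative_continuous[OF L] by (simp add: isCont_def)
  have "\<forall>\<^sub>F s in at t. norm (\<Lambda> s) \<le> 2 * norm (\<Lambda> t)"
  proof -
    \<comment> \<open>This radius makes the identity yield
      \<open>|\<Lambda> s| \<le> |\<Lambda> t| + |\<Lambda> s| / 2\<close>, and the last term is
      absorbed on the left.\<close>
    have "0 < 1 / (2 * (norm (\<Lambda> t) + 1))" by (simp add: add_nonneg_pos)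
    from tendstoD[OF L_lim this] ev_S show ?thesis
    proof eventually_elim
      case (elim s)
      have "norm (\<Lambda> s) \<le> norm (\<Lambda> t) + norm (\<Lambda> s - \<Lambda> t)"
        by (metis norm_triangle_sub)
      also have "norm (\<Lambda> s - \<Lambda> t) \<le> norm (\<Lambda> s) * norm (L s - L t) * norm (\<Lambda> t)"
        unfolding diff[OF elim(2)] norm_minus_cancel
        by (meson norm_blinfun_compose order_trans mult_right_mono norm_ge_zero)
      also have "\<dots> \<le> norm (\<Lambda> s) * (1 / (2 * (norm (\<Lambda> t) + 1))) * norm (\<Lambda> t)"
        using elim(1) by (intro mult_right_mono mult_left_mono) (auto simp: dist_norm)
      also have "\<dots> \<le> norm (\<Lambda> s) * (1 / 2)"
      proof -
        have "1 / (2 * (norm (\<Lambda> t) + 1)) * norm (\<Lambda> t) \<le> 1 / 2"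
          by (simp add: field_simps add_pos_nonneg)
        from mult_left_mono[OF this, of "norm (\<Lambda> s)"] show ?thesis by (simp add: mult.assoc)
      qed
      finally show ?case by simp
    qed
  qed
  then have "Bfun \<Lambda> (at t)" by (rule BfunI)
  have zero: "((\<lambda>s. L s - L t) \<longlongrightarrow> 0) (at t)" using L_lim by (simp add: LIM_zero_iff)
  have "((\<lambda>s. (L s - L t) o\<^sub>L \<Lambda> t) \<longlongrightarrow> 0) (at t)"
    using bounded_bilinear.tendsto_left_zero[OF bounded_bilinear_blinfun_compose zero] .
  then have "((\<lambda>s. \<Lambda> s o\<^sub>L ((L s - L t) o\<^sub>L \<Lambda> t)) \<longlongrightarrow> 0) (at t)"
    using bounded_bilinear.Bfun_prod_Zfun[OF bounded_bilinear_blinfun_compose \<open>Bfun \<Lambda> (at t)\<close>]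
    by (simp add: tendsto_Zfun_iff)
  from tendsto_minus[OF this]
  have "((\<lambda>s. - (\<Lambda> s o\<^sub>L ((L s - L t) o\<^sub>L \<Lambda> t))) \<longlongrightarrow> 0) (at t)" by simp
  then have "((\<lambda>s. \<Lambda> s - \<Lambda> t) \<longlongrightarrow> 0) (at t)"
  proof (rule Lim_transform_eventually)
    show "\<forall>\<^sub>F s in at t. - (\<Lambda> s o\<^sub>L ((L s - L t) o\<^sub>L \<Lambda> t)) = \<Lambda> s - \<Lambda> t"
      using ev_S by eventually_elim (simp add: diff blinfun_eqI)
  qed
  then have \<Lambda>_lim: "(\<Lambda> \<longlongrightarrow> \<Lambda> t) (at t)" by (simp add: LIM_zero_iff)
  have "((\<lambda>s. (L s - L t) /\<^sub>R (s - t)) \<longlongrightarrow> L') (at t)"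
    using L by (simp add: has_vector_derivative_iff_quotient)
  then have "((\<lambda>s. - (\<Lambda> s o\<^sub>L ((L s - L t) /\<^sub>R (s - t)) o\<^sub>L \<Lambda> t)) \<longlongrightarrow> - (\<Lambda> t o\<^sub>L L' o\<^sub>L \<Lambda> t)) (at t)"
    by (intro tendsto_minus bounded_bilinear.tendsto[OF bounded_bilinear_blinfun_compose] \<Lambda>_lim
        tendsto_const)
  moreover have "\<forall>\<^sub>F s in at t. - (\<Lambda> s o\<^sub>L ((L s - L t) /\<^sub>R (s - t)) o\<^sub>L \<Lambda> t)
      = (\<Lambda> s - \<Lambda> t) /\<^sub>R (s - t)"
    using ev_S
    by eventually_elim (simp add: diff bounded_bilinear.scaleR_left[OF bounded_bilinear_blinfun_compose]
        bounded_bilinear.scaleR_right[OF bounded_bilinear_blinfun_compose])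
  ultimately show ?thesis
    unfolding has_vector_derivative_iff_quotient by (rule Lim_transform_eventually)
qed

text \<open>A symbol class: \<open>j\<close> is the order in the scale \<open>m\<close>, and
  \<open>k\<close> counts the derivatives controlled. All derivatives have the same order
  \<open>j\<close>, as fits expressions in a solution of a linear autonomous equation whose norm is
  the scale.\<close>

primrec tame :: "real \<Rightarrow> (real \<Rightarrow> real) \<Rightarrow> int \<Rightarrow> nat \<Rightarrow> (real \<Rightarrow> 'a::real_normed_vector) \<Rightarrow> bool"
  where
    "tame t0 m j 0 X \<longleftrightarrow> (\<exists>C. \<forall>t>t0. norm (X t) \<le> C * m t powi j)"
  | "tame t0 m j (Suc k) X \<longleftrightarrow> (\<exists>C. \<forall>t>t0. norm (X t) \<le> C * m t powi j) \<and>
      (\<exists>X'. (\<forall>t>t0. (X has_vector_derivative X' t) (at t)) \<and> tame t0 m j k X')"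

locale scale =
  fixes t0 :: real and m :: "real \<Rightarrow> real"
  assumes m_ge_1: "t > t0 \<Longrightarrow> 1 \<le> m t"
begin

lemma m_pos: "t > t0 \<Longrightarrow> 0 < m t"
  using m_ge_1[of t] by simp

lemma tame_bound: 
  assumes "tame t0 m j k X"
  obtains C where "C \<ge> 0" "\<And>t. t > t0 \<Longrightarrow> norm (X t) \<le> C * m t powi j"
proof -
  obtain C where "\<And>t. t > t0 \<Longrightarrow> norm (X t) \<le> C * m t powi j"
    using assms by (cases k) auto
  then have "norm (X t) \<le> \<bar>C\<bar> * m t powi j" if "t > t0" for t
    using that m_pos[OF that]
    by (meson abs_ge_self mult_right_mono order_trans zero_le_power_int less_imp_le)
  then show ?thesis using that[of "\<bar>C\<bar>"] by simp
qed

lemma tame_SucI: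
  assumes "tame t0 m j 0 X" "\<And>t. t > t0 \<Longrightarrow> (X has_vector_derivative X' t) (at t)" "tame t0 m j k X'"
  shows "tame t0 m j (Suc k) X"
  using assms by auto

lemma tame_SucD: "tame t0 m j (Suc k) X \<Longrightarrow> tame t0 m j k X"
proof (induction k arbitrary: X)
  case (Suc k)
  then obtain X' where "\<forall>t>t0. (X has_vector_derivative X' t) (at t)" "tame t0 m j (Suc k) X'"
    by auto
  then show ?case using Suc by auto
qed auto

lemma tame_le: "tame t0 m j k X \<Longrightarrow> l \<le> k \<Longrightarrow> tame t0 m j l X"
  by (induction k) (auto simp: le_Suc_eq dest: tame_SucD simp del: tame.simps)

lemma tame_cong:
  assumes "\<And>t. t > t0 \<Longrightarrow> X t = Y t" "tame t0 m j k X"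
  shows "tame t0 m j k Y"
proof -
  have "(X has_vector_derivative D) (at t) \<longleftrightarrow> (Y has_vector_derivative D) (at t)" if "t > t0" for t D
    using assms(1) that
    by (intro has_vector_derivative_cong_ev)
      (auto simp: eventually_nhds intro!: exI[of _ "{t0<..}"])
  then show ?thesis using assms by (cases k) auto
qed

lemma tame_derivative:
  assumes "tame t0 m j (Suc k) X" "\<And>t. t > t0 \<Longrightarrow> (X has_vector_derivative X' t) (at t)"
  shows "tame t0 m j k X'"
proof -
  obtain Y where Y: "\<forall>t>t0. (X has_vector_derivative Y t) (at t)" "tame t0 m j k Y"
    using assms(1) by auto
  then have "Y t = X' t" if "t > t0" for t
    using assms(2) that vector_derivative_unique_at by blast
  then show ?thesis using Y(2) tame_cong by blast
qed

lemma tame_obtain_derivative: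
  assumes "tame t0 m j (Suc k) X"
  obtains X' where "\<And>t. t > t0 \<Longrightarrow> (X has_vector_derivative X' t) (at t)" "tame t0 m j k X'"
  using assms by auto

lemma tame_mono:
  assumes "tame t0 m i k X" "i \<le> j"
  shows "tame t0 m j k X"
  using assms(1)
proof (induction k arbitrary: X)
  case 0
  have "norm (X t) \<le> C * m t powi j" if "C \<ge> 0" "t > t0" "norm (X t) \<le> C * m t powi i" for C t
    using that m_ge_1[OF that(2)] power_int_increasing[OF assms(2)]
    by (meson mult_left_mono order_trans)
  then have "\<exists>C. \<forall>t>t0. norm (X t) \<le> C * m t powi j"
    by (rule_tac tame_bound[OF 0]) blast
  then show ?case by simp
next
  case (Suc k)
  have "norm (X t) \<le> C * m t powi j" if "C \<ge> 0" "t > t0" "norm (X t) \<le> C * m t powi i" for C t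
    using that m_ge_1[OF that(2)] power_int_increasing[OF assms(2)]
    by (meson mult_left_mono order_trans)
  then have "\<exists>C. \<forall>t>t0. norm (X t) \<le> C * m t powi j"
    by (rule_tac tame_bound[OF Suc.prems]) blast
  then show ?case using Suc by auto
qed

lemma tame_const: "tame t0 m 0 k (\<lambda>_. c)"
proof -
  have zero: "tame t0 m 0 k (\<lambda>_. 0::'a)" for k
    by (induction k) (auto intro: exI[of _ "\<lambda>_. 0"])
  show ?thesis
    by (cases k) (auto intro!: exI[of _ "\<lambda>_. 0"] exI[of _ "norm c"] zero)
qed

lemma tame_linear:
  assumes f: "bounded_linear f" and X: "tame t0 m j k X"
  shows "tame t0 m j k (\<lambda>t. f (X t))"
proof -
  have bd: "\<exists>C. \<forall>t>t0. norm (f (X t)) \<le> C * m t powi j" if X: "tame t0 m j k X" for k X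
  proof -
    obtain K where K: "\<And>x. norm (f x) \<le> norm x * K" "K \<ge> 0"
      using bounded_linear.nonneg_bounded[OF f] by blast
    obtain C where C: "\<And>t. t > t0 \<Longrightarrow> norm (X t) \<le> C * m t powi j"
      by (rule tame_bound[OF X]) blast
    have "norm (f (X t)) \<le> (C * K) * m t powi j" if "t > t0" for t
      using K(1)[of "X t"] mult_right_mono[OF C[OF that] K(2)] by (simp add: mult_ac)
    then show ?thesis by blast
  qed
  show ?thesis using X
  proof (induction k arbitrary: X)
    case 0
    then show ?case using bd by fastforce
  next
    case (Suc k)
    then obtain X' where X': "\<And>t. t > t0 \<Longrightarrow> (X has_vector_derivative X' t) (at t)"
      "tame t0 m j k X'" by auto
    show ?case
      by (rule tame_SucI[OF _ bounded_linear.has_vector_derivative[OF f X'(1)] Suc.IH[OF X'(2)]])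
        (use bd[OF Suc.prems] in simp_all)
  qed
qed

lemma tame_add:
  assumes "tame t0 m j k X" "tame t0 m j k Y"
  shows "tame t0 m j k (\<lambda>t. X t + Y t)"
proof -
  have bd: "\<exists>C. \<forall>t>t0. norm (X t + Y t) \<le> C * m t powi j"
    if X: "tame t0 m j k X" and Y: "tame t0 m j k Y" for k X Y
  proof -
    obtain C where C: "\<And>t. t > t0 \<Longrightarrow> norm (X t) \<le> C * m t powi j"
      by (rule tame_bound[OF X]) blast
    obtain D where D: "\<And>t. t > t0 \<Longrightarrow> norm (Y t) \<le> D * m t powi j"
      by (rule tame_bound[OF Y]) blast
    have "norm (X t + Y t) \<le> (C + D) * m t powi j" if "t > t0" for t
      using norm_triangle_ineq[of "X t" "Y t"] C[OF that] D[OF that] by (simp add: algebra_simps)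
    then show ?thesis by blast
  qed
  show ?thesis using assms
  proof (induction k arbitrary: X Y)
    case 0
    then show ?case using bd by fastforce
  next
    case (Suc k)
    obtain X' where X': "\<And>t. t > t0 \<Longrightarrow> (X has_vector_derivative X' t) (at t)"
      "tame t0 m j k X'" using Suc.prems(1) by auto
    obtain Y' where Y': "\<And>t. t > t0 \<Longrightarrow> (Y has_vector_derivative Y' t) (at t)"
      "tame t0 m j k Y'" using Suc.prems(2) by auto
    show ?case
      by (rule tame_SucI[OF _ has_vector_derivative_add[OF X'(1) Y'(1)] Suc.IH[OF X'(2) Y'(2)]])
        (use bd[OF Suc.prems] in simp_all)
  qed
qed

lemma tame_bilinear:
  assumes f: "bounded_bilinear f" and "tame t0 m i k X" "tame t0 m j k Y"
  shows "tame t0 m (i + j) k (\<lambda>t. f (X t) (Y t))"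
proof -
  have bd: "\<exists>C. \<forall>t>t0. norm (f (X t) (Y t)) \<le> C * m t powi (i + j)"
    if X: "tame t0 m i k X" and Y: "tame t0 m j k Y" for k X Y
  proof -
    obtain K where K: "\<And>x y. norm (f x y) \<le> norm x * norm y * K" "K > 0"
      using bounded_bilinear.pos_bounded[OF f] by blast
    obtain C where C: "C \<ge> 0" "\<And>t. t > t0 \<Longrightarrow> norm (X t) \<le> C * m t powi i"
      by (rule tame_bound[OF X]) blast
    obtain D where D: "\<And>t. t > t0 \<Longrightarrow> norm (Y t) \<le> D * m t powi j"
      by (rule tame_bound[OF Y]) blast
    have "norm (f (X t) (Y t)) \<le> (C * D * K) * m t powi (i + j)" if "t > t0" for t
    proof -
      have "norm (f (X t) (Y t)) \<le> norm (X t) * norm (Y t) * K" by (rule K)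
      also have "\<dots> \<le> (C * m t powi i) * (D * m t powi j) * K"
        using C(1) m_pos[OF that] K(2)
        by (intro mult_right_mono mult_mono C D that) auto
      also have "\<dots> = (C * D * K) * m t powi (i + j)"
        using m_pos[OF that] by (simp add: power_int_add)
      finally show ?thesis .
    qed
    then show ?thesis by blast
  qed
  show ?thesis using assms(2,3)
  proof (induction k arbitrary: X Y)
    case 0
    then show ?case using bd by fastforce
  next
    case (Suc k)
    obtain X' where X': "\<And>t. t > t0 \<Longrightarrow> (X has_vector_derivative X' t) (at t)"
      "tame t0 m i k X'" using Suc.prems(1) by auto
    obtain Y' where Y': "\<And>t. t > t0 \<Longrightarrow> (Y has_vector_derivative Y' t) (at t)"
      "tame t0 m j k Y'" using Suc.prems(2) by auto
    have D: "tame t0 m (i + j) k (\<lambda>t. f (X t) (Y' t) + f (X' t) (Y t))"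
      by (intro tame_add Suc.IH X' Y' tame_SucD[OF Suc.prems(1)] tame_SucD[OF Suc.prems(2)])
    show ?case
      by (rule tame_SucI[OF _ bounded_bilinear.has_vector_derivative[OF f X'(1) Y'(1)] D])
        (use bd[OF Suc.prems] in simp_all)
  qed
qed

lemmas tame_compose = tame_bilinear[OF bounded_bilinear_blinfun_compose]

lemma tame_minus: "tame t0 m j k X \<Longrightarrow> tame t0 m j k (\<lambda>t. - X t)"
  by (rule tame_linear[OF bounded_linear_minus[OF bounded_linear_ident]])

lemma tame_diff:
  "tame t0 m j k X \<Longrightarrow> tame t0 m j k Y \<Longrightarrow> tame t0 m j k (\<lambda>t. X t - Y t)"
  using tame_add[of j k X "\<lambda>t. - Y t"] tame_minus[of j k Y] by simp

lemma tame_scaleR: "tame t0 m j k X \<Longrightarrow> tame t0 m j k (\<lambda>t. c *\<^sub>R X t)"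
  by (rule tame_linear[OF bounded_linear_scaleR_right])

text \<open>Only the size of \<open>\<Lambda>\<close> itself has to be supplied. Its derivative
  \<open>- \<Lambda> L' \<Lambda>\<close> has order \<open>- j + j - j\<close>, so each derivative
  of \<open>L\<close> yields one of \<open>\<Lambda>\<close>.\<close>

lemma tame_inverse:
  fixes L \<Lambda> :: "real \<Rightarrow> 'a::real_normed_vector \<Rightarrow>\<^sub>L 'a"
  assumes L: "tame t0 m j k L"
    and left: "\<And>t. t > t0 \<Longrightarrow> \<Lambda> t o\<^sub>L L t = id_blinfun"
    and right: "\<And>t. t > t0 \<Longrightarrow> L t o\<^sub>L \<Lambda> t = id_blinfun"
    and \<Lambda>: "tame t0 m (- j) 0 \<Lambda>"
  shows "tame t0 m (- j) k \<Lambda>"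
  using L
proof (induction k)
  case (Suc k)
  obtain L' where L': "\<And>t. t > t0 \<Longrightarrow> (L has_vector_derivative L' t) (at t)"
    "tame t0 m j k L'" using Suc.prems by auto
  have IH: "tame t0 m (- j) k \<Lambda>" by (rule Suc.IH[OF tame_SucD[OF Suc.prems]])
  have "tame t0 m ((- j + j) + - j) k (\<lambda>t. \<Lambda> t o\<^sub>L L' t o\<^sub>L \<Lambda> t)"
    by (intro tame_compose L' IH)
  then have D: "tame t0 m (- j) k (\<lambda>t. - (\<Lambda> t o\<^sub>L L' t o\<^sub>L \<Lambda> t))"
    by (intro tame_minus) simp
  show ?case
  proof (rule tame_SucI[OF \<Lambda> _ D])
    show "(\<Lambda> has_vector_derivative - (\<Lambda> t o\<^sub>L L' t o\<^sub>L \<Lambda> t)) (at t)" if "t > t0" for t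
      by (rule has_vector_derivative_blinfun_inverse[OF L'(1)[OF that], of "{t0<..}"])
        (use that left right in auto)
  qed
qed (rule \<Lambda>)

end

subsection \<open>Positive definite operators\<close>

lemma positive_blinfun_coercive:
  fixes P :: "'a::euclidean_space \<Rightarrow>\<^sub>L 'a"
  assumes pos: "\<And>x. x \<noteq> 0 \<Longrightarrow> 0 < x \<bullet> P x"
  obtains p where "p > 0" "\<And>x. p * (norm x)\<^sup>2 \<le> x \<bullet> P x"
proof -
  obtain b :: 'a where b: "b \<in> Basis" using nonempty_Basis by blast
  have cont: "continuous_on (sphere 0 1) (\<lambda>x. x \<bullet> P x)"
    by (intro continuous_intros)
  have "sphere (0::'a) 1 \<noteq> {}"
    using b by (auto intro!: exI[of _ b])
  from continuous_attains_inf[OF compact_sphere this cont]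
  obtain x0 where x0: "x0 \<in> sphere 0 1" "\<And>x. x \<in> sphere 0 1 \<Longrightarrow> x0 \<bullet> P x0 \<le> x \<bullet> P x"
    by blast
  show ?thesis
  proof
    show "0 < x0 \<bullet> P x0" using pos[of x0] x0(1) by (metis mem_sphere_0 norm_zero zero_neq_one)
    fix x :: 'a
    show "(x0 \<bullet> P x0) * (norm x)\<^sup>2 \<le> x \<bullet> P x"
    proof (cases "x = 0")
      case False
      have "x0 \<bullet> P x0 \<le> (x /\<^sub>R norm x) \<bullet> P (x /\<^sub>R norm x)"
        using False by (intro x0(2)) simp
      also have "\<dots> = (x \<bullet> P x) / (norm x)\<^sup>2"
        by (simp add: blinfun.scaleR_right power2_eq_square divide_inverse)
      finally show ?thesis using False by (simp add: pos_le_divide_eq)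
    qed simp
  qed
qed

lemma positive_blinfun_inverse:
  fixes P :: "'a::euclidean_space \<Rightarrow>\<^sub>L 'a"
  assumes pos: "\<And>x. x \<noteq> 0 \<Longrightarrow> 0 < x \<bullet> P x"
  obtains Q :: "'a \<Rightarrow>\<^sub>L 'a" where "\<And>x. Q (P x) = x" "\<And>x. P (Q x) = x"
proof -
  have "linear P" by (simp add: blinfun.bounded_linear_right bounded_linear.linear)
  moreover have "inj P"
  proof (rule injI)
    fix x y assume "P x = P y"
    then have "P (x - y) = 0" by (simp add: blinfun.diff_right)
    then show "x = y" using pos[of "x - y"] by auto
  qed
  ultimately obtain g where g: "linear g" "\<And>x. g (P x) = x" "\<And>x. P (g x) = x"
    using linear_injective_isomorphism[of P] by blast
  show ?thesis
    by (rule that[of "Blinfun g"])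
      (simp_all add: g bounded_linear_Blinfun_apply linear_conv_bounded_linear[symmetric])
qed

lemma symmetric_blinfun_inverse:
  fixes P Q :: "'a::real_inner \<Rightarrow>\<^sub>L 'a"
  assumes "\<And>x y. x \<bullet> P y = P x \<bullet> y" "\<And>x. P (Q x) = x"
  shows "x \<bullet> Q y = Q x \<bullet> y"
  using assms(1)[of "Q x" "Q y"] by (simp add: assms(2))

lemma norm_blinfun_le:
  fixes f :: "'a::real_normed_vector \<Rightarrow>\<^sub>L 'b::real_normed_vector"
  assumes that: "norm f \<le> F" "norm x \<le> X"
  shows "norm (f x) \<le> F * X"
proof -
  have "norm (f x) \<le> norm f * norm x" by (rule norm_blinfun)
  also have "\<dots> \<le> F * X" using that by (intro mult_mono) (auto intro: order_trans[OF norm_ge_zero])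
  finally show ?thesis .
qed

lemma inner_le_mult: "y \<bullet> z \<le> Y * Z" if "norm y \<le> Y" "norm z \<le> Z" for y z :: "'a::real_inner"
proof -
  have "y \<bullet> z \<le> norm y * norm z" by (rule norm_cauchy_schwarz)
  also have "\<dots> \<le> Y * Z" using that by (intro mult_mono) (auto intro: order_trans[OF norm_ge_zero])
  finally show ?thesis .
qed

subsection \<open>The Lyapunov function of the fast dynamics\<close>

text \<open>The term \<open>b \<bullet> H v\<close> has two parts: \<open>a \<Lambda>\<close> spreads the damping of \<open>b\<close> over both
  components, and \<open>- 2 \<Lambda> J \<Lambda>\<close> cancels the terms of order one that stem from \<open>N\<close> and from the
  derivative of \<open>\<Lambda>\<close> and have no sign.\<close>

lemma fast_energy_derivative:
  fixes P L \<Lambda> \<Lambda>' J J' N X H H' :: "'a::real_inner \<Rightarrow>\<^sub>L 'a"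
  assumes P: "\<And>x y. x \<bullet> P y = P x \<bullet> y" and \<Lambda>: "\<And>x y. x \<bullet> \<Lambda> y = \<Lambda> x \<bullet> y"
    and \<Lambda>L: "\<And>x. \<Lambda> (L x) = x" 
    and J: "\<And>x y. x \<bullet> J' y = J x \<bullet> y" and \<Lambda>': "\<And>x. \<Lambda>' x = - \<Lambda> (J (\<Lambda> x) + J' (\<Lambda> x))"
    and N: "\<And>x. P (N x) = \<Lambda> (J (P x))"
    and H: "\<And>x. H x = a *\<^sub>R \<Lambda> x - 2 *\<^sub>R \<Lambda> (J (\<Lambda> x))"
    and b': "b' = N b - a *\<^sub>R b - v + r" and v': "v' = L (P b) - X b + y"
  shows "(b \<bullet> P b' + b' \<bullet> P b) + (v \<bullet> (\<Lambda> v' + \<Lambda>' v) + v' \<bullet> \<Lambda> v) + (b \<bullet> (H v' + H' v) + b' \<bullet> H v)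
    = - a * (b \<bullet> P b) - a * (v \<bullet> \<Lambda> v)
      + (2 * (b \<bullet> P r) - 2 * (v \<bullet> \<Lambda> (X b)) + 2 * (v \<bullet> \<Lambda> y) + (N b - a *\<^sub>R b + r) \<bullet> H v
        + b \<bullet> H' v - b \<bullet> H (X b) + b \<bullet> H y)"
proof -
  define w where "w = \<Lambda> v"
  have "b' \<bullet> P b = b \<bullet> P b'" using P[of b' b] by (simp add: inner_commute)
  then have 1: "b \<bullet> P b' + b' \<bullet> P b
      = 2 * (b \<bullet> P (N b)) - 2 * a * (b \<bullet> P b) - 2 * (b \<bullet> P v) + 2 * (b \<bullet> P r)"
    by (simp add: b' blinfun.bilinear_simps inner_simps)
  have "v' \<bullet> \<Lambda> v = v \<bullet> \<Lambda> v'" using \<Lambda>[of v' v] by (simp add: inner_commute)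
  moreover have "v \<bullet> P b = b \<bullet> P v" using P[of v b] by (simp add: inner_commute)
  ultimately have 2: "v \<bullet> \<Lambda> v' + v' \<bullet> \<Lambda> v
      = 2 * (b \<bullet> P v) - 2 * (v \<bullet> \<Lambda> (X b)) + 2 * (v \<bullet> \<Lambda> y)"
    by (simp add: v' blinfun.bilinear_simps inner_simps \<Lambda>L)
  have "w \<bullet> J' w = w \<bullet> J w" using J[of w w] by (simp add: inner_commute)
  then have 3: "v \<bullet> \<Lambda>' v = - 2 * (w \<bullet> J w)"
    using \<Lambda>[of v "J w"] \<Lambda>[of v "J' w"]
    by (simp add: \<Lambda>' blinfun.bilinear_simps inner_simps w_def[symmetric])
  \<comment> \<open>On \<open>L (P b)\<close> the first part of \<open>H\<close> returns half of the
    damping of \<open>b\<close>, and the second part cancels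
    \<open>2 * (b \<bullet> P (N b))\<close> from the first equation.\<close>
  have 4: "b \<bullet> H v' = a * (b \<bullet> P b) - 2 * (b \<bullet> P (N b)) - b \<bullet> H (X b) + b \<bullet> H y"
    by (simp add: v' blinfun.bilinear_simps inner_simps H[of "L (P b)"] \<Lambda>L N)
  \<comment> \<open>Entering with a minus sign through \<open>b'\<close>, this supplies the damping
    of \<open>v\<close> and cancels \<open>v \<bullet> \<Lambda>' v\<close>.\<close>
  have 5: "v \<bullet> H v = a * (v \<bullet> \<Lambda> v) - 2 * (w \<bullet> J w)"
    using \<Lambda>[of v "J w"] by (simp add: H inner_simps w_def)
  have 6: "b' \<bullet> H v = (N b - a *\<^sub>R b + r) \<bullet> H v - v \<bullet> H v"
    by (simp add: b' inner_simps)
  show ?thesis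
    using 1 2 3 4 5 6 by (simp add: inner_add_right algebra_simps)
qed

text \<open>For use with \<open>x = 1 / m\<close>. The weight \<open>\<Lambda>\<close> of
  \<open>v\<close> has order \<open>x^2\<close>, so \<open>\<eta> = x |v|\<close> is the quantity on
  a par with \<open>|b|\<close>. Terms quadratic in \<open>b\<close> and \<open>v\<close> keep a
  factor \<open>x\<close> and can be absorbed by damping; terms containing \<open>r\<close> or
  \<open>y\<close> carry \<open>x^2\<close> and act as forcing. The coefficient is a common upper
  bound for \<open>4 K^2 + a K + K\<close> and \<open>6 K^2\<close>, the sums over the two
  kinds.\<close>

lemma fast_energy_error:
  fixes P \<Lambda> N X H H' :: "'a::real_inner \<Rightarrow>\<^sub>L 'a" and b v r y :: 'a and x a K :: real
  assumes x: "0 < x" "x \<le> 1" and K: "0 \<le> K" and a: "0 \<le> a"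
    and bounds: "norm P \<le> K" "norm \<Lambda> \<le> K * x\<^sup>2" "norm N \<le> K" "norm X \<le> K"
      "norm H \<le> K * x\<^sup>2" "norm H' \<le> K * x\<^sup>2" "norm r \<le> K * x\<^sup>2" "norm y \<le> K * x"
  defines "\<beta> \<equiv> norm b" and "\<eta> \<equiv> x * norm v"
  shows "2 * (b \<bullet> P r) - 2 * (v \<bullet> \<Lambda> (X b)) + 2 * (v \<bullet> \<Lambda> y) + (N b - a *\<^sub>R b + r) \<bullet> H v
        + b \<bullet> H' v - b \<bullet> H (X b) + b \<bullet> H y
    \<le> (9 * K\<^sup>2 + a * K + K) * (x * (\<beta>\<^sup>2 + \<eta>\<^sup>2) + x\<^sup>2 * (\<beta> + \<eta>))"
proof -
  define s where "s = \<beta>\<^sup>2 + \<eta>\<^sup>2"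
  define q where "q = x\<^sup>2 * (\<beta> + \<eta>)"
  have nn: "0 \<le> \<beta>" "0 \<le> \<eta>" "0 \<le> q" "0 \<le> x * s"
    using x by (auto simp: \<beta>_def \<eta>_def q_def s_def)
  have \<beta>\<eta>: "x * (\<beta> * \<eta>) \<le> x * s"
  proof (rule mult_left_mono)
    have "2 * (\<beta> * \<eta>) \<le> s"
      using sum_squares_bound[of \<beta> \<eta>] by (simp add: s_def)
    then show "\<beta> * \<eta> \<le> s" using nn by (smt (verit) mult_nonneg_nonneg)
  qed (use x in simp)
  have \<beta>\<beta>: "x\<^sup>2 * \<beta>\<^sup>2 \<le> x * s"
  proof -
    have "x\<^sup>2 \<le> x" using x by (simp add: power2_eq_square mult_left_le)
    then show ?thesis unfolding s_def using x by (intro mult_mono) auto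
  qed
  have x3: "x ^ 3 * c \<le> x\<^sup>2 * c" if "0 \<le> c" for c
    using x that by (intro mult_right_mono power_decreasing) auto
  have q1: "x\<^sup>2 * \<beta> \<le> q" and q2: "x\<^sup>2 * \<eta> \<le> q"
    using nn by (auto simp: q_def algebra_simps)
  have q3: "x ^ 3 * \<beta> \<le> q" and q4: "x ^ 3 * \<eta> \<le> q"
    using x3[OF nn(1)] x3[OF nn(2)] q1 q2 by auto
  have b: "norm b \<le> \<beta>" "norm (- b) \<le> \<beta>" by (auto simp: \<beta>_def)
  have v: "norm v \<le> norm v" "norm (- v) \<le> norm v" by auto
  have 1: "b \<bullet> P r \<le> K\<^sup>2 * q"
  proof -
    have "b \<bullet> P r \<le> \<beta> * (K * (K * x\<^sup>2))"
      by (intro inner_le_mult norm_blinfun_le bounds b)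
    also have "\<dots> = K\<^sup>2 * (x\<^sup>2 * \<beta>)" by (simp add: power2_eq_square)
    finally show ?thesis using mult_left_mono[OF q1, of "K\<^sup>2"] by simp
  qed
  have 2: "(- v) \<bullet> \<Lambda> (X b) \<le> K\<^sup>2 * (x * s)"
  proof -
    have "(- v) \<bullet> \<Lambda> (X b) \<le> norm v * ((K * x\<^sup>2) * (K * \<beta>))"
      by (intro inner_le_mult norm_blinfun_le bounds b v)
    also have "\<dots> = K\<^sup>2 * (x * (\<beta> * \<eta>))" by (simp add: power2_eq_square \<eta>_def)
    finally show ?thesis using mult_left_mono[OF \<beta>\<eta>, of "K\<^sup>2"] by simp
  qed
  have 3: "v \<bullet> \<Lambda> y \<le> K\<^sup>2 * q"
  proof -
    have "v \<bullet> \<Lambda> y \<le> norm v * ((K * x\<^sup>2) * (K * x))"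
      by (intro inner_le_mult norm_blinfun_le bounds b v)
    also have "\<dots> = K\<^sup>2 * (x\<^sup>2 * \<eta>)" by (simp add: power2_eq_square \<eta>_def)
    finally show ?thesis using mult_left_mono[OF q2, of "K\<^sup>2"] by simp
  qed
  have 4: "(N b - a *\<^sub>R b + r) \<bullet> H v \<le> (K\<^sup>2 + a * K) * (x * s) + K\<^sup>2 * q"
  proof -
    have ab: "norm (a *\<^sub>R b) \<le> a * \<beta>" using a by (simp add: \<beta>_def)
    have "norm (N b - a *\<^sub>R b + r) \<le> norm (N b) + norm (a *\<^sub>R b) + norm r"
      by (meson norm_triangle_ineq norm_triangle_ineq4 add_right_mono order_trans)
    also have "\<dots> \<le> K * \<beta> + a * \<beta> + K * x\<^sup>2"
      by (intro add_mono norm_blinfun_le bounds b ab)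
    finally have "(N b - a *\<^sub>R b + r) \<bullet> H v \<le> (K * \<beta> + a * \<beta> + K * x\<^sup>2) * ((K * x\<^sup>2) * norm v)"
      by (intro inner_le_mult norm_blinfun_le bounds v)
    also have "\<dots> = (K\<^sup>2 + a * K) * (x * (\<beta> * \<eta>)) + K\<^sup>2 * (x ^ 3 * \<eta>)"
      by (simp add: power2_eq_square power3_eq_cube \<eta>_def algebra_simps)
    finally show ?thesis
      using mult_left_mono[OF \<beta>\<eta>, of "K\<^sup>2 + a * K"] mult_left_mono[OF q4, of "K\<^sup>2"] a K by simp
  qed
  have 5: "b \<bullet> H' v \<le> K * (x * s)"
  proof -
    have "b \<bullet> H' v \<le> \<beta> * ((K * x\<^sup>2) * norm v)"
      by (intro inner_le_mult norm_blinfun_le bounds b v)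
    also have "\<dots> = K * (x * (\<beta> * \<eta>))" by (simp add: power2_eq_square \<eta>_def)
    finally show ?thesis using mult_left_mono[OF \<beta>\<eta>, of K] K by simp
  qed
  have 6: "(- b) \<bullet> H (X b) \<le> K\<^sup>2 * (x * s)"
  proof -
    have "(- b) \<bullet> H (X b) \<le> \<beta> * ((K * x\<^sup>2) * (K * \<beta>))"
      by (intro inner_le_mult norm_blinfun_le bounds b v)
    also have "\<dots> = K\<^sup>2 * (x\<^sup>2 * \<beta>\<^sup>2)" by (simp add: power2_eq_square)
    finally show ?thesis using mult_left_mono[OF \<beta>\<beta>, of "K\<^sup>2"] by simp
  qed
  have 7: "b \<bullet> H y \<le> K\<^sup>2 * q"
  proof -
    have "b \<bullet> H y \<le> \<beta> * ((K * x\<^sup>2) * (K * x))"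
      by (intro inner_le_mult norm_blinfun_le bounds b v)
    also have "\<dots> = K\<^sup>2 * (x ^ 3 * \<beta>)" by (simp add: power2_eq_square power3_eq_cube)
    finally show ?thesis using mult_left_mono[OF q3, of "K\<^sup>2"] by simp
  qed
  have "2 * (b \<bullet> P r) - 2 * (v \<bullet> \<Lambda> (X b)) + 2 * (v \<bullet> \<Lambda> y) + (N b - a *\<^sub>R b + r) \<bullet> H v
        + b \<bullet> H' v - b \<bullet> H (X b) + b \<bullet> H y
    \<le> (4 * K\<^sup>2 + a * K + K) * (x * s) + (6 * K\<^sup>2) * q"
    using 1 2 3 4 5 6 7 by (simp add: algebra_simps)
  also have "\<dots> \<le> (9 * K\<^sup>2 + a * K + K) * (x * s) + (9 * K\<^sup>2 + a * K + K) * q"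
    using nn a K by (intro add_mono mult_right_mono) auto
  finally show ?thesis by (simp add: s_def q_def distrib_left)
qed

text \<open>The scale \<open>m\<close> may decrease, but only at an exponential rate that is small compared with the
  damping rate \<open>k\<close>.\<close>

lemma forced_decay:
  fixes W m :: "real \<Rightarrow> real"
  assumes W: "\<And>t. t > t0 \<Longrightarrow> (W has_real_derivative W' t) (at t)"
    and le: "\<And>t. t > t0 \<Longrightarrow> W' t \<le> - k * W t + c / m t ^ 4"
    and nonneg: "\<And>t. t > t0 \<Longrightarrow> 0 \<le> W t" and pos: "0 < k" "0 \<le> c" "0 \<le> C"
    and m: "\<And>t. t > t0 \<Longrightarrow> 0 < m t"
    and growth: "\<And>s t. t0 < s \<Longrightarrow> s \<le> t \<Longrightarrow> m t \<le> C * exp (k / 8 * (t - s)) * m s"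
    and lim: "filterlim m at_top at_top"
  shows "((\<lambda>t. (m t)\<^sup>2 * W t) \<longlongrightarrow> 0) at_top"
proof -
  define s where "s = t0 + 1"
  have s: "s > t0" by (simp add: s_def)
  define D where "D = 2 * c * C ^ 4 / k"
  have D: "D \<ge> 0" using pos by (simp add: D_def)
  have upper: "(m t)\<^sup>2 * W t \<le> C\<^sup>2 * (m s)\<^sup>2 * W s * exp (- (3 * k / 4) * (t - s)) + D / (m t)\<^sup>2"
    if "t \<ge> s" for t
  proof -
    have t: "t > t0" using that s by simp
    define d where "d = D / m t ^ 4"
    \<comment> \<open>With \<open>t\<close> fixed, the subtracted term is an antiderivative in
      \<open>\<tau>\<close> of the bound for \<open>exp (k * \<tau>)\<close> times the forcing;
      integrating \<open>exp (k * \<tau> / 2)\<close> produces the factor \<open>2 / k\<close> in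
      \<open>D\<close>.\<close>
    define F where "F \<tau> = exp (k * \<tau>) * W \<tau> - d * exp (k * t / 2) * exp (k * \<tau> / 2)" for \<tau>
    have "F t \<le> F s"
    proof (rule DERIV_nonpos_imp_nonincreasing[OF that])
      fix \<tau> assume \<tau>: "s \<le> \<tau>" "\<tau> \<le> t"
      have \<tau>0: "\<tau> > t0" using \<tau> s by simp
      let ?F' = "exp (k * \<tau>) * (W' \<tau> + k * W \<tau>)
          - d * exp (k * t / 2) * (k / 2 * exp (k * \<tau> / 2))"
      have "(F has_real_derivative ?F') (at \<tau>)"
        unfolding F_def by (auto intro!: derivative_eq_intros W[OF \<tau>0] simp: algebra_simps)
      moreover have "?F' \<le> 0"
      proof -
        \<comment> \<open>The growth bound from \<open>\<tau>\<close> to \<open>t\<close> compares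
          past forcing with its present size. The fourth power turns the rate \<open>k / 8\<close>
          into \<open>k / 2\<close>, half of the damping rate.\<close>
        have "m t ^ 4 \<le> (C * exp (k / 8 * (t - \<tau>)) * m \<tau>) ^ 4"
          using growth[OF \<tau>0 \<tau>(2)] m[OF t] by (intro power_mono) auto
        also have "\<dots> = C ^ 4 * exp (k * (t - \<tau>) / 2) * m \<tau> ^ 4"
          by (simp add: power_mult_distrib exp_of_nat_mult[symmetric])
        finally have "1 / m \<tau> ^ 4 \<le> C ^ 4 * exp (k * (t - \<tau>) / 2) / m t ^ 4"
          using m[OF t] m[OF \<tau>0] by (simp add: divide_simps mult_ac)
        from mult_left_mono[OF this \<open>0 \<le> c\<close>]
        have "W' \<tau> + k * W \<tau> \<le> c * (C ^ 4 * exp (k * (t - \<tau>) / 2) / m t ^ 4)"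
          using le[OF \<tau>0] by simp
        from mult_left_mono[OF this, of "exp (k * \<tau>)"]
        have "exp (k * \<tau>) * (W' \<tau> + k * W \<tau>)
            \<le> c * C ^ 4 / m t ^ 4 * (exp (k * \<tau>) * exp (k * (t - \<tau>) / 2))"
          by (simp add: mult_ac)
        also have "exp (k * \<tau>) * exp (k * (t - \<tau>) / 2) = exp (k * t / 2) * exp (k * \<tau> / 2)"
          by (simp add: exp_add[symmetric] field_simps)
        also have "c * C ^ 4 / m t ^ 4 * (exp (k * t / 2) * exp (k * \<tau> / 2))
            = D / m t ^ 4 * exp (k * t / 2) * (k / 2 * exp (k * \<tau> / 2))"
          using pos by (simp add: D_def)
        finally show ?thesis by (simp add: d_def)
      qed
      ultimately show "\<exists>y. (F has_real_derivative y) (at \<tau>) \<and> y \<le> 0" by blast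
    qed
    then have "exp (k * t) * W t - D / m t ^ 4 * exp (k * t / 2) * exp (k * t / 2) \<le> exp (k * s) * W s"
      using D m[OF t] by (simp add: F_def d_def) (smt (verit) divide_nonneg_nonneg exp_ge_zero mult_nonneg_nonneg zero_le_even_power even_numeral)
    moreover have "exp (k * t / 2) * exp (k * t / 2) = exp (k * t)"
      by (simp add: exp_add[symmetric])
    ultimately have "exp (k * t) * W t \<le> exp (k * s) * W s + D / m t ^ 4 * exp (k * t)"
      by (simp add: mult.assoc)
    from mult_left_mono[OF this, of "exp (- k * t)"]
    have "W t \<le> exp (- k * (t - s)) * W s + D / m t ^ 4"
      by (simp add: exp_minus exp_diff field_simps)
    from mult_left_mono[OF this, of "(m t)\<^sup>2"]
    have "(m t)\<^sup>2 * W t \<le> (m t)\<^sup>2 * (exp (- k * (t - s)) * W s) + (m t)\<^sup>2 * (D / m t ^ 4)"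
      by (simp add: distrib_left)
    also have "(m t)\<^sup>2 * (D / m t ^ 4) = D / (m t)\<^sup>2"
      using m[OF t] by (simp add: field_simps power2_eq_square power4_eq_xxxx)
    finally have "(m t)\<^sup>2 * W t \<le> (m t)\<^sup>2 * (exp (- k * (t - s)) * W s) + D / (m t)\<^sup>2" .
    \<comment> \<open>The square of \<open>m\<close> grows at rate at most \<open>k / 4\<close>, so
      the transient still decays at rate \<open>3 k / 4\<close>.\<close>
    also have "(m t)\<^sup>2 * (exp (- k * (t - s)) * W s)
        \<le> (C * exp (k / 8 * (t - s)) * m s)\<^sup>2 * (exp (- k * (t - s)) * W s)"
      using growth[OF s that] m[OF t] nonneg[OF s] by (intro mult_right_mono power_mono) auto
    also have "\<dots> = C\<^sup>2 * (m s)\<^sup>2 * W s * (exp (k / 8 * (t - s)) * exp (k / 8 * (t - s)) * exp (- k * (t - s)))"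
      by (simp add: power2_eq_square mult_ac)
    also have "exp (k / 8 * (t - s)) * exp (k / 8 * (t - s)) * exp (- k * (t - s)) = exp (- (3 * k / 4) * (t - s))"
      by (simp add: exp_add[symmetric] field_simps)
    finally show ?thesis by simp
  qed
  have "((\<lambda>t. exp (- (3 * k / 4) * (t - s))) \<longlongrightarrow> 0) at_top"
    using pos(1) by real_asymp
  then have "((\<lambda>t. C\<^sup>2 * (m s)\<^sup>2 * W s * exp (- (3 * k / 4) * (t - s))) \<longlongrightarrow> 0) at_top"
    by (rule tendsto_mult_right_zero)
  moreover have "((\<lambda>t. D / (m t)\<^sup>2) \<longlongrightarrow> 0) at_top"
    by (intro tendsto_divide_0[OF tendsto_const] filterlim_at_top_imp_at_infinity
        filterlim_pow_at_top lim) simp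
  ultimately have "((\<lambda>t. C\<^sup>2 * (m s)\<^sup>2 * W s * exp (- (3 * k / 4) * (t - s)) + D / (m t)\<^sup>2) \<longlongrightarrow> 0) at_top"
    by (rule tendsto_add_zero)
  then show ?thesis
    by (rule tendsto_sandwich[OF _ _ tendsto_const, rotated 2])
      (use upper nonneg s in \<open>auto intro!: eventually_mono[OF eventually_ge_at_top[of s]]\<close>)
qed

subsection \<open>Convergence of the regressor term\<close>

lemma norm_minus_diff_add_le: "norm (- x - y + z) \<le> norm x + norm y + norm z"
  for x :: "'a::real_normed_vector"
  using norm_triangle_ineq[of "- x - y" z] norm_triangle_ineq4[of "- x" y] by simp

text \<open>Abstract form of the error system: \<open>q\<close> is the filtered disturbance error, \<open>\<sigma>\<close> the vectorized
  parameter error, \<open>em e \<sigma>\<close> stands for the product of the parameter error matrix with \<open>e\<close>, \<open>ad e\<close>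
  is the adjoint of \<open>em e\<close>, \<open>P = D\<^sup>T D\<close> and \<open>G = \<Gamma>\<close>.\<close>

locale adaptive =
  fixes em :: "'e::real_normed_vector \<Rightarrow>\<^sub>L 'b::euclidean_space \<Rightarrow>\<^sub>L 'a::euclidean_space"
    and ad :: "'e \<Rightarrow>\<^sub>L 'a \<Rightarrow>\<^sub>L 'b"
    and P :: "'a \<Rightarrow>\<^sub>L 'a" and G :: "'b \<Rightarrow>\<^sub>L 'b" and S M :: "'e \<Rightarrow>\<^sub>L 'e"
    and a B :: real and q :: "real \<Rightarrow> 'a" and \<sigma> :: "real \<Rightarrow> 'b" and x e :: "real \<Rightarrow> 'e"
    and r0 :: 'a and c :: 'e
  assumes adj: "y \<bullet> em w s = ad w y \<bullet> s" and ad_norm: "norm (ad w y) = norm w * norm y"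
    and P_sym: "y \<bullet> P y' = P y \<bullet> y'" and P_pos: "y \<noteq> 0 \<Longrightarrow> 0 < y \<bullet> P y"
    and G_sym: "s \<bullet> G s' = G s \<bullet> s'" and G_pos: "s \<noteq> 0 \<Longrightarrow> 0 < s \<bullet> G s"
    and a_pos: "a > 0"
    and q_deriv: "t > 0 \<Longrightarrow>
      (q has_vector_derivative - (a *\<^sub>R q t) - em (e t) (\<sigma> t) + exp (- a * t) *\<^sub>R r0) (at t)"
    and \<sigma>_deriv: "t > 0 \<Longrightarrow> (\<sigma> has_vector_derivative G (ad (e t) (P (q t)))) (at t)"
    and x_deriv: "t > 0 \<Longrightarrow> (x has_vector_derivative S (x t)) (at t)"
    and e_eq: "t > 0 \<Longrightarrow> e t = M (x t) + exp (- a * t) *\<^sub>R c"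
    and e_lower: "t > 0 \<Longrightarrow> norm (x t) \<le> B * (norm (e t) + 1)"
    and growth: "\<delta> > 0 \<Longrightarrow> \<exists>C\<ge>0. \<forall>s t. 0 \<le> s \<longrightarrow> s \<le> t \<longrightarrow> norm (x t) \<le> C * exp (\<delta> * (t - s)) * norm (x s)"
    and dichotomy: "(\<exists>C. \<forall>t\<ge>0. norm (x t) \<le> C) \<or> filterlim (\<lambda>t. norm (x t)) at_top at_top"
begin

definition e' where "e' t = M (S (x t)) - (a * exp (- a * t)) *\<^sub>R c"

lemma e_deriv:
  assumes "t > 0"
  shows "(e has_vector_derivative e' t) (at t)"
proof -
  have "((\<lambda>t. exp (- a * t)) has_vector_derivative - a * exp (- a * t)) (at t)"
    unfolding has_real_derivative_iff_has_vector_derivative[symmetric]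
    by (auto intro!: derivative_eq_intros)
  then have "((\<lambda>t. M (x t) + exp (- a * t) *\<^sub>R c) has_vector_derivative
      M (S (x t)) + (- a * exp (- a * t)) *\<^sub>R c) (at t)"
    by (intro has_vector_derivative_add
        bounded_linear.has_vector_derivative[OF blinfun.bounded_linear_right x_deriv[OF assms]]
        bounded_linear.has_vector_derivative[OF bounded_linear_scaleR_left])
  then have "((\<lambda>t. M (x t) + exp (- a * t) *\<^sub>R c) has_vector_derivative e' t) (at t)"
    by (simp add: e'_def)
  then show ?thesis
    by (rule has_vector_derivative_transform_within_open[of _ _ _ "{0<..}"])
      (use assms e_eq in auto)
qed

lemma r_deriv:
  "((\<lambda>t. exp (- a * t) *\<^sub>R r0) has_vector_derivative (- a * exp (- a * t)) *\<^sub>R r0) (at t)"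
proof -
  have "((\<lambda>t. exp (- a * t)) has_vector_derivative - a * exp (- a * t)) (at t)"
    unfolding has_real_derivative_iff_has_vector_derivative[symmetric]
    by (auto intro!: derivative_eq_intros)
  then show ?thesis
    by (rule bounded_linear.has_vector_derivative[OF bounded_linear_scaleR_left])
qed

text \<open>The adaptive law is such that the indefinite terms
  \<open>P q \<bullet> E \<sigma>\<close> of the two quadratic forms cancel. The decaying forcing
  \<open>r0\<close> is paid for by an exponential summand in \<open>V\<close> and by half of the
  damping.\<close>

lemma dissipation:
  obtains V V' p C where "p > 0"
    "\<And>t. t > 0 \<Longrightarrow> (V has_real_derivative V' t) (at t)"
    "\<And>t. t > 0 \<Longrightarrow> V' t \<le> - p * (q t \<bullet> q t)" "\<And>t. t > 0 \<Longrightarrow> 0 \<le> V t"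
    "\<And>t. t > 1 \<Longrightarrow> norm (q t) \<le> C" "\<And>t. t > 1 \<Longrightarrow> norm (\<sigma> t) \<le> C"
proof -
  obtain p where p: "p > 0" "\<And>y. p * (norm y)\<^sup>2 \<le> y \<bullet> P y"
    by (rule positive_blinfun_coercive[OF P_pos]) (assumption, (rule that; assumption))
  obtain Q :: "'b \<Rightarrow>\<^sub>L 'b" where Q: "\<And>s. Q (G s) = s" "\<And>s. G (Q s) = s"
    by (rule positive_blinfun_inverse[OF G_pos]) (assumption, (rule that; assumption))
  have Q_sym: "s \<bullet> Q s' = Q s \<bullet> s'" for s s'
    by (rule symmetric_blinfun_inverse[OF G_sym Q(2)])
  have Q_pos: "0 < s \<bullet> Q s" if "s \<noteq> 0" for s
  proof -
    have "Q s \<noteq> 0" using that Q(2)[of s] by (metis blinfun.zero_right)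
    then show ?thesis using G_pos[of "Q s"] Q(2)[of s] by (simp add: inner_commute)
  qed
  obtain g where g: "g > 0" "\<And>s. g * (norm s)\<^sup>2 \<le> s \<bullet> Q s"
    by (rule positive_blinfun_coercive[OF Q_pos]) (assumption, (rule that; assumption))
  define r where "r t = exp (- a * t) *\<^sub>R r0" for t
  \<comment> \<open>The constant left over when \<open>2 * (q \<bullet> P r)\<close> is split by
    completing the square against \<open>a p |q|^2\<close>.\<close>
  define K where "K = (norm P)\<^sup>2 * (norm r0)\<^sup>2 / (a * p)"
  have K: "K \<ge> 0" using p a_pos by (simp add: K_def)
  define V where "V t = q t \<bullet> P (q t) + \<sigma> t \<bullet> Q (\<sigma> t) + K / (2 * a) * exp (- 2 * a * t)" for t
  define V' where "V' t = - 2 * a * (q t \<bullet> P (q t)) + 2 * (q t \<bullet> P (r t)) - K * exp (- 2 * a * t)" for t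
  have V: "(V has_real_derivative V' t) (at t)" if t: "t > 0" for t
  proof -
    let ?q' = "- (a *\<^sub>R q t) - em (e t) (\<sigma> t) + r t" and ?\<sigma>' = "G (ad (e t) (P (q t)))"
    have 1: "((\<lambda>t. q t \<bullet> P (q t)) has_vector_derivative q t \<bullet> P ?q' + ?q' \<bullet> P (q t)) (at t)"
      unfolding r_def
      by (intro bounded_bilinear.has_vector_derivative[OF bounded_bilinear_inner] q_deriv[OF t]
          bounded_linear.has_vector_derivative[OF blinfun.bounded_linear_right])
    have 2: "((\<lambda>t. \<sigma> t \<bullet> Q (\<sigma> t)) has_vector_derivative \<sigma> t \<bullet> Q ?\<sigma>' + ?\<sigma>' \<bullet> Q (\<sigma> t)) (at t)"
      by (intro bounded_bilinear.has_vector_derivative[OF bounded_bilinear_inner] \<sigma>_deriv[OF t]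
          bounded_linear.has_vector_derivative[OF blinfun.bounded_linear_right])
    have 3: "((\<lambda>t. K / (2 * a) * exp (- 2 * a * t)) has_vector_derivative - K * exp (- 2 * a * t)) (at t)"
      unfolding has_real_derivative_iff_has_vector_derivative[symmetric]
      using a_pos by (auto intro!: derivative_eq_intros)
    have "(q t \<bullet> P ?q' + ?q' \<bullet> P (q t)) + (\<sigma> t \<bullet> Q ?\<sigma>' + ?\<sigma>' \<bullet> Q (\<sigma> t)) + - K * exp (- 2 * a * t) = V' t"
    proof -
      have "?q' \<bullet> P (q t) = q t \<bullet> P ?q'" using P_sym[of ?q' "q t"] by (simp only: inner_commute)
      moreover have "q t \<bullet> P ?q' = - a * (q t \<bullet> P (q t)) - P (q t) \<bullet> em (e t) (\<sigma> t) + q t \<bullet> P (r t)"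
        using P_sym[of "q t" "em (e t) (\<sigma> t)"] by (simp add: blinfun.bilinear_simps inner_simps)
      moreover have "P (q t) \<bullet> em (e t) (\<sigma> t) = \<sigma> t \<bullet> ad (e t) (P (q t))"
        by (simp add: adj inner_commute)
      moreover have "\<sigma> t \<bullet> Q ?\<sigma>' = \<sigma> t \<bullet> ad (e t) (P (q t))" by (simp add: Q)
      moreover have "?\<sigma>' \<bullet> Q (\<sigma> t) = \<sigma> t \<bullet> ad (e t) (P (q t))"
        using Q_sym[of ?\<sigma>' "\<sigma> t"] by (simp add: Q inner_commute)
      ultimately show ?thesis by (simp add: V'_def)
    qed
    with has_vector_derivative_add[OF has_vector_derivative_add[OF 1 2] 3] show ?thesis
      unfolding has_real_derivative_iff_has_vector_derivative V_def by simp
  qed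
  have V'_le: "V' t \<le> - (a * p) * (q t \<bullet> q t)" for t
  proof -
    have "q t \<bullet> P (r t) \<le> norm (q t) * (norm P * norm (r t))"
      by (intro inner_le_mult norm_blinfun_le order_refl)
    moreover have "2 * (norm (q t) * (norm P * norm (r t))) \<le> a * p * (norm (q t))\<^sup>2 + K * exp (- 2 * a * t)"
    proof -
      have "0 \<le> (a * p * norm (q t) - norm P * norm (r t))\<^sup>2 / (a * p)"
        using a_pos p by simp
      also have "\<dots> = a * p * (norm (q t))\<^sup>2 - 2 * (norm (q t) * (norm P * norm (r t)))
          + (norm P)\<^sup>2 * (norm (r t))\<^sup>2 / (a * p)"
        using a_pos p by (simp add: power2_eq_square field_simps)
      also have "(norm P)\<^sup>2 * (norm (r t))\<^sup>2 / (a * p) = K * exp (- 2 * a * t)"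
        by (simp add: K_def r_def power_mult_distrib exp_of_nat_mult[symmetric])
      finally show ?thesis by simp
    qed
    moreover have "a * (p * (norm (q t))\<^sup>2) \<le> a * (q t \<bullet> P (q t))"
      using p a_pos by (intro mult_left_mono) auto
    ultimately show ?thesis
      unfolding V'_def power2_norm_eq_inner by simp
  qed
  have V0: "0 \<le> V t" for t
    using K a_pos p(2)[of "q t"] g(2)[of "\<sigma> t"] p(1) g(1) unfolding V_def
    by (intro add_nonneg_nonneg) (auto intro: order_trans[rotated])
  \<comment> \<open>The error equations are available at positive times only, so the comparison
    starts at time 1.\<close>
  have V1: "V t \<le> V 1" if "t > 1" for t
  proof (rule DERIV_nonpos_imp_nonincreasing[of 1 t])
    fix \<tau> assume "1 \<le> \<tau>" "\<tau> \<le> t"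
    moreover have "V' \<tau> \<le> 0"
      using V'_le[of \<tau>] a_pos p(1) by (smt (verit) inner_ge_zero mult_minus_left mult_nonneg_nonneg)
    ultimately show "\<exists>y. (V has_real_derivative y) (at \<tau>) \<and> y \<le> 0" using V[of \<tau>] by auto
  qed (use that in simp)
  have bound: "norm y \<le> V 1 / k + 1" if "k > 0" "k * (norm y)\<^sup>2 \<le> V 1" for k and y :: "'z::real_normed_vector"
  proof -
    have "(norm y)\<^sup>2 \<le> V 1 / k" using that by (simp add: field_simps)
    moreover have "norm y \<le> (norm y)\<^sup>2 + 1"
      using sum_squares_bound[of "norm y" 1] norm_ge_zero[of y] unfolding one_power2 mult_1_right
      by linarith
    ultimately show ?thesis by simp
  qed
  have K2: "0 \<le> K / (2 * a) * exp (- 2 * a * t)" for t using K a_pos by simp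
  have qP: "0 \<le> q t \<bullet> P (q t)" "0 \<le> \<sigma> t \<bullet> Q (\<sigma> t)" for t
    using p(2)[of "q t"] g(2)[of "\<sigma> t"] p(1) g(1)
    by (auto intro: order_trans[rotated])
  have "norm (q t) \<le> V 1 / p + 1" if "t > 1" for t
    using bound[OF p(1), of "q t"] p(2)[of "q t"] V1[OF that] K2[of t] qP[of t] unfolding V_def[of t] by simp
  moreover have "norm (\<sigma> t) \<le> V 1 / g + 1" if "t > 1" for t
    using bound[OF g(1), of "\<sigma> t"] g(2)[of "\<sigma> t"] V1[OF that] K2[of t] qP[of t] unfolding V_def[of t] by simp
  ultimately show ?thesis
    using that[of "a * p" V V' "max (V 1 / p + 1) (V 1 / g + 1)"] V V'_le V0 a_pos p(1)
    by (simp add: le_max_iff_disj)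
qed

lemma regressor_tendsto_0_bounded:
  assumes "\<And>t. t \<ge> 0 \<Longrightarrow> norm (x t) \<le> X"
  shows "((\<lambda>t. em (e t) (\<sigma> t)) \<longlongrightarrow> 0) at_top"
proof -
  obtain V V' p C where V: "p > 0"
    "\<And>t. t > 0 \<Longrightarrow> (V has_real_derivative V' t) (at t)"
    "\<And>t. t > 0 \<Longrightarrow> V' t \<le> - p * (q t \<bullet> q t)" "\<And>t. t > 0 \<Longrightarrow> 0 \<le> V t"
    and q: "\<And>t. t > 1 \<Longrightarrow> norm (q t) \<le> C" and \<sigma>: "\<And>t. t > 1 \<Longrightarrow> norm (\<sigma> t) \<le> C"
    by (rule dissipation) (rule that; assumption)
  define q' where "q' t = - (a *\<^sub>R q t) - em (e t) (\<sigma> t) + exp (- a * t) *\<^sub>R r0" for t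
  define \<sigma>' where "\<sigma>' t = G (ad (e t) (P (q t)))" for t
  \<comment> \<open>A bound on this derivative needs \<open>e\<close> and \<open>e'\<close> bounded,
    and that is where boundedness of \<open>x\<close> enters. It is used twice: for
    \<open>q'\<close> in Barbalat's lemma and for \<open>q''\<close> in passing from
    \<open>q \<longlongrightarrow> 0\<close> to \<open>q' \<longlongrightarrow> 0\<close>.\<close>
  define q'' where "q'' t = - (a *\<^sub>R q' t) - (em (e t) (\<sigma>' t) + em (e' t) (\<sigma> t)) +
    (- a * exp (- a * t)) *\<^sub>R r0" for t
  have exp_le: "norm (exp (- a * t) *\<^sub>R w) \<le> norm w" if "t > 1" for t and w :: "'z::real_normed_vector"
    using a_pos that mult_right_mono[of "exp (- a * t)" 1 "norm w"] by simp
  have e: "norm (e t) \<le> norm M * X + norm c" if "t > 1" for t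
    using that norm_triangle_ineq[of "M (x t)" "exp (- a * t) *\<^sub>R c"] exp_le[OF that, of c]
      norm_blinfun_le[OF order_refl assms[of t], of M] e_eq[of t] by simp
  have "norm ((a * exp (- a * t)) *\<^sub>R c) \<le> a * norm c" if "t > 1" for t
    using exp_le[OF that, of "a *\<^sub>R c"] a_pos by (simp add: mult.commute)
  then have e': "norm (e' t) \<le> norm M * (norm S * X) + a * norm c" if "t > 1" for t
    using that norm_triangle_ineq4[of "M (S (x t))" "(a * exp (- a * t)) *\<^sub>R c"]
      norm_blinfun_le[OF order_refl norm_blinfun_le[OF order_refl assms[of t]], of M S]
    unfolding e'_def by (meson add_mono less_trans zero_less_one less_imp_le order_trans)
  obtain C1 where C1: "\<And>t. t > 1 \<Longrightarrow> norm (q' t) \<le> C1"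
  proof -
    have "norm (q' t) \<le> a * C + (norm em * (norm M * X + norm c)) * C + norm r0" if "t > 1" for t
    proof -
      have "norm (q' t) \<le> norm (a *\<^sub>R q t) + norm (em (e t) (\<sigma> t)) + norm (exp (- a * t) *\<^sub>R r0)"
        unfolding q'_def by (rule norm_minus_diff_add_le)
      also have "\<dots> \<le> a * C + (norm em * (norm M * X + norm c)) * C + norm r0"
        using a_pos q[OF that] by (intro add_mono norm_blinfun_le order_refl e \<sigma> exp_le that) simp
      finally show ?thesis .
    qed
    then show ?thesis using that by blast
  qed
  obtain C2 where C2: "\<And>t. t > 1 \<Longrightarrow> norm (q'' t) \<le> C2"
  proof -
    let ?E = "norm M * X + norm c" and ?E' = "norm M * (norm S * X) + a * norm c"
    have "norm (q'' t) \<le> a * C1 + ((norm em * ?E) * (norm G * ((norm ad * ?E) * (norm P * C)))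
        + (norm em * ?E') * C) + a * norm r0" if "t > 1" for t
    proof -
      have r: "norm ((- a * exp (- a * t)) *\<^sub>R r0) \<le> a * norm r0"
        using exp_le[OF that, of "a *\<^sub>R r0"] a_pos by (simp add: mult.commute)
      have "norm (q'' t) \<le> norm (a *\<^sub>R q' t) + (norm (em (e t) (\<sigma>' t)) + norm (em (e' t) (\<sigma> t)))
          + norm ((- a * exp (- a * t)) *\<^sub>R r0)"
        unfolding q''_def
        using norm_minus_diff_add_le[of "a *\<^sub>R q' t" "em (e t) (\<sigma>' t) + em (e' t) (\<sigma> t)"
            "(- a * exp (- a * t)) *\<^sub>R r0"]
          norm_triangle_ineq[of "em (e t) (\<sigma>' t)" "em (e' t) (\<sigma> t)"] by linarith
      also have "\<dots> \<le> a * C1 + ((norm em * ?E) * (norm G * ((norm ad * ?E) * (norm P * C)))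
        + (norm em * ?E') * C) + a * norm r0"
        unfolding \<sigma>'_def
        using a_pos C1[OF that] by (intro add_mono norm_blinfun_le order_refl e e' \<sigma> q r that) simp
      finally show ?thesis .
    qed
    then show ?thesis using that by blast
  qed
  have q_d: "(q has_vector_derivative q' t) (at t)" if "t > 1" for t
    using q_deriv[of t] that by (simp add: q'_def)
  have q'_d: "(q' has_vector_derivative q'' t) (at t)" if "t > 1" for t
    unfolding q'_def[abs_def] q''_def \<sigma>'_def
    by (intro has_vector_derivative_add has_vector_derivative_diff has_vector_derivative_minus r_deriv
        bounded_linear.has_vector_derivative[OF bounded_linear_scaleR_right] q_d[OF that, unfolded q'_def]
        bounded_bilinear.has_vector_derivative[OF bounded_bilinear_blinfun_apply]
        bounded_linear.has_vector_derivative[OF blinfun.bounded_linear_right] e_deriv \<sigma>_deriv)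
      (use that in auto)
  have "((\<lambda>t. p * (q t \<bullet> q t)) \<longlongrightarrow> 0) at_top"
  proof (rule dissipation_tendsto_0[of 1 V V' _ "\<lambda>t. p * (2 * (q t \<bullet> q' t))" "p * (2 * (C * C1))"])
    fix t :: real assume t: "t > 1"
    show "((\<lambda>t. p * (q t \<bullet> q t)) has_real_derivative p * (2 * (q t \<bullet> q' t))) (at t)"
      unfolding has_real_derivative_iff_has_vector_derivative
      using bounded_bilinear.has_vector_derivative[OF bounded_bilinear_inner q_d[OF t] q_d[OF t]]
      by (intro has_vector_derivative_mult_right) (simp add: inner_commute)
    have "\<bar>q t \<bullet> q' t\<bar> \<le> C * C1"
      using inner_le_mult[OF q[OF t] C1[OF t]] inner_le_mult[of "- q t" C "q' t" C1] q[OF t] C1[OF t]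
      by simp
    then show "\<bar>p * (2 * (q t \<bullet> q' t))\<bar> \<le> p * (2 * (C * C1))"
      using V(1) by (simp add: abs_mult)
  qed (use V in auto)
  then have "((\<lambda>t. inverse p * (p * (q t \<bullet> q t))) \<longlongrightarrow> 0) at_top"
    by (rule tendsto_mult_right_zero)
  then have "((\<lambda>t. sqrt (q t \<bullet> q t)) \<longlongrightarrow> sqrt 0) at_top"
    using V(1) by (intro tendsto_real_sqrt) (simp add: mult.assoc[symmetric])
  then have q_lim: "(q \<longlongrightarrow> 0) at_top"
    by (simp add: norm_eq_sqrt_inner[symmetric] tendsto_norm_zero_iff)
  have q'_lim: "(q' \<longlongrightarrow> 0) at_top"
    by (rule derivative_tendsto_0[OF q_d q'_d C2 q_lim])
  have "((\<lambda>t. exp (- a * t)) \<longlongrightarrow> 0) at_top" using a_pos by real_asymp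
  then have r_lim: "((\<lambda>t. exp (- a * t) *\<^sub>R r0) \<longlongrightarrow> 0 *\<^sub>R r0) at_top" by (intro tendsto_intros)
  have "((\<lambda>t. - q' t - a *\<^sub>R q t + exp (- a * t) *\<^sub>R r0) \<longlongrightarrow> - 0 - a *\<^sub>R 0 + 0 *\<^sub>R r0) at_top"
    by (intro tendsto_add tendsto_diff tendsto_minus tendsto_scaleR tendsto_const q'_lim q_lim r_lim)
  then show ?thesis by (simp add: q'_def)
qed

end

context scale begin

lemma tame_exp:
  assumes "0 \<le> t0" "0 \<le> a"
  shows "tame t0 m 0 k (\<lambda>t. exp (- a * t) *\<^sub>R w)"
proof (induction k arbitrary: w)
  case 0
  have "norm (exp (- a * t) *\<^sub>R w) \<le> norm w * m t powi 0" if "t > t0" for t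
    using assms that mult_right_mono[of "exp (- a * t)" 1 "norm w"] by simp
  then show ?case by auto
next
  case (Suc k)
  have "((\<lambda>t. exp (- a * t) *\<^sub>R w) has_vector_derivative exp (- a * t) *\<^sub>R (- a *\<^sub>R w)) (at t)" for t
  proof -
    have "((\<lambda>t. exp (- a * t)) has_vector_derivative - a * exp (- a * t)) (at t)"
      unfolding has_real_derivative_iff_has_vector_derivative[symmetric]
      by (auto intro!: derivative_eq_intros)
    from bounded_linear.has_vector_derivative[OF bounded_linear_scaleR_left this, of w]
    show ?thesis by (simp add: mult.commute)
  qed
  then show ?case
    by (intro tame_SucI[OF tame_le[OF Suc.IH] _ Suc.IH]) simp
qed

lemma tame_compose_eq:
  "tame t0 m i k X \<Longrightarrow> tame t0 m j k Y \<Longrightarrow> l = i + j \<Longrightarrow> tame t0 m l k (\<lambda>t. X t o\<^sub>L Y t)"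
  using tame_compose by blast

lemma tame_minus_one_bound:
  assumes "tame t0 m (- 1) k X"
  obtains C where "C \<ge> 0" "\<And>t. t > t0 \<Longrightarrow> norm (X t) \<le> C * (1 / m t)"
proof -
  obtain C where "C \<ge> 0" "\<And>t. t > t0 \<Longrightarrow> norm (X t) \<le> C * m t powi - 1"
    by (rule tame_bound[OF assms]) (rule that; assumption)
  then show ?thesis
    by (intro that[of C]) (auto simp: power_int_minus divide_inverse)
qed

lemma tame_minus_two_bound:
  assumes "tame t0 m (- 2) k X"
  obtains C where "C \<ge> 0" "\<And>t. t > t0 \<Longrightarrow> norm (X t) \<le> C * (1 / m t)\<^sup>2"
proof -
  obtain C where "C \<ge> 0" "\<And>t. t > t0 \<Longrightarrow> norm (X t) \<le> C * m t powi - 2"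
    by (rule tame_bound[OF assms]) (rule that; assumption)
  then show ?thesis
    by (intro that[of C]) (auto simp: power_int_minus divide_inverse power_inverse)
qed

lemma tame_zero_bound:
  assumes "tame t0 m 0 k X"
  obtains C where "C \<ge> 0" "\<And>t. t > t0 \<Longrightarrow> norm (X t) \<le> C"
proof -
  obtain C where "C \<ge> 0" "\<And>t. t > t0 \<Longrightarrow> norm (X t) \<le> C * m t powi 0"
    by (rule tame_bound[OF assms]) (rule that; assumption)
  then show ?thesis
    by (intro that[of C]) auto
qed

end

context adaptive begin

text \<open>Orders in \<open>m\<close>: \<open>e\<close> and \<open>e'\<close> have order 1,
  \<open>L\<close> and \<open>J\<close> order 2, \<open>\<Lambda>\<close> and \<open>H\<close> order
  -2, \<open>R\<close>, \<open>T\<close> and \<open>Y\<close> order -1, \<open>N\<close> and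
  \<open>X\<close> order 0. The natural size of \<open>v\<close> is therefore \<open>m\<close> times
  that of \<open>b\<close>, and the energy has to decay faster than \<open>m^(-2)\<close> to give a
  limit for \<open>v\<close>.\<close>

lemma regressor_tendsto_0_unbounded:
  assumes lim: "filterlim (\<lambda>t. norm (x t)) at_top at_top"
  shows "((\<lambda>t. em (e t) (\<sigma> t)) \<longlongrightarrow> 0) at_top"
proof -
  define m where "m t = norm (x t)" for t
  define r where "r t = exp (- a * t) *\<^sub>R r0" for t
  obtain C\<sigma> where \<sigma>_bound: "\<And>t. t > 1 \<Longrightarrow> norm (\<sigma> t) \<le> C\<sigma>"
    by (rule dissipation) (rule that; assumption)
  have C\<sigma>: "0 \<le> C\<sigma>" using \<sigma>_bound[of 2] norm_ge_zero[of "\<sigma> 2"] by (meson one_less_numeral_iff order_trans semiring_norm(76))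
  \<comment> \<open>Once \<open>m\<close> is at least \<open>2 * B1\<close>, the additive 1 in
    \<open>e_lower\<close> accounts for at most half of \<open>m\<close>, leaving a purely
    multiplicative lower bound for \<open>|e|\<close>.\<close>
  define B1 where "B1 = \<bar>B\<bar> + 1"
  have B1: "B1 \<ge> 1" by (simp add: B1_def)
  have ev: "\<forall>\<^sub>F t in at_top. 2 * B1 \<le> m t"
    using lim by (simp add: m_def filterlim_at_top)
  then obtain t0 where t0: "t0 \<ge> 1" "\<And>t. t > t0 \<Longrightarrow> 2 * B1 \<le> m t"
    unfolding eventually_at_top_linorder by (metis le_max_iff_disj less_imp_le max.cobounded1 order.trans)
  have m1: "1 \<le> m t" if "t > t0" for t using t0(2)[OF that] B1 by simp
  have m0: "0 < m t" if "t > t0" for t using m1[OF that] by simp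
  interpret scale t0 m by unfold_locales (rule m1)
  have e_low: "m t / (2 * B1) \<le> norm (e t)" if "t > t0" for t
  proof -
    have "m t \<le> B1 * (norm (e t) + 1)"
    proof -
      have "B * (norm (e t) + 1) \<le> B1 * (norm (e t) + 1)"
        by (rule mult_right_mono) (auto simp: B1_def)
      then show ?thesis using e_lower[of t] that t0(1) by (simp add: m_def)
    qed
    then have "m t / 2 \<le> B1 * norm (e t)"
      using t0(2)[OF that] by (simp add: algebra_simps)
    then show ?thesis using B1 by (simp add: field_simps)
  qed
  \<comment> \<open>The operator \<open>A\<close> is arbitrary in the induction because the
    derivative of \<open>A x\<close> is \<open>(A S) x\<close>.\<close>
  have tame_x: "tame t0 m 1 k (\<lambda>t. A (x t))" for k and A :: "'e \<Rightarrow>\<^sub>L 'e"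
  proof (induction k arbitrary: A)
    case 0
    have "norm (A (x t)) \<le> norm A * m t powi 1" for t
      using norm_blinfun[of A "x t"] by (simp add: m_def)
    then show ?case by auto
  next
    case (Suc k)
    have "((\<lambda>t. A (x t)) has_vector_derivative (A o\<^sub>L S) (x t)) (at t)" if "t > t0" for t
      using bounded_linear.has_vector_derivative[OF blinfun.bounded_linear_right x_deriv[of t], of A]
        that t0(1) by simp
    then show ?case by (intro tame_SucI[OF tame_le[OF Suc.IH] _ Suc.IH[of "A o\<^sub>L S"]]) auto
  qed
  have tame_e: "tame t0 m 1 k e" for k
  proof (rule tame_cong)
    show "M (x t) + exp (- a * t) *\<^sub>R c = e t" if "t > t0" for t
      using e_eq[of t] that t0(1) by simp
    show "tame t0 m 1 k (\<lambda>t. M (x t) + exp (- a * t) *\<^sub>R c)"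
      using t0(1) a_pos by (intro tame_add tame_x tame_mono[OF tame_exp]) auto
  qed
  have e_d: "(e has_vector_derivative e' t) (at t)" if "t > t0" for t
    using e_deriv that t0(1) by simp
  have tame_e': "tame t0 m 1 k e'" for k
    by (rule tame_derivative[OF tame_e e_d])
  have tame_em: "tame t0 m 1 k (\<lambda>t. em (w t))" if "tame t0 m 1 k w" for k w
    by (rule tame_linear[OF blinfun.bounded_linear_right that])
  have tame_ad: "tame t0 m 1 k (\<lambda>t. ad (w t))" if "tame t0 m 1 k w" for k w
    by (rule tame_linear[OF blinfun.bounded_linear_right that])

  \<comment> \<open>The gain of the fast oscillator and its inverse\<close>
  define L where "L t = (em (e t) o\<^sub>L G) o\<^sub>L ad (e t)" for t
  \<comment> \<open>The derivative of \<open>L\<close> is split into adjoint halves, since the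
    coefficient \<open>N\<close> below involves only one of them:
    \<open>P N = \<Lambda> J P\<close>.\<close>
  define J where "J t = (em (e' t) o\<^sub>L G) o\<^sub>L ad (e t)" for t
  define J' where "J' t = (em (e t) o\<^sub>L G) o\<^sub>L ad (e' t)" for t
  have tame_L: "tame t0 m 2 k L" for k
    unfolding L_def[abs_def]
    by (rule tame_compose_eq[OF tame_compose_eq[OF tame_em[OF tame_e] tame_const refl] tame_ad[OF tame_e]]) simp
  have tame_J: "tame t0 m 2 k J" for k
    unfolding J_def[abs_def]
    by (rule tame_compose_eq[OF tame_compose_eq[OF tame_em[OF tame_e'] tame_const refl] tame_ad[OF tame_e]]) simp
  have L_d: "(L has_vector_derivative J' t + J t) (at t)" if "t > t0" for t
  proof -
    have E: "((\<lambda>t. em (e t)) has_vector_derivative em (e' t)) (at t)"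
      by (rule bounded_linear.has_vector_derivative[OF blinfun.bounded_linear_right e_d[OF that]])
    have Et: "((\<lambda>t. ad (e t)) has_vector_derivative ad (e' t)) (at t)"
      by (rule bounded_linear.has_vector_derivative[OF blinfun.bounded_linear_right e_d[OF that]])
    show ?thesis
      unfolding L_def[abs_def] J_def J'_def
      by (intro bounded_bilinear.has_vector_derivative[OF bounded_bilinear_blinfun_compose] Et
          bounded_linear.has_vector_derivative[OF bounded_bilinear.bounded_linear_left[OF
              bounded_bilinear_blinfun_compose]] E)
  qed
  have L_sym: "y \<bullet> L t z = L t y \<bullet> z" for t y z
    by (simp add: L_def adj G_sym) (metis adj inner_commute)
  have J_adj: "y \<bullet> J' t z = J t y \<bullet> z" for t y z
    by (simp add: J_def J'_def adj G_sym) (metis adj inner_commute)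

  obtain g where g: "g > 0" "\<And>s. g * (norm s)\<^sup>2 \<le> s \<bullet> G s"
    by (rule positive_blinfun_coercive[OF G_pos]) (assumption, (rule that; assumption))
  \<comment> \<open>Coercivity of \<open>G\<close> combined with \<open>|ad e y| = |e| |y|\<close>
    and the lower bound for \<open>|e|\<close>; this is the place where definiteness needs no
    excitation.\<close>
  define g1 where "g1 = g / (2 * B1)\<^sup>2"
  have g1: "g1 > 0" using g(1) B1 by (simp add: g1_def)
  have L_low: "g1 * (m t)\<^sup>2 * (norm y)\<^sup>2 \<le> y \<bullet> L t y" if "t > t0" for t y
  proof -
    have "g1 * (m t)\<^sup>2 * (norm y)\<^sup>2 = g * ((m t / (2 * B1))\<^sup>2 * (norm y)\<^sup>2)"
      by (simp add: g1_def power_divide)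
    also have "\<dots> \<le> g * ((norm (e t))\<^sup>2 * (norm y)\<^sup>2)"
      using g(1) e_low[OF that] m0[OF that] B1
      by (intro mult_left_mono mult_right_mono power_mono) auto
    also have "\<dots> = g * (norm (ad (e t) y))\<^sup>2"
      by (simp add: ad_norm power_mult_distrib)
    also have "\<dots> \<le> y \<bullet> L t y"
      using g(2)[of "ad (e t) y"] by (simp add: L_def adj)
    finally show ?thesis .
  qed
  have L_pos: "0 < y \<bullet> L t y" if "t > t0" "y \<noteq> 0" for t y
  proof -
    have "0 < g1 * (m t)\<^sup>2 * (norm y)\<^sup>2" using g1 m0[OF that(1)] that(2) by simp
    then show ?thesis using L_low[OF that(1), of y] by linarith
  qed
  have "\<exists>\<Lambda>. t > t0 \<longrightarrow> (\<forall>y. blinfun_apply \<Lambda> (L t y) = y) \<and> (\<forall>y. L t (\<Lambda> y) = y)" for t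
  proof (cases "t > t0")
    case True
    show ?thesis
      by (rule positive_blinfun_inverse[OF L_pos[OF True]]) (assumption, blast)
  qed simp
  then obtain \<Lambda> :: "real \<Rightarrow> 'a \<Rightarrow>\<^sub>L 'a" where \<Lambda>L: "\<And>t y. t > t0 \<Longrightarrow> \<Lambda> t (L t y) = y" and L\<Lambda>: "\<And>t y. t > t0 \<Longrightarrow> L t (\<Lambda> t y) = y"
    by metis
  have \<Lambda>_sym: "y \<bullet> \<Lambda> t z = \<Lambda> t y \<bullet> z" if "t > t0" for t y z
    by (rule symmetric_blinfun_inverse[OF L_sym L\<Lambda>[OF that]])
  have tame_\<Lambda>: "tame t0 m (- 2) k \<Lambda>" for k
  proof (rule tame_inverse[OF tame_L])
    show "\<Lambda> t o\<^sub>L L t = id_blinfun" "L t o\<^sub>L \<Lambda> t = id_blinfun" if "t > t0" for t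
      by (auto intro!: blinfun_eqI simp: \<Lambda>L[OF that] L\<Lambda>[OF that])
    have "norm (\<Lambda> t) \<le> 1 / g1 * m t powi - 2" if t: "t > t0" for t
    proof (rule norm_blinfun_bound)
      fix y
      have "g1 * (m t)\<^sup>2 * (norm (\<Lambda> t y))\<^sup>2 \<le> \<Lambda> t y \<bullet> y"
        using L_low[OF t, of "\<Lambda> t y"] by (simp add: L\<Lambda>[OF t])
      also have "\<dots> \<le> norm (\<Lambda> t y) * norm y" by (rule norm_cauchy_schwarz)
      finally have "norm (\<Lambda> t y) * (g1 * (m t)\<^sup>2 * norm (\<Lambda> t y)) \<le> norm (\<Lambda> t y) * norm y"
        by (simp add: power2_eq_square mult_ac)
      then have "g1 * (m t)\<^sup>2 * norm (\<Lambda> t y) \<le> norm y"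
        by (cases "\<Lambda> t y = 0") auto
      then show "norm (\<Lambda> t y) \<le> 1 / g1 * m t powi - 2 * norm y"
        using g1 m0[OF t] by (simp add: power_int_minus field_simps)
    qed (use g1 m0[OF t] in simp)
    then show "tame t0 m (- 2) 0 \<Lambda>" unfolding tame.simps by blast
  qed
  define \<Lambda>' where "\<Lambda>' t = - (\<Lambda> t o\<^sub>L (J' t + J t) o\<^sub>L \<Lambda> t)" for t
  have \<Lambda>_d: "(\<Lambda> has_vector_derivative \<Lambda>' t) (at t)" if "t > t0" for t
    unfolding \<Lambda>'_def
    by (rule has_vector_derivative_blinfun_inverse[OF L_d[OF that], of "{t0<..}"])
      (use that in \<open>auto intro!: blinfun_eqI simp: \<Lambda>L L\<Lambda>\<close>)
  obtain CL where CL: "CL \<ge> 0" "\<And>t. t > t0 \<Longrightarrow> norm (L t) \<le> CL * m t powi 2"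
    by (rule tame_bound[OF tame_L]) (rule that; assumption)
  have "\<exists>l>0. \<forall>t>t0. \<forall>y. l * (1 / m t * norm y)\<^sup>2 \<le> y \<bullet> \<Lambda> t y"
  \<comment> \<open>The witness combines
    \<open>y \<bullet> \<Lambda> y \<ge> g1 m^2 |\<Lambda> y|^2\<close> with
    \<open>|y| = |L (\<Lambda> y)| \<le> (CL + 1) m^2 |\<Lambda> y|\<close>.\<close>
  proof (intro exI[of _ "g1 / (CL + 1)\<^sup>2"] conjI allI impI)
    fix t y assume t: "t > t0"
    have "norm y = norm (L t (\<Lambda> t y))" by (simp add: L\<Lambda>[OF t])
    also have "\<dots> \<le> (CL * m t powi 2) * norm (\<Lambda> t y)"
      by (intro norm_blinfun_le CL t order_refl)
    also have "\<dots> \<le> ((CL + 1) * (m t)\<^sup>2) * norm (\<Lambda> t y)"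
      by (intro mult_right_mono) (auto simp: distrib_right)
    finally have "1 / m t * norm y \<le> (CL + 1) * (m t * norm (\<Lambda> t y))"
      using m0[OF t] by (simp add: field_simps power2_eq_square)
    then have "(1 / m t * norm y)\<^sup>2 \<le> ((CL + 1) * (m t * norm (\<Lambda> t y)))\<^sup>2"
      using m0[OF t] by (intro power_mono) auto
    then have "g1 / (CL + 1)\<^sup>2 * (1 / m t * norm y)\<^sup>2 \<le> g1 * ((m t)\<^sup>2 * (norm (\<Lambda> t y))\<^sup>2)"
      using g1 CL(1) mult_left_mono[of _ _ "g1 / (CL + 1)\<^sup>2"] by (fastforce simp: power_mult_distrib)
    also have "\<dots> \<le> y \<bullet> \<Lambda> t y"
      using L_low[OF t, of "\<Lambda> t y"] by (simp add: L\<Lambda>[OF t] inner_commute mult.assoc)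
    finally show "g1 / (CL + 1)\<^sup>2 * (1 / m t * norm y)\<^sup>2 \<le> y \<bullet> \<Lambda> t y" .
  qed (use g1 CL(1) in simp)
  then obtain l where l: "l > 0" "\<And>t y. t > t0 \<Longrightarrow> l * (1 / m t * norm y)\<^sup>2 \<le> y \<bullet> \<Lambda> t y"
    by blast
  obtain p where p: "p > 0" "\<And>y. p * (norm y)\<^sup>2 \<le> y \<bullet> P y"
    by (rule positive_blinfun_coercive[OF P_pos]) (assumption, (rule that; assumption))
  obtain Q :: "'a \<Rightarrow>\<^sub>L 'a" where Q: "\<And>y. Q (P y) = y" "\<And>y. P (Q y) = y"
    by (rule positive_blinfun_inverse[OF P_pos]) (assumption, (rule that; assumption))

  \<comment> \<open>The corrections that remove the slow forcing\<close>
  \<comment> \<open>Solves \<open>L P R = E'\<close>: the term \<open>E' \<sigma>\<close> of order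
    \<open>m\<close> in the derivative of \<open>E \<sigma>\<close> becomes part of
    \<open>L P b\<close>.\<close>
  define R where "R t = (Q o\<^sub>L \<Lambda> t) o\<^sub>L em (e' t)" for t
  have tame_R: "tame t0 m (- 1) k R" for k
    unfolding R_def[abs_def]
    by (rule tame_compose_eq[OF tame_compose_eq[OF tame_const tame_\<Lambda> refl] tame_em[OF tame_e']]) simp
  obtain R' where R_d: "\<And>t. t > t0 \<Longrightarrow> (R has_vector_derivative R' t) (at t)"
    by (rule tame_obtain_derivative[OF tame_R[of "Suc 0"]]) (rule that; assumption)
  have tame_R': "tame t0 m (- 1) k R'" for k
    by (rule tame_derivative[OF tame_R R_d])
  have tame_GP: "tame t0 m (j + 1) k (\<lambda>t. ((Z t o\<^sub>L G) o\<^sub>L ad (e t)) o\<^sub>L P)"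
    if "tame t0 m j k Z" for j k and Z :: "real \<Rightarrow> 'b \<Rightarrow>\<^sub>L 'a"
    by (rule tame_compose_eq[OF tame_compose_eq[OF tame_compose_eq[OF that tame_const refl]
          tame_ad[OF tame_e] refl] tame_const]) simp
  define N where "N t = ((R t o\<^sub>L G) o\<^sub>L ad (e t)) o\<^sub>L P" for t
  have tame_N: "tame t0 m 0 k N" for k
    using tame_GP[OF tame_R] by (simp add: N_def[abs_def])
  \<comment> \<open>The terms in \<open>\<sigma>\<close> that remain in \<open>b'\<close> after
    \<open>q = b - R \<sigma>\<close> is substituted; subtracting them from
    \<open>E \<sigma>\<close> leaves \<open>b'\<close> without any explicit
    \<open>\<sigma>\<close>.\<close>
  define T where "T t = a *\<^sub>R R t + R' t - (N t o\<^sub>L R t)" for t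
  have tame_T: "tame t0 m (- 1) k T" for k
    unfolding T_def[abs_def]
    by (intro tame_diff tame_add tame_scaleR tame_R tame_R' tame_compose_eq[OF tame_N tame_R]) simp
  obtain T' where T_d: "\<And>t. t > t0 \<Longrightarrow> (T has_vector_derivative T' t) (at t)"
    by (rule tame_obtain_derivative[OF tame_T[of "Suc 0"]]) (rule that; assumption)
  have tame_T': "tame t0 m (- 1) k T'" for k
    by (rule tame_derivative[OF tame_T T_d])
  define X where "X t = ((T t o\<^sub>L G) o\<^sub>L ad (e t)) o\<^sub>L P" for t
  have tame_X: "tame t0 m 0 k X" for k
    using tame_GP[OF tame_T] by (simp add: X_def[abs_def])
  \<comment> \<open>The forcing coefficient that remains in \<open>v'\<close>, again after
    substituting \<open>q = b - R \<sigma>\<close>; it has order -1.\<close>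
  define Y where "Y t = (X t o\<^sub>L R t) - T' t" for t
  have tame_Y: "tame t0 m (- 1) k Y" for k
    unfolding Y_def[abs_def]
    by (intro tame_diff tame_T' tame_compose_eq[OF tame_X tame_R]) simp
  define H where "H t = a *\<^sub>R \<Lambda> t - 2 *\<^sub>R ((\<Lambda> t o\<^sub>L J t) o\<^sub>L \<Lambda> t)" for t
  have tame_H: "tame t0 m (- 2) k H" for k
    unfolding H_def[abs_def]
    by (intro tame_diff tame_scaleR tame_\<Lambda>
        tame_compose_eq[OF tame_compose_eq[OF tame_\<Lambda> tame_J refl] tame_\<Lambda>]) simp
  obtain H' where H_d: "\<And>t. t > t0 \<Longrightarrow> (H has_vector_derivative H' t) (at t)"
    by (rule tame_obtain_derivative[OF tame_H[of "Suc 0"]]) (rule that; assumption)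
  have tame_H': "tame t0 m (- 2) k H'" for k
    by (rule tame_derivative[OF tame_H H_d])

  \<comment> \<open>The corrected variables and their energy\<close>
  define b where "b t = q t + R t (\<sigma> t)" for t
  define v where "v t = em (e t) (\<sigma> t) - T t (\<sigma> t)" for t
  define y where "y t = Y t (\<sigma> t)" for t
  define b' where "b' t = N t (b t) - a *\<^sub>R b t - v t + r t" for t
  define v' where "v' t = L t (P (b t)) - X t (b t) + y t" for t
  have b_d: "(b has_vector_derivative b' t) (at t)" if t: "t > t0" for t
  proof -
    have "t > 0" using t t0(1) by simp
    have "(b has_vector_derivative (- (a *\<^sub>R q t) - em (e t) (\<sigma> t) + r t)
        + (R t (G (ad (e t) (P (q t)))) + R' t (\<sigma> t))) (at t)"
      unfolding b_def[abs_def] r_def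
      by (intro has_vector_derivative_add q_deriv \<sigma>_deriv R_d t \<open>t > 0\<close>
          bounded_bilinear.has_vector_derivative[OF bounded_bilinear_blinfun_apply])
    moreover have "(- (a *\<^sub>R q t) - em (e t) (\<sigma> t) + r t)
        + (R t (G (ad (e t) (P (q t)))) + R' t (\<sigma> t)) = b' t"
      by (simp add: b'_def b_def v_def T_def N_def blinfun.bilinear_simps scaleR_add_right)
    ultimately show ?thesis by simp
  qed
  have v_d: "(v has_vector_derivative v' t) (at t)" if t: "t > t0" for t
  proof -
    have "t > 0" using t t0(1) by simp
    have E: "((\<lambda>t. em (e t)) has_vector_derivative em (e' t)) (at t)"
      by (rule bounded_linear.has_vector_derivative[OF blinfun.bounded_linear_right e_d[OF t]])
    have "(v has_vector_derivative
        (em (e t) (G (ad (e t) (P (q t)))) + em (e' t) (\<sigma> t))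
        - (T t (G (ad (e t) (P (q t)))) + T' t (\<sigma> t))) (at t)"
      unfolding v_def[abs_def]
      by (intro has_vector_derivative_diff \<sigma>_deriv T_d t \<open>t > 0\<close> E
          bounded_bilinear.has_vector_derivative[OF bounded_bilinear_blinfun_apply])
    moreover have "L t (P (R t (\<sigma> t))) = em (e' t) (\<sigma> t)"
      by (simp add: R_def Q L\<Lambda>[OF t])
    then have "(em (e t) (G (ad (e t) (P (q t)))) + em (e' t) (\<sigma> t))
        - (T t (G (ad (e t) (P (q t)))) + T' t (\<sigma> t)) = v' t"
      by (simp add: v'_def b_def y_def Y_def X_def L_def blinfun.bilinear_simps)
    ultimately show ?thesis by simp
  qed
  define W where "W t = b t \<bullet> P (b t) + v t \<bullet> \<Lambda> t (v t) + b t \<bullet> H t (v t)" for t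
  define W' where "W' t = (b t \<bullet> P (b' t) + b' t \<bullet> P (b t))
      + (v t \<bullet> (\<Lambda> t (v' t) + \<Lambda>' t (v t)) + v' t \<bullet> \<Lambda> t (v t))
      + (b t \<bullet> (H t (v' t) + H' t (v t)) + b' t \<bullet> H t (v t))" for t
  have W_d: "(W has_real_derivative W' t) (at t)" if t: "t > t0" for t
    unfolding has_real_derivative_iff_has_vector_derivative W_def[abs_def] W'_def
    by (intro has_vector_derivative_add b_d v_d \<Lambda>_d H_d t
        bounded_bilinear.has_vector_derivative[OF bounded_bilinear_inner]
        bounded_bilinear.has_vector_derivative[OF bounded_bilinear_blinfun_apply]
        bounded_linear.has_vector_derivative[OF blinfun.bounded_linear_right])

  \<comment> \<open>Quantitative bounds and the differential inequality\<close>
  obtain K\<Lambda> where K\<Lambda>: "K\<Lambda> \<ge> 0" "\<And>t. t > t0 \<Longrightarrow> norm (\<Lambda> t) \<le> K\<Lambda> * (1 / m t)\<^sup>2"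
    by (rule tame_minus_two_bound[OF tame_\<Lambda>]) (rule that; assumption)
  obtain KH where KH: "KH \<ge> 0" "\<And>t. t > t0 \<Longrightarrow> norm (H t) \<le> KH * (1 / m t)\<^sup>2"
    by (rule tame_minus_two_bound[OF tame_H]) (rule that; assumption)
  obtain KH' where KH': "KH' \<ge> 0" "\<And>t. t > t0 \<Longrightarrow> norm (H' t) \<le> KH' * (1 / m t)\<^sup>2"
    by (rule tame_minus_two_bound[OF tame_H']) (rule that; assumption)
  obtain KT where KT: "KT \<ge> 0" "\<And>t. t > t0 \<Longrightarrow> norm (T t) \<le> KT * (1 / m t)"
    by (rule tame_minus_one_bound[OF tame_T]) (rule that; assumption)
  obtain KY where KY: "KY \<ge> 0" "\<And>t. t > t0 \<Longrightarrow> norm (Y t) \<le> KY * (1 / m t)"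
    by (rule tame_minus_one_bound[OF tame_Y]) (rule that; assumption)
  obtain KN where KN: "KN \<ge> 0" "\<And>t. t > t0 \<Longrightarrow> norm (N t) \<le> KN"
    by (rule tame_zero_bound[OF tame_N]) (rule that; assumption)
  obtain KX where KX: "KX \<ge> 0" "\<And>t. t > t0 \<Longrightarrow> norm (X t) \<le> KX"
    by (rule tame_zero_bound[OF tame_X]) (rule that; assumption)
  \<comment> \<open>Since \<open>m\<close> grows at rate at most \<open>a / 2\<close>, its square
    grows at rate at most \<open>a\<close>, so \<open>exp (- a * t)\<close> is of order
    \<open>m^(-2)\<close>.\<close>
  obtain Kr where Kr: "Kr \<ge> 0" "\<And>t. t > t0 \<Longrightarrow> norm (r t) \<le> Kr * (1 / m t)\<^sup>2"
  proof -
    obtain C where C: "C \<ge> 0" "\<And>s t. 0 \<le> s \<Longrightarrow> s \<le> t \<Longrightarrow> m t \<le> C * exp (a / 2 * (t - s)) * m s"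
      using growth[of "a / 2"] a_pos by (auto simp: m_def)
    have "norm (r t) \<le> (C\<^sup>2 * (m 0)\<^sup>2 * norm r0) * (1 / m t)\<^sup>2" if t: "t > t0" for t
    proof -
      have "(m t)\<^sup>2 \<le> (C * exp (a / 2 * (t - 0)) * m 0)\<^sup>2"
        using C(2)[of 0 t] t t0(1) m0[OF t] by (intro power_mono) auto
      also have "\<dots> = C\<^sup>2 * (m 0)\<^sup>2 * exp (a * t)"
        by (simp add: power_mult_distrib exp_of_nat_mult[symmetric])
      finally have "exp (- a * t) \<le> C\<^sup>2 * (m 0)\<^sup>2 * (1 / m t)\<^sup>2"
        using m0[OF t] by (simp add: exp_minus field_simps)
      from mult_right_mono[OF this norm_ge_zero[of r0]] show ?thesis
        by (simp add: r_def mult_ac)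
    qed
    then show ?thesis using that[of "C\<^sup>2 * (m 0)\<^sup>2 * norm r0"] by simp
  qed
  define K where "K = K\<Lambda> + KH + KH' + KY * C\<sigma> + KN + KX + Kr + norm P"
  have K: "K \<ge> 0" "K\<Lambda> \<le> K" "KH \<le> K" "KH' \<le> K" "KY * C\<sigma> \<le> K" "KN \<le> K" "KX \<le> K" "Kr \<le> K" "norm P \<le> K"
    using K\<Lambda>(1) KH(1) KH'(1) KY(1) KN(1) KX(1) Kr(1) C\<sigma> mult_nonneg_nonneg[OF KY(1) C\<sigma>] norm_ge_zero[of P]
    unfolding K_def by linarith+
  define s where "s t = (norm (b t))\<^sup>2 + (1 / m t * norm (v t))\<^sup>2" for t
  define \<kappa> where "\<kappa> = min p l"
  have \<kappa>: "\<kappa> > 0" "\<kappa> \<le> p" "\<kappa> \<le> l" using p(1) l(1) by (auto simp: \<kappa>_def)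
  have coercive: "\<kappa> * s t \<le> b t \<bullet> P (b t) + v t \<bullet> \<Lambda> t (v t)" if t: "t > t0" for t
    using p(2)[of "b t"] l(2)[OF t, of "v t"] mult_right_mono[OF \<kappa>(2), of "(norm (b t))\<^sup>2"]
      mult_right_mono[OF \<kappa>(3), of "(1 / m t * norm (v t))\<^sup>2"]
    by (simp add: s_def distrib_left)
  define C1 where "C1 = 9 * K\<^sup>2 + a * K + K"
  have C1: "C1 \<ge> 0" using K(1) a_pos by (simp add: C1_def)
  have W'_le: "W' t \<le> - (a * \<kappa>) * s t + C1 * (1 / m t * s t + (1 / m t)\<^sup>2 * (norm (b t) + 1 / m t * norm (v t)))"
    if t: "t > t0" for t
  proof -
    have scale_le: "Z \<le> K * c" if "Z \<le> Z' * c" "Z' \<le> K" "0 \<le> c" for Z Z' c :: real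
      using that mult_right_mono[OF that(2,3)] by linarith
    have "t > 1" using t t0(1) by simp
    have y: "norm (y t) \<le> K * (1 / m t)"
    proof -
      have "norm (y t) \<le> (KY * (1 / m t)) * C\<sigma>"
        unfolding y_def by (intro norm_blinfun_le KY t \<sigma>_bound \<open>t > 1\<close>)
      then show ?thesis
        using m0[OF t] by (intro scale_le[OF _ K(5)]) (simp_all add: mult_ac)
    qed
    have "W' t = - a * (b t \<bullet> P (b t)) - a * (v t \<bullet> \<Lambda> t (v t))
      + (2 * (b t \<bullet> P (r t)) - 2 * (v t \<bullet> \<Lambda> t (X t (b t))) + 2 * (v t \<bullet> \<Lambda> t (y t))
        + (N t (b t) - a *\<^sub>R b t + r t) \<bullet> H t (v t)
        + b t \<bullet> H' t (v t) - b t \<bullet> H t (X t (b t)) + b t \<bullet> H t (y t))"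
      unfolding W'_def
    proof (rule fast_energy_derivative[where L = "L t" and J = "J t" and J' = "J' t"])
      show "\<Lambda>' t z = - \<Lambda> t (J t (\<Lambda> t z) + J' t (\<Lambda> t z))" for z
        by (simp add: \<Lambda>'_def blinfun.bilinear_simps)
      show "P (N t z) = \<Lambda> t (J t (P z))" for z
        by (simp add: N_def R_def J_def Q)
      show "H t z = a *\<^sub>R \<Lambda> t z - 2 *\<^sub>R \<Lambda> t (J t (\<Lambda> t z))" for z
        by (simp add: H_def blinfun.bilinear_simps)
    qed (rule P_sym \<Lambda>_sym[OF t] \<Lambda>L[OF t] J_adj b'_def v'_def)+
    also have "\<dots> \<le> - (a * \<kappa>) * s t + C1 * (1 / m t * s t + (1 / m t)\<^sup>2 * (norm (b t) + 1 / m t * norm (v t)))"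
    proof (intro add_mono)
      show "- a * (b t \<bullet> P (b t)) - a * (v t \<bullet> \<Lambda> t (v t)) \<le> - (a * \<kappa>) * s t"
        using mult_left_mono[OF coercive[OF t], of a] a_pos by (simp add: algebra_simps)
      show "2 * (b t \<bullet> P (r t)) - 2 * (v t \<bullet> \<Lambda> t (X t (b t))) + 2 * (v t \<bullet> \<Lambda> t (y t))
        + (N t (b t) - a *\<^sub>R b t + r t) \<bullet> H t (v t)
        + b t \<bullet> H' t (v t) - b t \<bullet> H t (X t (b t)) + b t \<bullet> H t (y t)
        \<le> C1 * (1 / m t * s t + (1 / m t)\<^sup>2 * (norm (b t) + 1 / m t * norm (v t)))"
        unfolding C1_def s_def
        using m1[OF t] m0[OF t] K(1) a_pos
        by (intro fast_energy_error K y scale_le[OF K\<Lambda>(2)[OF t] K(2)] scale_le[OF KH(2)[OF t] K(3)]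
            scale_le[OF KH'(2)[OF t] K(4)] scale_le[OF Kr(2)[OF t] K(8)]
            order_trans[OF KN(2)[OF t] K(6)] order_trans[OF KX(2)[OF t] K(7)]) auto
    qed
    finally show ?thesis .
  qed
  have cross: "\<bar>b t \<bullet> H t (v t)\<bar> \<le> K * (1 / m t) * s t" if t: "t > t0" for t
  proof -
    have "norm (H t (v t)) \<le> (KH * (1 / m t)\<^sup>2) * norm (v t)"
      by (intro norm_blinfun_le KH t order_refl)
    also have "\<dots> \<le> (K * (1 / m t)\<^sup>2) * norm (v t)"
      using K(3) by (intro mult_right_mono) auto
    finally have "norm (b t) * norm (H t (v t)) \<le> norm (b t) * ((K * (1 / m t)\<^sup>2) * norm (v t))"
      by (intro mult_left_mono) auto
    also have "\<dots> = K * (1 / m t) * (norm (b t) * (1 / m t * norm (v t)))"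
      by (simp add: power2_eq_square)
    also have "\<dots> \<le> K * (1 / m t) * s t"
    proof (intro mult_left_mono)
      have "2 * (norm (b t) * (1 / m t * norm (v t))) \<le> s t"
        using sum_squares_bound[of "norm (b t)" "1 / m t * norm (v t)"] by (simp add: s_def mult.assoc)
      moreover have "0 \<le> norm (b t) * (1 / m t * norm (v t))" using m0[OF t] by simp
      ultimately show "norm (b t) * (1 / m t * norm (v t)) \<le> s t" by linarith
    qed (use K m0[OF t] in simp)
    finally show ?thesis using Cauchy_Schwarz_ineq2 order_trans by blast
  qed

  \<comment> \<open>Absorbing the error terms for large \<open>m\<close>\<close>
  \<comment> \<open>A quarter of the damping \<open>a * \<kappa>\<close>: one quarter absorbs the
    terms of relative size \<open>1 / m\<close>, one is spent on Young's inequality for the forcing,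
    and two remain.\<close>
  define d where "d = a * \<kappa> / 4"
  have d: "d > 0" using a_pos \<kappa> by (simp add: d_def)
  \<comment> \<open>The first threshold gives \<open>C1 / m \<le> d\<close>; the second bounds the
    cross term by half of the coercive part, so that \<open>W\<close> stays equivalent to
    \<open>s\<close>.\<close>
  obtain t1 where t1: "t1 \<ge> t0" "\<And>t. t > t1 \<Longrightarrow> max (C1 / d) (2 * K / \<kappa>) \<le> m t"
  proof -
    have "\<forall>\<^sub>F t in at_top. max (C1 / d) (2 * K / \<kappa>) \<le> m t"
      using lim by (simp only: m_def filterlim_at_top)
    then obtain N where "\<And>t. t \<ge> N \<Longrightarrow> max (C1 / d) (2 * K / \<kappa>) \<le> m t"
      unfolding eventually_at_top_linorder by blast
    then show ?thesis using that[of "max N t0"] by simp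
  qed
  have s0: "0 \<le> s t" for t by (simp add: s_def)
  have cross': "\<bar>b t \<bullet> H t (v t)\<bar> \<le> \<kappa> / 2 * s t" if t: "t > t1" for t
  proof -
    have "t > t0" using t t1(1) by simp
    have "K * (1 / m t) \<le> \<kappa> / 2"
      using t1(2)[OF t] m0[OF \<open>t > t0\<close>] \<kappa> by (simp add: field_simps)
    from mult_right_mono[OF this s0] cross[OF \<open>t > t0\<close>] show ?thesis by (rule order_trans[rotated])
  qed
  have W_low: "\<kappa> / 2 * s t \<le> W t" if t: "t > t1" for t
    using coercive[of t] cross'[OF t] t t1(1) by (simp add: W_def abs_le_iff)
  define K2 where "K2 = K + \<kappa> / 2"
  have K2: "K2 > 0" using K(1) \<kappa> by (simp add: K2_def)
  have W_up: "W t \<le> K2 * s t" if t: "t > t1" for t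
  proof -
    have "t > t0" using t t1(1) by simp
    have "b t \<bullet> P (b t) \<le> norm (b t) * (K * norm (b t))"
      by (intro inner_le_mult norm_blinfun_le K order_refl)
    moreover have "v t \<bullet> \<Lambda> t (v t) \<le> norm (v t) * ((K\<Lambda> * (1 / m t)\<^sup>2) * norm (v t))"
      by (intro inner_le_mult norm_blinfun_le K\<Lambda> order_refl \<open>t > t0\<close>)
    moreover have "norm (v t) * ((K\<Lambda> * (1 / m t)\<^sup>2) * norm (v t)) = K\<Lambda> * (1 / m t * norm (v t))\<^sup>2"
      by (simp add: power2_eq_square)
    moreover have "K\<Lambda> * (1 / m t * norm (v t))\<^sup>2 \<le> K * (1 / m t * norm (v t))\<^sup>2"
      using K(2) by (intro mult_right_mono) auto
    moreover have "b t \<bullet> H t (v t) \<le> \<kappa> / 2 * s t" using cross'[OF t] by simp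
    moreover have "K * s t = norm (b t) * (K * norm (b t)) + K * (1 / m t * norm (v t))\<^sup>2"
      by (simp add: s_def distrib_left power2_eq_square)
    ultimately show ?thesis unfolding W_def K2_def distrib_right by linarith
  qed
  have W'_final: "W' t \<le> - (2 * d / K2) * W t + (C1\<^sup>2 / (2 * d)) / m t ^ 4" if t: "t > t1" for t
  proof -
    have t': "t > t0" using t t1(1) by simp
    have "C1 * (1 / m t) \<le> d"
      using t1(2)[OF t] m0[OF t'] d by (simp add: field_simps)
    from mult_right_mono[OF this s0] have 1: "C1 * (1 / m t * s t) \<le> d * s t" by (simp add: mult.assoc)
    have young: "C1 * ((1 / m t)\<^sup>2 * z) \<le> d * z\<^sup>2 + C1\<^sup>2 / (4 * d) / m t ^ 4" for z
    proof -
      have "C1 * (w * z) \<le> d * z\<^sup>2 + C1\<^sup>2 / (4 * d) * w\<^sup>2" for w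
      proof -
        have "0 \<le> (2 * d * z - C1 * w)\<^sup>2 / (4 * d)" using d by simp
        also have "\<dots> = d * z\<^sup>2 - C1 * (w * z) + C1\<^sup>2 / (4 * d) * w\<^sup>2"
          using d by (simp add: power2_eq_square field_simps)
        finally show ?thesis by simp
      qed
      moreover have "((1 / m t)\<^sup>2)\<^sup>2 = 1 / m t ^ 4"
        by (simp add: power_one_over[symmetric] power_mult[symmetric])
      ultimately show ?thesis by (metis mult.right_neutral times_divide_eq_right)
    qed
    have "C1 * ((1 / m t)\<^sup>2 * (norm (b t) + 1 / m t * norm (v t))) \<le> d * s t + C1\<^sup>2 / (2 * d) / m t ^ 4"
      using young[of "norm (b t)"] young[of "1 / m t * norm (v t)"]
      by (simp add: s_def distrib_left)
    moreover have "W' t \<le> - (4 * d) * s t + (C1 * (1 / m t * s t)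
        + C1 * ((1 / m t)\<^sup>2 * (norm (b t) + 1 / m t * norm (v t))))"
      using W'_le[OF t'] unfolding distrib_left[of C1] by (simp add: d_def)
    ultimately have "W' t \<le> - (2 * d) * s t + C1\<^sup>2 / (2 * d) / m t ^ 4"
      using 1 by linarith
    moreover have "2 * d / K2 * W t \<le> 2 * d * s t"
      using mult_left_mono[OF W_up[OF t], of "2 * d / K2"] d K2 by simp
    ultimately show ?thesis by simp
  qed

  \<comment> \<open>Decay of the energy and the limit of the regressor term\<close>
  have W_lim: "((\<lambda>t. (m t)\<^sup>2 * W t) \<longlongrightarrow> 0) at_top"
  proof -
    have k: "2 * d / K2 > 0" using d K2 by simp
    then obtain C where C: "C \<ge> 0"
      "\<And>s t. 0 \<le> s \<Longrightarrow> s \<le> t \<Longrightarrow> m t \<le> C * exp ((2 * d / K2) / 8 * (t - s)) * m s"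
      using growth[of "(2 * d / K2) / 8"] by (auto simp: m_def)
    show ?thesis
    proof (rule forced_decay[of t1 W W' "2 * d / K2" "C1\<^sup>2 / (2 * d)" m C])
      show "0 \<le> W t" if "t > t1" for t
        using W_low[OF that] s0[of t] \<kappa> by (smt (verit) mult_nonneg_nonneg half_gt_zero)
      show "filterlim m at_top at_top" using lim by (simp add: m_def[abs_def])
    qed (use W_d W'_final k d C m0 t1(1) t0(1) in auto)
  qed
  have "((\<lambda>t. 2 / \<kappa> * ((m t)\<^sup>2 * W t)) \<longlongrightarrow> 0) at_top"
    using W_lim by (rule tendsto_mult_right_zero)
  then have "((\<lambda>t. (norm (v t))\<^sup>2) \<longlongrightarrow> 0) at_top"
  proof (rule tendsto_sandwich[OF _ _ tendsto_const, rotated 2])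
    show "\<forall>\<^sub>F t in at_top. (norm (v t))\<^sup>2 \<le> 2 / \<kappa> * ((m t)\<^sup>2 * W t)"
      using eventually_gt_at_top[of t1]
    proof eventually_elim
      case (elim t)
      then have "t > t0" using t1(1) by simp
      have "\<kappa> / 2 * (1 / m t * norm (v t))\<^sup>2 \<le> W t"
      proof -
        have "\<kappa> / 2 * (1 / m t * norm (v t))\<^sup>2 \<le> \<kappa> / 2 * s t"
          using \<kappa>(1) by (intro mult_left_mono) (auto simp: s_def)
        then show ?thesis using W_low[OF elim] by linarith
      qed
      then show ?case using \<kappa>(1) m0[OF \<open>t > t0\<close>] by (simp add: field_simps power2_eq_square)
    qed
  qed simp
  then have "((\<lambda>t. sqrt ((norm (v t))\<^sup>2)) \<longlongrightarrow> sqrt 0) at_top"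
    by (rule tendsto_real_sqrt)
  then have v_lim: "(v \<longlongrightarrow> 0) at_top"
    by (simp add: tendsto_norm_zero_iff)
  have "((\<lambda>t. KT * C\<sigma> / m t) \<longlongrightarrow> 0) at_top"
    using lim unfolding m_def
    by (intro tendsto_divide_0[OF tendsto_const] filterlim_at_top_imp_at_infinity)
  then have "((\<lambda>t. T t (\<sigma> t)) \<longlongrightarrow> 0) at_top"
  proof (rule Lim_null_comparison[rotated])
    show "\<forall>\<^sub>F t in at_top. norm (T t (\<sigma> t)) \<le> KT * C\<sigma> / m t"
      using eventually_gt_at_top[of t0]
    proof eventually_elim
      case (elim t)
      have "norm (T t (\<sigma> t)) \<le> (KT * (1 / m t)) * C\<sigma>"
        by (intro norm_blinfun_le KT elim \<sigma>_bound) (use elim t0(1) in simp)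
      then show ?case by simp
    qed
  qed
  from tendsto_add[OF v_lim this] show ?thesis by (simp add: v_def)
qed

theorem regressor_tendsto_0: "((\<lambda>t. em (e t) (\<sigma> t)) \<longlongrightarrow> 0) at_top"
  using dichotomy regressor_tendsto_0_bounded regressor_tendsto_0_unbounded by blast

end

subsection \<open>The error system of the observer\<close>

text \<open>Multiplication by the integrating factor \<open>exp (a * t)\<close> makes the solution
  constant.\<close>

lemma decay_equation_unique:
  assumes y: "solves_on_halfline y (\<lambda>t. - (a *\<^sub>R y t))" and t: "t \<ge> 0"
  shows "y t = exp (- a * t) *\<^sub>R y 0"
proof -
  have "solves_on_halfline (\<lambda>t. exp (a * t) *\<^sub>R y t) (\<lambda>t. 0)"
    unfolding solves_on_halfline_def
  proof (intro allI impI)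
    fix t :: real assume "t \<ge> 0"
    have "((\<lambda>t. exp (a * t)) has_real_derivative a * exp (a * t)) (at t within {0..})"
      by (auto intro!: derivative_eq_intros)
    from has_vector_derivative_scaleR[OF this y[unfolded solves_on_halfline_def, rule_format, OF \<open>t \<ge> 0\<close>]]
    show "((\<lambda>t. exp (a * t) *\<^sub>R y t) has_vector_derivative 0) (at t within {0..})"
      by (simp add: mult.commute)
  qed
  moreover have "solves_on_halfline (\<lambda>_. 0::real) (\<lambda>_. 0)"
    by (simp add: solves_on_halfline_def)
  ultimately have "norm (exp (a * t) *\<^sub>R y t - exp (a * 0) *\<^sub>R y 0) \<le> 0 - 0"
    by (rule solves_on_halfline_diff_bound) (use t in auto)
  then have y0: "y 0 = exp (a * t) *\<^sub>R y t" by simp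
  show ?thesis
    unfolding y0 by (simp add: exp_add[symmetric])
qed

lemma solves_on_halfline_add:
  "solves_on_halfline y r \<Longrightarrow> solves_on_halfline y' r' \<Longrightarrow>
    solves_on_halfline (\<lambda>t. y t + y' t) (\<lambda>t. r t + r' t)"
  unfolding solves_on_halfline_def by (auto intro: has_vector_derivative_add)

lemma solves_on_halfline_diff:
  "solves_on_halfline y r \<Longrightarrow> solves_on_halfline y' r' \<Longrightarrow>
    solves_on_halfline (\<lambda>t. y t - y' t) (\<lambda>t. r t - r' t)"
  unfolding solves_on_halfline_def by (auto intro: has_vector_derivative_diff)

lemma solves_on_halfline_cong:
  "solves_on_halfline y r \<Longrightarrow> (\<And>t. t \<ge> 0 \<Longrightarrow> r t = r' t) \<Longrightarrow> solves_on_halfline y r'"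
  unfolding solves_on_halfline_def by auto

lemma matrix_vector_mult_minus: "A *v (- v) = - (A *v v)" for A :: "real^'n^'m"
  using matrix_vector_mult_scaleR[of A "- 1" v] by simp

lemma block_row_mult_stack: "block_row A B *v stack v w = A *v v + B *v w"
proof -
  have "(\<Sum>k\<in>UNIV. block_row A B $ i $ k * stack v w $ k) = (A *v v) $ i + (B *v w) $ i" for i
    unfolding UNIV_Plus_UNIV[symmetric]
    by (subst sum.Plus) (simp_all add: block_row_def stack_def matrix_vector_mult_def)
  then show ?thesis by (simp add: vec_eq_iff matrix_vector_mult_def)
qed

lemma bounded_bilinear_obtain_blinfun:
  fixes f :: "'a::real_normed_vector \<Rightarrow> 'b::real_normed_vector \<Rightarrow> 'c::real_normed_vector"
  assumes f: "bounded_bilinear f"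
  obtains F :: "'a \<Rightarrow>\<^sub>L 'b \<Rightarrow>\<^sub>L 'c" where "\<And>x y. F x y = f x y"
proof -
  have f_eq: "f = (\<lambda>x y. Blinfun (f x) y)"
    by (simp add: fun_eq_iff bounded_linear_Blinfun_apply bounded_bilinear.bounded_linear_right[OF f])
  have "bounded_linear (\<lambda>x. Blinfun (f x))"
    using f transfer_bounded_bilinear_bounded_linearI[OF f_eq] by blast
  then show ?thesis
    using f_eq by (intro that[of "Blinfun (\<lambda>x. Blinfun (f x))"])
      (metis bounded_linear_Blinfun_apply)
qed

section \<open>Column stacking and the adaptive law\<close>

definition unvec :: "real^('b \<times> 'a) \<Rightarrow> real^'b^'a"
  where "unvec s = (\<chi> i j. s $ (j, i))"

lemma unvec_vec_cols [simp]: "unvec (vec_cols A) = A"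
  by (simp add: unvec_def vec_cols_def vec_eq_iff)

lemma vec_cols_unvec [simp]: "vec_cols (unvec s) = s"
  by (simp add: unvec_def vec_cols_def vec_eq_iff)

lemma vec_cols_diff: "vec_cols (A - B) = vec_cols A - vec_cols B"
  by (simp add: vec_cols_def vec_eq_iff)

text \<open>The column-stacked rank-one matrix \<open>y w^T\<close>. As a function of
  \<open>y\<close> it is the adjoint of \<open>s \<mapsto> unvec s *v w\<close>.\<close>

definition outer :: "real^'b \<Rightarrow> real^'a \<Rightarrow> real^('b \<times> 'a)"
  where "outer w y = (\<chi> s. w $ fst s * y $ snd s)"

lemma inner_unvec_mult: "y \<bullet> (unvec s *v w) = outer w y \<bullet> s"
proof -
  have "outer w y \<bullet> s = (\<Sum>k\<in>UNIV \<times> UNIV. w $ fst k * y $ snd k * s $ k)"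
    by (simp add: inner_vec_def outer_def)
  also have "\<dots> = (\<Sum>j\<in>UNIV. \<Sum>i\<in>UNIV. w $ j * y $ i * s $ (j, i))"
    by (simp add: sum.cartesian_product case_prod_unfold)
  also have "\<dots> = (\<Sum>i\<in>UNIV. \<Sum>j\<in>UNIV. w $ j * y $ i * s $ (j, i))"
    by (rule sum.swap)
  also have "\<dots> = y \<bullet> (unvec s *v w)"
    by (simp add: inner_vec_def matrix_vector_mult_def unvec_def sum_distrib_left mult_ac)
  finally show ?thesis by simp
qed

lemma norm_outer: "norm (outer w y) = norm w * norm y"
proof -
  have "outer w y \<bullet> outer w y = (\<Sum>k\<in>UNIV \<times> UNIV. (w $ fst k * w $ fst k) * (y $ snd k * y $ snd k))"
    by (simp add: inner_vec_def outer_def mult_ac)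
  also have "\<dots> = (w \<bullet> w) * (y \<bullet> y)"
    by (simp add: inner_vec_def sum_product sum.cartesian_product case_prod_unfold)
  finally show ?thesis by (simp add: norm_eq_sqrt_inner real_sqrt_mult)
qed

lemma bounded_bilinear_unvec_mult: "bounded_bilinear (\<lambda>w s. unvec s *v w)"
  unfolding bilinear_conv_bounded_bilinear[symmetric] bilinear_def
  by (auto intro!: linearI
      simp: vec_eq_iff unvec_def matrix_vector_mult_def algebra_simps sum.distrib sum_distrib_left)

lemma bounded_bilinear_outer: "bounded_bilinear outer"
  unfolding bilinear_conv_bounded_bilinear[symmetric] bilinear_def
  by (auto intro!: linearI simp: vec_eq_iff outer_def algebra_simps)

lemma inner_matrix_transpose: "y \<bullet> (A *v w) = (transpose A *v y) \<bullet> w" for A :: "real^'n^'m"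
  by (simp add: dot_lmul_matrix)

lemma full_column_rank_gram_pos:
  fixes D :: "real^'d^'n"
  assumes "full_column_rank D" "y \<noteq> 0"
  shows "0 < y \<bullet> ((transpose D ** D) *v y)"
proof -
  have "D *v y \<noteq> 0"
    using assms unfolding full_column_rank_def full_rank_injective
    by (metis injD matrix_vector_mult_0_right)
  moreover have "y \<bullet> ((transpose D ** D) *v y) = (D *v y) \<bullet> (D *v y)"
    by (metis inner_matrix_transpose inner_commute matrix_vector_mul_assoc)
  ultimately show ?thesis by simp
qed

text \<open>Full column rank makes the Gram matrix positive definite, hence injective and
  invertible, so the choice in \<open>matrix_inv\<close> yields a true inverse.\<close>

lemma left_pinv_mult:
  fixes D :: "real^'d^'n"
  assumes "full_column_rank D"
  shows "left_pinv D ** D = mat 1"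
proof -
  have "inj ((*v) (transpose D ** D))"
  proof (rule injI)
    fix x y assume "(transpose D ** D) *v x = (transpose D ** D) *v y"
    then have "(transpose D ** D) *v (x - y) = 0" by (simp add: matrix_vector_mult_diff_distrib)
    then show "x = y" using full_column_rank_gram_pos[OF assms, of "x - y"] by auto
  qed
  then have "\<exists>A. (transpose D ** D) ** A = mat 1 \<and> A ** (transpose D ** D) = mat 1"
    unfolding matrix_left_invertible_injective[symmetric] by (metis matrix_left_right_inverse)
  then have "matrix_inv (transpose D ** D) ** (transpose D ** D) = mat 1"
    unfolding matrix_inv_def by (rule someI2_ex) blast
  then show ?thesis by (simp add: left_pinv_def matrix_mul_assoc)
qed

text \<open>\<open>F\<close> recovers \<open>w\<close> from \<open>D w\<close>, which turns the
  Kronecker regressor into \<open>s \<mapsto> D (unvec s w)\<close>. Its transpose is read off by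
  testing against every \<open>s\<close>.\<close>

lemma adaptive_law_regressor:
  fixes D :: "real^'d^'n"
  assumes "F ** D = mat 1"
  shows "transpose (kron_row (rowvector (D *v w) ** transpose F) D) *v (D *v y)
    = outer w ((transpose D ** D) *v y)" (is "transpose ?K *v _ = _")
proof (rule vector_eq_ldot[THEN iffD1], intro allI)
  fix s :: "real^('d \<times> 'd)"
  have "(transpose ?K *v (D *v y)) \<bullet> s = (D *v y) \<bullet> (?K *v vec_cols (unvec s))"
    by (simp only: inner_matrix_transpose vec_cols_unvec)
  also have "?K *v vec_cols (unvec s) = D *v (unvec s *v ((F ** D) *v w))"
    by (simp only: kron_row_mult_vec_cols matrix_vector_mul_assoc matrix_mul_assoc)
  also have "(D *v y) \<bullet> (D *v (unvec s *v ((F ** D) *v w))) = ((transpose D ** D) *v y) \<bullet> (unvec s *v w)"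
    unfolding assms matrix_vector_mul_lid inner_matrix_transpose[of "D *v y" D]
    by (simp only: matrix_vector_mul_assoc)
  also have "\<dots> = outer w ((transpose D ** D) *v y) \<bullet> s"
    by (rule inner_unvec_mult)
  finally show "s \<bullet> (transpose ?K *v (D *v y)) = s \<bullet> outer w ((transpose D ** D) *v y)"
    by (simp only: inner_commute)
qed

theorem theorem1:
  fixes f :: "real^'n \<Rightarrow> real^'n"
    and g :: "real^'n \<Rightarrow> real^'m^'n"
    and D :: "real^'d^'n"
    and S :: "real^'d^'d"
    and \<theta> :: "real^'p^'n" and \<psi> :: "real^'q^'n"
    and \<xi> :: "real^'n \<Rightarrow> real^'p" and \<zeta> :: "real^'n \<Rightarrow> real^'m^'q"
    and \<phi> :: "real^('p + 'q)^'n"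
    and z :: "real^'n \<Rightarrow> real^'m \<Rightarrow> real^('p + 'q)"
    and a :: real
    and \<Gamma> :: "real^('d \<times> 'd)^('d \<times> 'd)"
    and F :: "real^'n^'d"
    and x :: "real \<Rightarrow> real^'n" and u :: "real \<Rightarrow> real^'m"
    and \<epsilon>\<^sub>T \<epsilon> :: "real \<Rightarrow> real^'d"
    and h :: "real \<Rightarrow> real^('p + 'q)"
    and l \<rho> \<epsilon>bar :: "real \<Rightarrow> real^'n"
    and Shat :: "real \<Rightarrow> real^'d^'d"
    and \<epsilon>\<^sub>That \<rho>\<^sub>\<Delta>hat \<epsilon>hat :: "real \<Rightarrow> real^'d"
    and \<epsilon>barhat xhat etilde :: "real \<Rightarrow> real^'n"
  \<comment> \<open>plant and disturbance generator\<close>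
  assumes "stabilizable f g" and "f 0 = 0"
    and "locally_lipschitz f" and "locally_lipschitz g"
    and "\<And>y. full_column_rank (g y)"
    and "imaginary_spectrum S"
    and "full_column_rank D"
    and "solves_on_halfline x (\<lambda>t. f (x t) + g (x t) *v u t + D *v \<epsilon>\<^sub>T t)"
    and "solves_on_halfline \<epsilon>\<^sub>T (\<lambda>t. S *v \<epsilon>\<^sub>T t)"
  \<comment> \<open>parametrization\<close>
    and "\<And>y. f y = \<theta> *v \<xi> y"
    and "\<And>y. g y = \<psi> ** \<zeta> y"
    and "\<phi> = block_row \<theta> \<psi>"
    and "\<And>y v. z y v = stack (\<xi> y) (\<zeta> y *v v)"
  \<comment> \<open>design parameters\<close>
    and "a > 0"
    and "symmetric_matrix \<Gamma>" and "positive_definite \<Gamma>"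
    and "F = left_pinv D"
  \<comment> \<open>filtered signals\<close>
    and "solves_on_halfline h (\<lambda>t. - (a *\<^sub>R h t) + z (x t) (u t))" and "h 0 = 0"
    and "solves_on_halfline l (\<lambda>t. - (a *\<^sub>R l t) + x t)" and "l 0 = 0"
    and "solves_on_halfline \<rho> (\<lambda>t. - (a *\<^sub>R \<rho> t))" and "\<rho> 0 = x 0"
    and "solves_on_halfline \<epsilon> (\<lambda>t. - (a *\<^sub>R \<epsilon> t) + \<epsilon>\<^sub>T t)" and "\<epsilon> 0 = 0"
    and "\<And>t. t \<ge> 0 \<Longrightarrow> \<epsilon>bar t = D *v \<epsilon> t"
  \<comment> \<open>disturbance observer\<close>
    and "\<And>t. t \<ge> 0 \<Longrightarrow> \<epsilon>\<^sub>That t = (Shat t + a *\<^sub>R mat 1) *v \<epsilon> t + \<rho>\<^sub>\<Delta>hat t"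
    and "solves_on_halfline \<rho>\<^sub>\<Delta>hat (\<lambda>t. - (a *\<^sub>R \<rho>\<^sub>\<Delta>hat t))" and "\<rho>\<^sub>\<Delta>hat 0 = \<epsilon>\<^sub>That 0"
  \<comment> \<open>auxiliary dynamics\<close>
    and "\<And>t. t \<ge> 0 \<Longrightarrow> xhat t = \<phi> *v h t + a *\<^sub>R l t + \<epsilon>barhat t + \<rho> t"
    and "solves_on_halfline \<epsilon>hat (\<lambda>t. - (a *\<^sub>R \<epsilon>hat t) + \<epsilon>\<^sub>That t)"
    and "\<And>t. t \<ge> 0 \<Longrightarrow> \<epsilon>barhat t = D *v \<epsilon>hat t"
  \<comment> \<open>adaptive law\<close>
    and "\<And>t. t \<ge> 0 \<Longrightarrow> etilde t = x t - xhat t"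
    and "solves_on_halfline (\<lambda>t. vec_cols (Shat t))
      (\<lambda>t. \<Gamma> *v (transpose (kron_row (rowvector (\<epsilon>bar t) ** transpose F) D) *v etilde t))"
  shows "((\<lambda>t. \<epsilon>\<^sub>T t - \<epsilon>\<^sub>That t) \<longlongrightarrow> 0) at_top"
proof -
  note x = assms(8) and \<epsilon>\<^sub>T = assms(9) and a = \<open>a > 0\<close> and h = assms(18) and l = assms(20)
    and \<rho> = assms(22) and \<epsilon> = assms(24) and \<rho>\<^sub>\<Delta> = assms(28) and \<epsilon>hat = assms(31)
  note mult = solves_on_halfline_linear[OF matrix_vector_mul_bounded_linear]
    and scale = solves_on_halfline_linear[OF bounded_linear_scaleR_right]
  have FD: "F ** D = mat 1" using left_pinv_mult[OF assms(7)] assms(17) by simp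

  \<comment> \<open>The defect in \<open>\<epsilon>\<^sub>T = (S + a I) \<epsilon>\<close>. As
    \<open>S\<close> commutes with the filter, it satisfies \<open>w' = - a w\<close>.\<close>
  define w where "w t = \<epsilon>\<^sub>T t - (S *v \<epsilon> t + a *\<^sub>R \<epsilon> t)" for t
  have "solves_on_halfline w (\<lambda>t. - (a *\<^sub>R w t))"
  proof (rule solves_on_halfline_cong)
    show "solves_on_halfline w (\<lambda>t. S *v \<epsilon>\<^sub>T t
        - (S *v (- (a *\<^sub>R \<epsilon> t) + \<epsilon>\<^sub>T t) + a *\<^sub>R (- (a *\<^sub>R \<epsilon> t) + \<epsilon>\<^sub>T t)))"
      unfolding w_def[abs_def]
      by (intro solves_on_halfline_diff solves_on_halfline_add mult[OF \<epsilon>] scale[OF \<epsilon>] \<epsilon>\<^sub>T)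
  qed (simp add: w_def matrix_vector_mult_scaleR matrix_vector_right_distrib
      matrix_vector_mult_diff_distrib scaleR_right_distrib scaleR_right_diff_distrib matrix_vector_mult_minus)
  note w_decay = decay_equation_unique[OF this]
  have w: "\<epsilon>\<^sub>T t = S *v \<epsilon> t + a *\<^sub>R \<epsilon> t + exp (- a * t) *\<^sub>R \<epsilon>\<^sub>T 0" if "t \<ge> 0" for t
  proof -
    have "\<epsilon>\<^sub>T t = S *v \<epsilon> t + a *\<^sub>R \<epsilon> t + w t" by (simp add: w_def)
    also have "w t = exp (- a * t) *\<^sub>R w 0" by (rule w_decay[OF that])
    also have "w 0 = \<epsilon>\<^sub>T 0" using \<open>\<epsilon> 0 = 0\<close> by (simp add: w_def)
    finally show ?thesis .
  qed
  have \<rho>\<^sub>\<Delta>_eq: "\<rho>\<^sub>\<Delta>hat t = exp (- a * t) *\<^sub>R \<rho>\<^sub>\<Delta>hat 0" if "t \<ge> 0" for t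
    by (rule decay_equation_unique[OF \<rho>\<^sub>\<Delta> that])

  \<comment> \<open>The defect in the filter representation of the state. It solves
    \<open>y' = - a y\<close> with \<open>y 0 = 0\<close>; its vanishing reduces the measured error
    to \<open>D (\<epsilon> - \<epsilon>hat)\<close>.\<close>
  define y where "y t = x t - (\<phi> *v h t + a *\<^sub>R l t + D *v \<epsilon> t + \<rho> t)" for t
  have plant: "f (x t) + g (x t) *v u t = \<phi> *v z (x t) (u t)" for t
    by (simp add: assms(10-13) block_row_mult_stack matrix_vector_mul_assoc)
  have "solves_on_halfline y (\<lambda>t. - (a *\<^sub>R y t))"
  proof (rule solves_on_halfline_cong)
    show "solves_on_halfline y (\<lambda>t. (f (x t) + g (x t) *v u t + D *v \<epsilon>\<^sub>T t)
        - (\<phi> *v (- (a *\<^sub>R h t) + z (x t) (u t)) + a *\<^sub>R (- (a *\<^sub>R l t) + x t)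
          + D *v (- (a *\<^sub>R \<epsilon> t) + \<epsilon>\<^sub>T t) + - (a *\<^sub>R \<rho> t)))"
      unfolding y_def[abs_def]
      by (intro solves_on_halfline_diff solves_on_halfline_add mult[OF \<epsilon>] mult[OF h] scale[OF l] \<rho> x)
  qed (simp add: plant, simp add: y_def matrix_vector_mult_scaleR matrix_vector_right_distrib
      matrix_vector_mult_diff_distrib scaleR_right_distrib scaleR_right_diff_distrib
      matrix_vector_mult_minus)
  note y_decay = decay_equation_unique[OF this]
  have y0: "y t = 0" if "t \<ge> 0" for t
  proof -
    have "y 0 = 0" using assms(19,21,23,25) by (simp add: y_def)
    then show ?thesis using y_decay[OF that] by simp
  qed
  have etilde: "etilde t = D *v (\<epsilon> t - \<epsilon>hat t)" if "t \<ge> 0" for t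
  proof -
    have "x t = \<phi> *v h t + a *\<^sub>R l t + D *v \<epsilon> t + \<rho> t"
      using y0[OF that] by (simp add: y_def)
    then show ?thesis
      unfolding assms(33)[OF that] assms(30)[OF that] assms(32)[OF that]
      by (simp add: matrix_vector_mult_diff_distrib)
  qed

  define q where "q t = \<epsilon> t - \<epsilon>hat t" for t
  define \<sigma> where "\<sigma> t = vec_cols (Shat t) - vec_cols S" for t
  define r0 where "r0 = \<epsilon>\<^sub>T 0 - \<rho>\<^sub>\<Delta>hat 0"
  \<comment> \<open>The defect \<open>w\<close> and \<open>\<rho>\<^sub>\<Delta>hat\<close> decay at
    the same rate \<open>a\<close>, so they merge into one exponential with coefficient
    \<open>r0\<close>.\<close>
  have error: "\<epsilon>\<^sub>T t - \<epsilon>\<^sub>That t = - (unvec (\<sigma> t) *v \<epsilon> t) + exp (- a * t) *\<^sub>R r0" if "t \<ge> 0" for t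
  proof -
    have "unvec (\<sigma> t) = Shat t - S" by (simp add: \<sigma>_def vec_cols_diff[symmetric])
    moreover have "(a *\<^sub>R mat 1) *v \<epsilon> t = a *\<^sub>R \<epsilon> t"
      by (simp add: scaleR_matrix_vector_assoc[symmetric])
    ultimately show ?thesis
      unfolding w[OF that] assms(27)[OF that] \<rho>\<^sub>\<Delta>_eq[OF that]
      by (simp add: r0_def matrix_vector_mult_diff_rdistrib matrix_vector_mult_add_rdistrib
          scaleR_right_diff_distrib)
  qed
  have q: "solves_on_halfline q (\<lambda>t. - (a *\<^sub>R q t) - unvec (\<sigma> t) *v \<epsilon> t + exp (- a * t) *\<^sub>R r0)"
  proof (rule solves_on_halfline_cong)
    show "solves_on_halfline q (\<lambda>t. (- (a *\<^sub>R \<epsilon> t) + \<epsilon>\<^sub>T t) - (- (a *\<^sub>R \<epsilon>hat t) + \<epsilon>\<^sub>That t))"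
      unfolding q_def[abs_def] by (intro solves_on_halfline_diff \<epsilon> \<epsilon>hat)
    show "(- (a *\<^sub>R \<epsilon> t) + \<epsilon>\<^sub>T t) - (- (a *\<^sub>R \<epsilon>hat t) + \<epsilon>\<^sub>That t)
        = - (a *\<^sub>R q t) - unvec (\<sigma> t) *v \<epsilon> t + exp (- a * t) *\<^sub>R r0" if "t \<ge> 0" for t
      using error[OF that] by (simp add: q_def algebra_simps)
  qed
  have \<sigma>: "solves_on_halfline \<sigma> (\<lambda>t. \<Gamma> *v outer (\<epsilon> t) ((transpose D ** D) *v q t))"
  proof (rule solves_on_halfline_cong)
    show "solves_on_halfline \<sigma> (\<lambda>t. \<Gamma> *v (transpose (kron_row (rowvector (\<epsilon>bar t) ** transpose F) D)
        *v etilde t) - 0)"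
      unfolding \<sigma>_def[abs_def]
      by (intro solves_on_halfline_diff assms(34)) (simp add: solves_on_halfline_def)
    show "\<Gamma> *v (transpose (kron_row (rowvector (\<epsilon>bar t) ** transpose F) D) *v etilde t) - 0
        = \<Gamma> *v outer (\<epsilon> t) ((transpose D ** D) *v q t)" if "t \<ge> 0" for t
      using adaptive_law_regressor[OF FD] that
      by (simp only: assms(26) etilde q_def[symmetric] diff_zero)
  qed

  obtain em :: "(real^'d) \<Rightarrow>\<^sub>L (real^('d \<times> 'd)) \<Rightarrow>\<^sub>L (real^'d)" where em: "\<And>e s. em e s = unvec s *v e"
    by (rule bounded_bilinear_obtain_blinfun[OF bounded_bilinear_unvec_mult]) (rule that; assumption)
  obtain ad :: "(real^'d) \<Rightarrow>\<^sub>L (real^'d) \<Rightarrow>\<^sub>L (real^('d \<times> 'd))" where ad: "\<And>e y. ad e y = outer e y"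
    by (rule bounded_bilinear_obtain_blinfun[OF bounded_bilinear_outer]) (rule that; assumption)
  have matrix_blinfun: "blinfun_apply (Blinfun ((*v) A)) = (*v) A" for A :: "real^'j^'k"
    by (rule bounded_linear_Blinfun_apply) simp
  \<comment> \<open>Invertibility of \<open>S + a I\<close> gives its inverse \<open>M\<close>, by
    which \<open>\<epsilon>\<close> is recovered from \<open>\<epsilon>\<^sub>T\<close> up to an
    exponential.\<close>
  have "linear (\<lambda>v. S *v v + a *\<^sub>R v)"
    by (auto intro!: linearI simp: algebra_simps matrix_vector_right_distrib matrix_vector_mult_scaleR)
  moreover have "inj (\<lambda>v. S *v v + a *\<^sub>R v)"
  proof (rule injI)
    fix v v' assume eq: "S *v v + a *\<^sub>R v = S *v v' + a *\<^sub>R v'"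
    have "S *v (v - v') + a *\<^sub>R (v - v') = (S *v v + a *\<^sub>R v) - (S *v v' + a *\<^sub>R v')"
      by (simp add: matrix_vector_mult_diff_distrib scaleR_right_diff_distrib)
    then have "S *v (v - v') + a *\<^sub>R (v - v') = 0"
      unfolding eq by simp
    from imaginary_spectrum_shift_injective[OF assms(6) less_imp_neq[OF a, symmetric] this]
    show "v = v'" by simp
  qed
  ultimately obtain M where M: "linear M" "\<And>v. M (S *v v + a *\<^sub>R v) = v"
    using linear_injective_isomorphism[of "\<lambda>v. S *v v + a *\<^sub>R v"] by blast
  have M_blinfun: "blinfun_apply (Blinfun M) = M"
    using M(1) by (simp add: bounded_linear_Blinfun_apply linear_conv_bounded_linear[symmetric])
  obtain B where B: "\<And>v. norm (S *v v + a *\<^sub>R v) \<le> B * norm v"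
    using linear_bounded[OF \<open>linear (\<lambda>v. S *v v + a *\<^sub>R v)\<close>] by blast

  \<comment> \<open>The constant \<open>\<bar>B\<bar> + norm (\<epsilon>\<^sub>T 0)\<close> covers
    both the operator \<open>S + a I\<close> and the exponential remainder;
    \<open>- M (\<epsilon>\<^sub>T 0)\<close> is the remainder after applying
    \<open>M\<close>.\<close>
  have "adaptive em ad (Blinfun ((*v) (transpose D ** D))) (Blinfun ((*v) \<Gamma>)) (Blinfun ((*v) S))
      (Blinfun M) a (\<bar>B\<bar> + norm (\<epsilon>\<^sub>T 0)) q \<sigma> \<epsilon>\<^sub>T \<epsilon> r0 (- M (\<epsilon>\<^sub>T 0))"
  proof (unfold_locales, unfold em ad matrix_blinfun M_blinfun)
    show "y \<bullet> (unvec s *v v) = outer v y \<bullet> s" for y v s by (rule inner_unvec_mult)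
    show "norm (outer v y) = norm v * norm y" for v y by (rule norm_outer)
    show "y \<bullet> ((transpose D ** D) *v y') = ((transpose D ** D) *v y) \<bullet> y'" for y y'
      by (metis inner_matrix_transpose matrix_transpose_mul transpose_transpose)
    show "y \<noteq> 0 \<Longrightarrow> 0 < y \<bullet> ((transpose D ** D) *v y)" for y
      by (rule full_column_rank_gram_pos[OF assms(7)])
    show "s \<bullet> (\<Gamma> *v s') = (\<Gamma> *v s) \<bullet> s'" for s s'
      using assms(15) inner_matrix_transpose[of s \<Gamma> s'] by (simp only: symmetric_matrix_def)
    show "s \<noteq> 0 \<Longrightarrow> 0 < s \<bullet> (\<Gamma> *v s)" for s
      using assms(16) by (simp add: positive_definite_def)
    show "a > 0" by (rule a)
    show "(q has_vector_derivative - (a *\<^sub>R q t) - unvec (\<sigma> t) *v \<epsilon> t + exp (- a * t) *\<^sub>R r0) (at t)"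
      if "t > 0" for t
      by (rule solves_on_halfline_interior[OF q that])
    show "(\<sigma> has_vector_derivative \<Gamma> *v outer (\<epsilon> t) ((transpose D ** D) *v q t)) (at t)" if "t > 0" for t
      by (rule solves_on_halfline_interior[OF \<sigma> that])
    show "(\<epsilon>\<^sub>T has_vector_derivative S *v \<epsilon>\<^sub>T t) (at t)" if "t > 0" for t
      by (rule solves_on_halfline_interior[OF \<epsilon>\<^sub>T that])
    show "\<epsilon> t = M (\<epsilon>\<^sub>T t) + exp (- a * t) *\<^sub>R (- M (\<epsilon>\<^sub>T 0))" if "t > 0" for t
    proof -
      have "M (\<epsilon>\<^sub>T t) = \<epsilon> t + exp (- a * t) *\<^sub>R M (\<epsilon>\<^sub>T 0)"
        unfolding w[OF less_imp_le[OF that]] linear_add[OF M(1), of "S *v \<epsilon> t + a *\<^sub>R \<epsilon> t"]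
        by (simp add: M(2) linear_scale[OF M(1)])
      then show ?thesis by simp
    qed
    show "norm (\<epsilon>\<^sub>T t) \<le> (\<bar>B\<bar> + norm (\<epsilon>\<^sub>T 0)) * (norm (\<epsilon> t) + 1)" if "t > 0" for t
    proof -
      have "norm (\<epsilon>\<^sub>T t) \<le> norm (S *v \<epsilon> t + a *\<^sub>R \<epsilon> t) + norm (exp (- a * t) *\<^sub>R \<epsilon>\<^sub>T 0)"
        using w[of t] that norm_triangle_ineq by (metis less_imp_le)
      also have "\<dots> \<le> \<bar>B\<bar> * norm (\<epsilon> t) + norm (\<epsilon>\<^sub>T 0)"
      proof (rule add_mono)
        show "norm (S *v \<epsilon> t + a *\<^sub>R \<epsilon> t) \<le> \<bar>B\<bar> * norm (\<epsilon> t)"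
          by (rule order_trans[OF B]) (simp add: mult_right_mono)
        show "norm (exp (- a * t) *\<^sub>R \<epsilon>\<^sub>T 0) \<le> norm (\<epsilon>\<^sub>T 0)"
          using mult_right_mono[of "exp (- a * t)" 1 "norm (\<epsilon>\<^sub>T 0)"] a that by simp
      qed
      also have "\<dots> \<le> (\<bar>B\<bar> + norm (\<epsilon>\<^sub>T 0)) * (norm (\<epsilon> t) + 1)"
        by (simp add: algebra_simps)
      finally show ?thesis .
    qed
    show "\<exists>C\<ge>0. \<forall>s t. 0 \<le> s \<longrightarrow> s \<le> t \<longrightarrow> norm (\<epsilon>\<^sub>T t) \<le> C * exp (\<delta> * (t - s)) * norm (\<epsilon>\<^sub>T s)"
      if \<delta>: "\<delta> > 0" for \<delta>
    proof -
      obtain C where "C \<ge> 0" "\<And>y s t. solves_on_halfline y (\<lambda>t. S *v y t) \<Longrightarrow> 0 \<le> s \<Longrightarrow> s \<le> t \<Longrightarrow>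
          norm (y t) \<le> C * exp (\<delta> * (t - s)) * norm (y s)"
        by (rule imaginary_spectrum_growth[OF assms(6) \<delta>]) (rule that; assumption)
      then show ?thesis using \<epsilon>\<^sub>T by blast
    qed
    show "(\<exists>C. \<forall>t\<ge>0. norm (\<epsilon>\<^sub>T t) \<le> C) \<or> filterlim (\<lambda>t. norm (\<epsilon>\<^sub>T t)) at_top at_top"
      by (rule imaginary_spectrum_bounded_or_unbounded[OF assms(6) \<epsilon>\<^sub>T])
  qed
  from adaptive.regressor_tendsto_0[OF this]
  have lim: "((\<lambda>t. unvec (\<sigma> t) *v \<epsilon> t) \<longlongrightarrow> 0) at_top" by (simp only: em)
  have "((\<lambda>t. exp (- a * t)) \<longlongrightarrow> 0) at_top" using a by real_asymp
  from tendsto_add[OF tendsto_minus[OF lim] tendsto_scaleR[OF this tendsto_const[of r0]]]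
  have "((\<lambda>t. - (unvec (\<sigma> t) *v \<epsilon> t) + exp (- a * t) *\<^sub>R r0) \<longlongrightarrow> 0) at_top" by simp
  then show ?thesis
  proof (rule Lim_transform_eventually)
    show "\<forall>\<^sub>F t in at_top. - (unvec (\<sigma> t) *v \<epsilon> t) + exp (- a * t) *\<^sub>R r0 = \<epsilon>\<^sub>T t - \<epsilon>\<^sub>That t"
      using eventually_ge_at_top[of 0] by eventually_elim (rule error[symmetric])
  qed
qed

end
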